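(* Let $S$ be a compact metric space, $\nu_0$ a probability measure on $S$, $0<\alpha<1$ and $\theta>-\alpha$. For any $f$ in $B_+(S)$, let $\widetilde{PD}(\alpha,\theta)$ denote the image law of the two-parameter Poisson–Dirichlet distribution $PD(\alpha,\theta)$ under the map $S_{f,\nu_0}$. Then $\widetilde{PD}(\alpha,\theta)$ and $PD(\alpha,\theta)$ are mutually absolutely continuous and $$\frac{d\,\widetilde{PD}(\alpha,\theta)}{d\,PD(\alpha,\theta)}(\mathbf{p})=\langle\nu_0,f^\alpha\rangle^{-\theta/\alpha}\,\frac{1}{\Gamma(\theta)}\int_0^\infty u^{\theta-1}\prod_{i=1}^\infty E^{\nu_\alpha}\big[e^{-u f^{-1}(\xi_i)p_i}\big]\,du,$$ where $\nu_\alpha(ds)=f^\alpha(s)\nu_0(ds)/\langle\nu_0,f^\alpha\rangle$ and under $E^{\nu_\alpha}$ each $\xi_i$ has distribution $\nu_\alpha$.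
   Context: $B_+(S)$ is the collection of positive Borel measurable functions on $S$ with strictly positive lower bound; $f^{-1}=1/f$; $\langle\mu,g\rangle=\int g\,d\mu$. Let $\nabla_\infty=\{\mathbf{p}=(p_1,p_2,\ldots):p_1\ge p_2\ge\cdots\ge0,\ \sum_{j=1}^\infty p_j=1\}$ with the subspace topology of the infinite-dimensional Euclidean space. For $0<\alpha<1$, $\theta>-\alpha$, let $U_1,U_2,\ldots$ be independent with $U_i\sim Beta(1-\alpha,\theta+i\alpha)$ and let $V_1=U_1$, $V_n=(1-U_1)\cdots(1-U_{n-1})U_n$ for $n\ge2$. $PD(\alpha,\theta)$ is the law of $(V_1,V_2,\ldots)$ arranged in descending order. For an i.i.d. sequence $\xi_1,\xi_2,\ldots$ with common distribution $\nu_0$, the (random) map $S_{f,\nu_0}:\nabla_\infty\to\nabla_\infty$ sends $(p_1,p_2,\ldots)$ to the descending order statistics of $\left(\frac{f(\xi_1)p_1}{\sum_i f(\xi_i)p_i},\frac{f(\xi_2)p_2}{\sum_i f(\xi_i)p_i},\ldots\right)$. The image law is taken with the sequence $(\xi_i)$ independent of the $PD(\alpha,\theta)$-distributed sequence.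
   Formalization: For −α<θ≤0 the displayed integral diverges at u=0, so (1/Γ(θ))∫… is read as its analytic continuation in θ (for θ=0 the value 1); also ⟨ν_0,f^α⟩<∞ is assumed, without which ν_α and the map S_{f,ν_0} are undefined. *)

theory Defs
  imports "HOL-Probability.Probability"
begin

text \<open>Sequences are indexed from 0, so \<open>p i\<close> stands for \<open>p\<^sub>i\<^sub>+\<^sub>1\<close>.\<close>

definition nabla :: "(nat \<Rightarrow> real) set" where
  "nabla = {p. decseq p \<and> (\<forall>i. 0 \<le> p i) \<and> p sums 1}"

definition B_plus :: "('s::topological_space \<Rightarrow> real) set" where
  "B_plus = {f \<in> borel_measurable borel. \<exists>c>0. \<forall>s. c \<le> f s}"

text \<open>Descending order statistics: \<open>desc v n\<close> is the \<open>(n + 1)\<close>-st largest value of \<open>v\<close>, counted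
  with multiplicity. This is meant for non-negative null sequences. If \<open>v\<close> has
  infinitely many positive terms, its zero terms are dropped.\<close>

definition desc :: "(nat \<Rightarrow> real) \<Rightarrow> nat \<Rightarrow> real" where
  "desc v n = Sup {x. \<exists>A. finite A \<and> card A = Suc n \<and> (\<forall>i\<in>A. x \<le> v i)}"

lemma desc_eq_rearrangement:
  assumes "bij \<pi>" "decseq (v \<circ> \<pi>)"
  shows "desc v = v \<circ> \<pi>"
proof
  fix n
  have "{x. \<exists>A. finite A \<and> card A = Suc n \<and> (\<forall>i\<in>A. x \<le> v i)} = {..v (\<pi> n)}"
  proof (intro equalityI subsetI)
    fix x assume "x \<in> {x. \<exists>A. finite A \<and> card A = Suc n \<and> (\<forall>i\<in>A. x \<le> v i)}"
    then obtain A where A: "finite A" "card A = Suc n" "\<And>i. i \<in> A \<Longrightarrow> x \<le> v i" by auto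
    have "\<not> A \<subseteq> \<pi> ` {..<n}"
      using card_mono[of "\<pi> ` {..<n}" A] card_image_le[of "{..<n}" \<pi>] A(2) by auto
    then obtain i where i: "i \<in> A" "i \<notin> \<pi> ` {..<n}" by auto
    obtain m where m: "i = \<pi> m" using assms(1) by (metis bij_pointE)
    then have "n \<le> m" using i(2) by (meson imageI lessThan_iff not_le)
    then have "v (\<pi> m) \<le> v (\<pi> n)" using decseqD[OF assms(2)] by auto
    then show "x \<in> {..v (\<pi> n)}" using A(3)[OF i(1)] m by auto
  next
    fix x assume x: "x \<in> {..v (\<pi> n)}"
    have "x \<le> v i" if i: "i \<in> \<pi> ` {..n}" for i
    proof -
      obtain m where "i = \<pi> m" "m \<le> n" using i by auto
      then show ?thesis using decseqD[OF assms(2), of m n] x by auto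
    qed
    moreover have "card (\<pi> ` {..n}) = Suc n"
      using assms(1) by (simp add: card_image bij_is_inj inj_on_subset[of \<pi> UNIV])
    ultimately show "x \<in> {x. \<exists>A. finite A \<and> card A = Suc n \<and> (\<forall>i\<in>A. x \<le> v i)}"
      by (intro CollectI exI[of _ "\<pi> ` {..n}"]) auto
  qed
  then show "desc v n = (v \<circ> \<pi>) n" by (simp add: desc_def)
qed

definition beta_measure :: "real \<Rightarrow> real \<Rightarrow> real measure" where
  "beta_measure a b = density lborel
     (\<lambda>x. ennreal (indicator {0<..<1} x * (x powr (a - 1) * (1 - x) powr (b - 1) / Beta a b)))"

definition stick_breaking :: "(nat \<Rightarrow> real) \<Rightarrow> nat \<Rightarrow> real" where
  "stick_breaking U n = (\<Prod>i<n. 1 - U i) * U n"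

text \<open>The Poisson--Dirichlet law lives on \<open>nabla\<close> with the Borel sets of the product topology. The
  restriction to \<open>nabla\<close> is needed because the stick-breaking weights sum to 1 only almost surely;
  it discards a null set.\<close>

definition PD :: "real \<Rightarrow> real \<Rightarrow> (nat \<Rightarrow> real) measure" where
  "PD \<alpha> \<theta> = restrict_space
     (distr (\<Pi>\<^sub>M i\<in>UNIV. beta_measure (1 - \<alpha>) (\<theta> + real (Suc i) * \<alpha>)) borel
        (\<lambda>U. desc (stick_breaking U)))
     nabla"

definition S_map :: "('s \<Rightarrow> real) \<Rightarrow> (nat \<Rightarrow> 's) \<Rightarrow> (nat \<Rightarrow> real) \<Rightarrow> nat \<Rightarrow> real" where
  "S_map f \<xi> p = desc (\<lambda>i. f (\<xi> i) * p i / (\<Sum>j. f (\<xi> j) * p j))"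

text \<open>Law of \<open>S_map f \<xi> p\<close> for independent \<open>p\<close> of law \<open>\<mu>\<close> and i.i.d. \<open>\<xi>\<^sub>i\<close> of law \<open>\<nu>\<close>, as a measure
  on \<open>nabla\<close>. For unbounded \<open>f\<close> the normalising series may diverge on a null set, which
  the restriction to \<open>nabla\<close> discards.\<close>

definition S_image :: "('s \<Rightarrow> real) \<Rightarrow> 's measure \<Rightarrow> (nat \<Rightarrow> real) measure \<Rightarrow> (nat \<Rightarrow> real) measure" where
  "S_image f \<nu> \<mu> = restrict_space
     (distr (\<mu> \<Otimes>\<^sub>M (\<Pi>\<^sub>M i\<in>(UNIV::nat set). \<nu>)) borel (\<lambda>(p, \<xi>). S_map f \<xi> p))
     nabla"

definition tilted :: "('s \<Rightarrow> real) \<Rightarrow> real \<Rightarrow> 's measure \<Rightarrow> 's measure" where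
  "tilted f \<alpha> \<nu> = density \<nu> (\<lambda>s. ennreal (f s powr \<alpha> / (\<integral>t. f t powr \<alpha> \<partial>\<nu>)))"

text \<open>The expression \<open>1/\<Gamma>(\<theta>) \<integral>\<^sub>0\<^sup>\<infinity> u\<^sup>\<theta>\<^sup>-\<^sup>1 \<phi>(u) du\<close>, for a non-increasing \<open>\<phi> \<ge> 0\<close>
  on \<open>[0, \<infinity>)\<close>. For \<open>\<theta> > 0\<close> it is taken literally. For \<open>-1 < \<theta> \<le> 0\<close> the integral diverges at 0 when
  \<open>\<phi> 0 > 0\<close>, and the expression denotes its analytic continuation in \<open>\<theta>\<close>: the
  Cauchy--Saalschuetz integral \<open>1/\<Gamma>(\<theta>) \<integral>\<^sub>0\<^sup>\<infinity> u\<^sup>\<theta>\<^sup>-\<^sup>1 (\<phi>(u) - \<phi>(0)) du\<close> for \<open>\<theta> < 0\<close>, where both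
  factors are non-positive, and \<open>\<phi>(0)\<close> for \<open>\<theta> = 0\<close>. With \<open>\<phi>(u) = e\<^sup>-\<^sup>c\<^sup>u\<close>, \<open>c > 0\<close>, all three cases
  give \<open>c\<^sup>-\<^sup>\<theta>\<close>.\<close>

definition gamma_mellin :: "real \<Rightarrow> (real \<Rightarrow> real) \<Rightarrow> ennreal" where
  "gamma_mellin \<theta> \<phi> =
     (if \<theta> > 0 then ennreal (1 / Gamma \<theta>) * (\<integral>\<^sup>+u\<in>{0<..}. ennreal (u powr (\<theta> - 1) * \<phi> u) \<partial>lborel)
      else if \<theta> = 0 then ennreal (\<phi> 0)
      else ennreal (- 1 / Gamma \<theta>) *
             (\<integral>\<^sup>+u\<in>{0<..}. ennreal (u powr (\<theta> - 1) * (\<phi> 0 - \<phi> u)) \<partial>lborel))"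

end

theory Submission
  imports Defs
begin

text \<open>
  The law of a stick-breaking sequence \<open>V\<close> is determined by the functionals
  \<open>\<Psi>\<^sub>\<theta>(u) = E \<Prod>\<^sub>i \<rho>(u V\<^sub>i)\<close> with \<open>0 \<le> \<rho> \<le> 1\<close>. Splitting off the first stick turns the beta density
  into a convolution, so that the Laplace transform of \<open>u\<^sup>\<theta> \<Psi>\<^sub>\<theta>(u)\<close> is expressed through that of
  \<open>u\<^sup>\<theta>\<^sup>+\<^sup>\<alpha>\<^sup>-\<^sup>1 \<Psi>\<^sub>\<theta>\<^sub>+\<^sub>\<alpha>(u)\<close>. The powers \<open>\<Phi>\<^sup>-\<^sup>\<theta>\<^sup>/\<^sup>\<alpha>\<close> of the Laplace exponent
  \<open>\<Phi>(s) = \<alpha>/\<Gamma>(1 - \<alpha>) \<integral> (1 - e\<^sup>-\<^sup>s\<^sup>x \<rho>(x)) x\<^sup>-\<^sup>\<alpha>\<^sup>-\<^sup>1 dx\<close> solve the same recursion in \<open>\<theta>\<close>, and iterating it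
  contracts the difference of two solutions to 0. This identifies \<open>\<Psi>\<^sub>\<theta>\<close> without Poisson processes.

  To compare the image law with the candidate density, both are integrated against \<open>\<Prod>\<^sub>i \<rho>(t p\<^sub>i)\<close> and the
  measure \<open>(e\<^sup>-\<^sup>t - e\<^sup>-\<^sup>2\<^sup>t) dt/t\<close>, and a second scale \<open>u\<close> with weight \<open>u\<^sup>\<theta>\<^sup>-\<^sup>1 (e\<^sup>-\<^sup>u - e\<^sup>-\<^sup>2\<^sup>u)\<close> is
  introduced. In the variables \<open>u\<close> and \<open>s = t / (u \<Sum>\<^sub>i f(\<xi>\<^sub>i) p\<^sub>i)\<close> the random normalisation disappears and
  everything becomes a second difference of \<open>\<Phi>\<^sup>-\<^sup>\<theta>\<^sup>/\<^sup>\<alpha>\<close>; rescaling the jumps by \<open>f\<close> multiplies \<open>\<Phi>\<close> by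
  \<open>s\<^sup>\<alpha> \<langle>\<nu>\<^sub>0, f\<^sup>\<alpha>\<rangle>\<close>, tilts \<open>\<nu>\<^sub>0\<close> to \<open>\<nu>\<^sub>\<alpha>\<close> and replaces \<open>s\<close> by \<open>1/s\<close>. The functionals determine a
  measure on \<open>nabla\<close> because they contain the joint generating functions of the numbers of \<open>t p\<^sub>i\<close> above
  given levels.
\<close>

section \<open>Infinite products and descending rearrangements\<close>

text \<open>Comparing the two solutions hinges on one extra power of s. To leading order both equal
  \<open>s powr (- \<eta>)\<close>, and the recursion carries this order from \<eta> + \<alpha> to
  \<eta> with factor exactly 1, so an error of that order would never shrink. If 1 - \<rho>(x) \<le>
  C x, the solutions differ only at order \<open>s powr (- \<eta> - 1)\<close>. There a step costs
  the factor (\<eta> + \<alpha>) / (\<eta> + 1), the mean fraction of the stick left after a break,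
  and these products tend to 0 because the harmonic series diverges. The Lipschitz bound can fail
  for factors averaged over the marks, since f^\<alpha> is integrable but f need not be; hence the
  passage to a limit afterwards. Differences of two exponentials replace a single one because they
  make the weights integrable at 0 for all \<theta> > -1, so that \<theta> \<le> 0 is covered by the
  same comparison. The integral in the density is the mean of T^(-\<theta>) with T the sum of p_i /
  f(\<xi>_i), and the comparison is carried out with this mean.\<close>

definition iprod :: "(nat \<Rightarrow> real) \<Rightarrow> real" where
  "iprod a = lim (\<lambda>n. \<Prod>i<n. a i)"

lemma borel_measurable_iprod [measurable (raw)]:
  assumes "\<And>i. (\<lambda>x. a x i) \<in> borel_measurable M"
  shows "(\<lambda>x. iprod (a x)) \<in> borel_measurable M"
  unfolding iprod_def using assms by measurable

context
  fixes a :: "nat \<Rightarrow> real"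
  assumes a: "\<And>i. a i \<in> {0..1}"
begin

lemma prod_unit_range: "(\<Prod>i\<in>I. a i) \<in> {0..1}"
  using a by (auto intro!: prod_nonneg prod_le_1)

lemma decseq_prod_unit: "decseq (\<lambda>n. \<Prod>i<n. a i)"
  by (rule decseq_SucI) (use a prod_unit_range in \<open>auto intro!: mult_right_le_one_le\<close>)

lemma iprod_LIMSEQ: "(\<lambda>n. \<Prod>i<n. a i) \<longlonglongrightarrow> iprod a"
proof -
  have "convergent (\<lambda>n. \<Prod>i<n. a i)"
    using decseq_convergent[OF decseq_prod_unit, of 0] prod_unit_range
    by (metis atLeastAtMost_iff convergentI)
  then show ?thesis unfolding iprod_def by (simp add: convergent_LIMSEQ_iff)
qed

lemma iprod_le_prod: "iprod a \<le> (\<Prod>i<n. a i)"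
  using decseq_ge[OF decseq_prod_unit iprod_LIMSEQ] .

lemma iprod_range: "iprod a \<in> {0..1}"
  using iprod_le_prod[of 0] LIMSEQ_le_const[OF iprod_LIMSEQ, of 0] prod_unit_range by auto

end

lemma iprod_Suc:
  assumes a: "\<And>i. a i \<in> {0..1}"
  shows "iprod a = a 0 * iprod (\<lambda>i. a (Suc i))"
proof -
  have "(\<lambda>n. a 0 * (\<Prod>i<n. a (Suc i))) \<longlonglongrightarrow> iprod a"
    using LIMSEQ_Suc[OF iprod_LIMSEQ[OF a]] by (simp add: prod.lessThan_Suc_shift del: prod.lessThan_Suc)
  moreover have "(\<lambda>n. a 0 * (\<Prod>i<n. a (Suc i))) \<longlonglongrightarrow> a 0 * iprod (\<lambda>i. a (Suc i))"
    by (intro tendsto_mult_left iprod_LIMSEQ a)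
  ultimately show ?thesis by (rule LIMSEQ_unique)
qed

text \<open>An injection selects a subfamily of the factors, and the omitted ones are at most 1. For
  a bijection the inverse gives the reverse inequality, so the product does not depend on the
  order.\<close>

lemma iprod_le_comp:
  assumes a: "\<And>i. a i \<in> {0..1}" and "inj \<pi>"
  shows "iprod a \<le> iprod (a \<circ> \<pi>)"
proof -
  have "(\<lambda>n. \<Prod>i<n. (a \<circ> \<pi>) i) \<longlonglongrightarrow> iprod (a \<circ> \<pi>)"
    by (rule iprod_LIMSEQ) (use a in simp)
  moreover have "iprod a \<le> (\<Prod>i<n. (a \<circ> \<pi>) i)" for n
  proof -
    obtain m where m: "\<pi> ` {..<n} \<subseteq> {..<m}"
      using finite_nat_iff_bounded by (meson finite_imageI finite_lessThan)
    have "iprod a \<le> (\<Prod>i<m. a i)" by (rule iprod_le_prod[OF a])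
    also have "\<dots> = (\<Prod>i\<in>\<pi> ` {..<n}. a i) * (\<Prod>i\<in>{..<m} - \<pi> ` {..<n}. a i)"
      using prod.subset_diff[OF m, of a] by (simp add: mult.commute)
    also have "\<dots> \<le> (\<Prod>i\<in>\<pi> ` {..<n}. a i)"
      using prod_unit_range[OF a] by (auto intro!: mult_right_le_one_le)
    also have "\<dots> = (\<Prod>i<n. (a \<circ> \<pi>) i)"
      using assms(2) by (subst prod.reindex) (auto intro: inj_on_subset)
    finally show ?thesis .
  qed
  ultimately show ?thesis by (intro LIMSEQ_le_const) auto
qed

text \<open>Weierstrass' product inequality. It yields the first-order lower bound on
  \<open>Psi\<close> near 0.\<close>

lemma iprod_ge_one_minus:
  assumes a: "\<And>i. a i \<in> {0..1}" and sum: "\<And>n. (\<Sum>i<n. 1 - a i) \<le> c"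
  shows "1 - c \<le> iprod a"
proof -
  have "1 - (\<Sum>i<n. 1 - a i) \<le> (\<Prod>i<n. a i)" for n
  proof (induction n)
    case (Suc n)
    have "(1 - a n) * (\<Prod>i<n. a i) \<le> 1 - a n"
      using a[of n] prod_unit_range[of a, OF a, of "{..<n}"] by (intro mult_right_le_one_le) auto
    then show ?case using Suc by (simp add: algebra_simps)
  qed simp
  then have "1 - c \<le> (\<Prod>i<n. a i)" for n using sum[of n] by (smt (verit))
  then show ?thesis by (intro LIMSEQ_le_const[OF iprod_LIMSEQ[OF a]]) auto
qed

lemma iprod_bij:
  assumes "\<And>i. a i \<in> {0..1}" "bij \<pi>"
  shows "iprod (a \<circ> \<pi>) = iprod a"
proof (rule antisym)
  have "iprod (a \<circ> \<pi>) \<le> iprod ((a \<circ> \<pi>) \<circ> inv \<pi>)"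
    by (rule iprod_le_comp) (use assms in \<open>auto simp: bij_imp_bij_inv bij_is_inj\<close>)
  moreover have "(a \<circ> \<pi>) \<circ> inv \<pi> = a"
    using assms(2) by (auto simp: fun_eq_iff bij_is_surj surj_f_inv_f)
  ultimately show "iprod (a \<circ> \<pi>) \<le> iprod a" by simp
  show "iprod a \<le> iprod (a \<circ> \<pi>)"
    by (rule iprod_le_comp) (use assms in \<open>auto simp: bij_is_inj\<close>)
qed

lemma iprod_mult:
  assumes "\<And>i. a i \<in> {0..1}" "\<And>i. b i \<in> {0..1}"
  shows "iprod (\<lambda>i. a i * b i) = iprod a * iprod b"
proof -
  have "(\<lambda>n. (\<Prod>i<n. a i) * (\<Prod>i<n. b i)) \<longlonglongrightarrow> iprod a * iprod b"
    by (intro tendsto_mult iprod_LIMSEQ assms)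
  then show ?thesis
    unfolding iprod_def[of "\<lambda>i. a i * b i"] prod.distrib by (rule limI)
qed

lemma iprod_mono:
  assumes "\<And>i. a i \<in> {0..1}" "\<And>i. b i \<in> {0..1}" "\<And>i. a i \<le> b i"
  shows "iprod a \<le> iprod b"
  by (rule LIMSEQ_le[OF iprod_LIMSEQ iprod_LIMSEQ])
    (use assms in \<open>auto intro!: prod_mono exI[of _ 0]\<close>)

lemma iprod_eq_prod:
  assumes "\<And>i. n \<le> i \<Longrightarrow> a i = 1"
  shows "iprod a = (\<Prod>i<n. a i)"
  unfolding iprod_def
proof (rule limI, rule tendsto_eventually, rule eventually_sequentiallyI[of n])
  fix m assume "n \<le> m"
  have "(\<Prod>i<n. a i) = (\<Prod>i<m. a i)"
    by (rule prod.mono_neutral_left) (use \<open>n \<le> m\<close> assms in auto)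
  then show "(\<Prod>i<m. a i) = (\<Prod>i<n. a i)" ..
qed

lemma iprod_exp_summable:
  assumes "summable c"
  shows "iprod (\<lambda>i. exp (- c i)) = exp (- suminf c)"
proof -
  have "(\<lambda>n. exp (- (\<Sum>i<n. c i))) \<longlonglongrightarrow> exp (- suminf c)"
    by (intro tendsto_intros) (use assms summable_LIMSEQ in auto)
  then show ?thesis
    unfolding iprod_def by (intro limI) (simp add: exp_sum flip: sum_negf)
qed

text \<open>Divergence to 0 is an ordinary value of \<open>iprod\<close>. It makes the test
  functionals vanish for those marks whose normalising series diverges.\<close>

lemma iprod_exp_not_summable:
  assumes "\<not> summable c" "\<And>i. 0 \<le> c i"
  shows "iprod (\<lambda>i. exp (- c i)) = 0"
proof -
  let ?a = "\<lambda>i. exp (- c i)"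
  have r: "?a i \<in> {0..1}" for i using assms(2)[of i] by auto
  have "\<not> 0 < iprod ?a"
  proof
    assume pos: "0 < iprod ?a"
    have "(\<Sum>i<n. c i) \<le> - ln (iprod ?a)" for n
    proof -
      have "iprod ?a \<le> exp (- (\<Sum>i<n. c i))"
        using iprod_le_prod[of ?a n, OF r] by (simp add: exp_sum flip: sum_negf)
      then have "ln (iprod ?a) \<le> - (\<Sum>i<n. c i)"
        using pos by (metis exp_gt_zero ln_exp ln_le_cancel_iff)
      then show ?thesis by simp
    qed
    then have "summable c"
      by (intro summableI_nonneg_bounded assms(2))
    then show False using assms(1) by simp
  qed
  then show ?thesis using iprod_range[of ?a, OF r] by auto
qed

text \<open>A squeeze: \<open>iprod a\<close> is a lower bound for every \<open>k\<close>, and any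
  finite partial product is an upper bound that converges.\<close>

lemma iprod_decseq_limit:
  assumes "\<And>k i. b k i \<in> {0..1}" "\<And>i. a i \<in> {0..1}" "\<And>k i. a i \<le> b k i"
    and "\<And>i. (\<lambda>k. b k i) \<longlonglongrightarrow> a i"
  shows "(\<lambda>k. iprod (b k)) \<longlonglongrightarrow> iprod a"
proof (rule order_tendstoI)
  fix y assume "y < iprod a"
  moreover have "iprod a \<le> iprod (b k)" for k
    using assms by (intro iprod_mono)
  ultimately have "y < iprod (b k)" for k
    by (rule less_le_trans)
  then show "\<forall>\<^sub>F k in sequentially. y < iprod (b k)"
    by simp
next
  fix y assume "iprod a < y"
  then have "\<forall>\<^sub>F n in sequentially. (\<Prod>i<n. a i) < y"
    using order_tendstoD(2)[OF iprod_LIMSEQ[of a, OF assms(2)]] by blast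
  then obtain n where n: "(\<Prod>i<n. a i) < y"
    by (auto simp: eventually_sequentially)
  have "(\<lambda>k. \<Prod>i<n. b k i) \<longlonglongrightarrow> (\<Prod>i<n. a i)"
    by (intro tendsto_prod assms)
  then have "\<forall>\<^sub>F k in sequentially. (\<Prod>i<n. b k i) < y"
    using n by (rule order_tendstoD(2))
  then show "\<forall>\<^sub>F k in sequentially. iprod (b k) < y"
    by eventually_elim (use iprod_le_prod[of "b _" n, OF assms(1)] in \<open>auto intro: le_less_trans\<close>)
qed

section \<open>Descending rearrangements: existence, measurability, membership in
  \<open>nabla\<close>\<close>

lemma ex_decreasing_rearrangement:
  fixes v :: "nat \<Rightarrow> real"
  assumes pos: "\<And>i. 0 < v i" and null: "v \<longlonglongrightarrow> 0"
  obtains \<pi> where "bij \<pi>" "decseq (v \<circ> \<pi>)"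
proof -
  \<comment> \<open>Larger values come first and ties are broken by the index. In this strict linear
    order every index has finitely many predecessors, because \<open>v\<close> is null and
    \<open>v i\<close> is positive.\<close>
  define R where "R j i \<longleftrightarrow> v j > v i \<or> (v j = v i \<and> j < i)" for i j
  define rk where "rk i = card {j. R j i}" for i
  have fin: "finite {j. R j i}" for i
  proof -
    have "\<forall>\<^sub>F j in sequentially. v j < v i" using order_tendstoD(2)[OF null pos] .
    then obtain n where n: "\<And>j. n \<le> j \<Longrightarrow> v j < v i" by (auto simp: eventually_sequentially)
    have "{j. R j i} \<subseteq> {..<n}"
      using n by (force simp: R_def not_less[symmetric])
    then show ?thesis using finite_subset by blast
  qed
  have trans: "R k i" if "R k j" "R j i" for i j k using that by (auto simp: R_def)
  have lin: "R i j \<or> R j i" if "i \<noteq> j" for i j using that by (auto simp: R_def)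
  have irr: "\<not> R i i" for i by (auto simp: R_def)
  have rk_mono: "rk j < rk i" if "R j i" for i j
    unfolding rk_def
  proof (intro psubset_card_mono fin psubsetI)
    show "{k. R k j} \<subseteq> {k. R k i}" using that trans by blast
    show "{k. R k j} \<noteq> {k. R k i}" using that irr by blast
  qed
  have rk_iff: "rk j < rk i \<longleftrightarrow> R j i" for i j
    using rk_mono lin by (metis less_asym less_irrefl)
  have inj: "inj rk" by (rule injI) (metis lin rk_iff less_irrefl)
  have "m \<in> range rk" for m
  proof -
    \<comment> \<open>Counting: the injective rank maps the \<open>rk i\<close> predecessors of
      \<open>i\<close> into the first \<open>rk i\<close> numbers, hence onto them. As ranks are
      unbounded, no number is skipped.\<close>
    have im: "rk ` {j. R j i} = {..<rk i}" for i
    proof (rule card_subset_eq)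
      show "rk ` {j. R j i} \<subseteq> {..<rk i}" using rk_mono by auto
      have "card (rk ` {j. R j i}) = card {j. R j i}"
        by (intro card_image inj_on_subset[OF inj]) auto
      then show "card (rk ` {j. R j i}) = card {..<rk i}" by (simp add: rk_def)
    qed simp
    have "infinite (range rk)" using inj range_inj_infinite by blast
    then obtain i where "m < rk i"
      by (metis finite_nat_iff_bounded_le infinite_nat_iff_unbounded rangeE)
    then show ?thesis using im[of i] by auto
  qed
  then have bij: "bij rk" using inj by (auto simp: bij_def)
  have "decseq (v \<circ> inv rk)"
  proof (rule decseq_SucI)
    fix n
    have "rk (inv rk n) < rk (inv rk (Suc n))"
      using bij by (simp add: bij_is_surj surj_f_inv_f)
    then show "(v \<circ> inv rk) (Suc n) \<le> (v \<circ> inv rk) n"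
      unfolding rk_iff R_def by auto
  qed
  then show ?thesis using that bij bij_imp_bij_inv by blast
qed

definition top_level :: "(nat \<Rightarrow> real) \<Rightarrow> nat \<Rightarrow> real \<Rightarrow> bool" where
  "top_level v n x \<longleftrightarrow> (\<exists>A. finite A \<and> card A = Suc n \<and> (\<forall>i\<in>A. x \<le> v i))"

lemma desc_eq_Sup: "desc v n = Sup {x. top_level v n x}"
  by (simp add: desc_def top_level_def)

lemma top_level_antimono: "top_level v n y \<Longrightarrow> x \<le> y \<Longrightarrow> top_level v n x"
  unfolding top_level_def by (meson order_trans)

lemma ex_top_level: "\<exists>x. top_level v n x"
  unfolding top_level_def
  by (rule exI[of _ "Min (v ` {..n})"], rule exI[of _ "{..n}"]) auto

text \<open>A nonempty down-closed set of reals is either bounded, and then its supremum can be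
  tested on rationals, or the whole line, where \<open>Sup UNIV\<close> is a fixed unspecified real.
  Both alternatives are countable conditions, which makes \<open>desc\<close> measurable on all
  sequences.\<close>

lemma Sup_gt_iff_rational:
  fixes E :: "real \<Rightarrow> bool"
  assumes "\<And>x y. E y \<Longrightarrow> x \<le> y \<Longrightarrow> E x" "\<exists>x. E x"
  shows "y < Sup {x. E x} \<longleftrightarrow> (if \<exists>m::nat. \<not> E (real m) then \<exists>q::rat. y < of_rat q \<and> E (of_rat q)
           else y < Sup UNIV)"
proof (cases "\<exists>m::nat. \<not> E (real m)")
  case True
  then obtain m :: nat where m: "\<not> E (real m)" by auto
  then have bdd: "bdd_above {x. E x}"
    using assms(1) by (intro bdd_aboveI[of _ "real m"]) (metis linear mem_Collect_eq)
  have "y < Sup {x. E x} \<longleftrightarrow> (\<exists>x\<in>{x. E x}. y < x)"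
    using assms(2) bdd by (intro less_cSup_iff) auto
  also have "\<dots> \<longleftrightarrow> (\<exists>q::rat. y < of_rat q \<and> E (of_rat q))"
    using assms(1) of_rat_dense[of y] by (meson less_imp_le mem_Collect_eq)
  finally show ?thesis using True by simp
next
  case False
  then have "{x. E x} = UNIV"
    using assms(1) by (auto, meson real_arch_simple)
  then show ?thesis using False by simp
qed

lemma measurable_desc [measurable]: "desc \<in> borel_measurable borel"
proof (rule measurable_coordinatewise_then_product)
  fix n
  have [measurable]: "(\<lambda>v::nat \<Rightarrow> real. v i) \<in> borel_measurable borel" for i
    by (rule borel_measurable_continuous_onI) (simp add: continuous_on_product_coordinates)
  have [measurable]: "Measurable.pred borel (\<lambda>v. top_level v n x)" for x
  proof -
    \<comment> \<open>Distinct lists replace finite sets so that the existential quantifier ranges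
      over a countable type.\<close>
    have "top_level v n x \<longleftrightarrow> (\<exists>l::nat list. (distinct l \<and> length l = Suc n) \<and> (\<forall>i\<in>set l. x \<le> v i))" for v
    proof
      assume "top_level v n x"
      then obtain A where A: "finite A" "card A = Suc n" "\<forall>i\<in>A. x \<le> v i" by (auto simp: top_level_def)
      obtain l where "set l = A" "distinct l" using finite_distinct_list[OF A(1)] by auto
      then show "\<exists>l::nat list. (distinct l \<and> length l = Suc n) \<and> (\<forall>i\<in>set l. x \<le> v i)"
        using A by (intro exI[of _ l]) (auto simp: distinct_card)
    next
      assume "\<exists>l::nat list. (distinct l \<and> length l = Suc n) \<and> (\<forall>i\<in>set l. x \<le> v i)"
      then obtain l where "distinct l" "length l = Suc n" "\<forall>i\<in>set l. x \<le> v i" by auto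
      then show "top_level v n x"
        unfolding top_level_def by (intro exI[of _ "set l"]) (auto simp: distinct_card)
    qed
    then show ?thesis by (simp only:) measurable
  qed
  show "(\<lambda>v. desc v n) \<in> borel_measurable borel"
  proof (rule borel_measurableI_greater)
    fix y
    have "{v \<in> space borel. y < desc v n} =
       {v \<in> space borel. if \<exists>m::nat. \<not> top_level v n (real m) then \<exists>q::rat. y < of_rat q \<and> top_level v n (of_rat q)
           else y < Sup UNIV}"
      unfolding desc_eq_Sup using Sup_gt_iff_rational[of "top_level _ n" y, OF top_level_antimono ex_top_level] by simp
    also have "\<dots> \<in> sets borel" by measurable
    finally show "{v \<in> space borel. y < desc v n} \<in> sets borel" .
  qed
qed

lemma desc_positive_null:
  assumes "\<And>i. 0 < v i" "v \<longlonglongrightarrow> 0"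
  obtains \<pi> where "bij \<pi>" "desc v = v \<circ> \<pi>" "decseq (desc v)"
  using ex_decreasing_rearrangement[OF assms] desc_eq_rearrangement by metis

lemma sums_comp_bij_nonneg:
  fixes v :: "nat \<Rightarrow> real"
  assumes "bij \<pi>" "\<And>i. 0 \<le> v i"
  shows "(v \<circ> \<pi>) sums s \<longleftrightarrow> v sums s"
proof -
  have "(v has_sum s) UNIV \<longleftrightarrow> ((v \<circ> \<pi>) has_sum s) UNIV"
    using has_sum_reindex_bij_betw[OF assms(1), of v s] by (simp add: o_def)
  moreover have "(w has_sum s) UNIV \<longleftrightarrow> w sums s" if "\<And>i. 0 \<le> w i" for w :: "nat \<Rightarrow> real"
  proof
    show "w sums s" if "(w has_sum s) UNIV" using has_sum_imp_sums[OF that] .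
    show "(w has_sum s) UNIV" if "w sums s"
      using norm_summable_imp_has_sum[of w s] that \<open>\<And>i. 0 \<le> w i\<close> sums_summable[OF that] by simp
  qed
  ultimately show ?thesis using assms(2) by auto
qed

lemma desc_in_nabla:
  assumes "\<And>i. 0 < v i" "v sums 1"
  shows "desc v \<in> nabla"
proof -
  obtain \<pi> where \<pi>: "bij \<pi>" "desc v = v \<circ> \<pi>" "decseq (desc v)"
    using desc_positive_null[of v] assms summable_LIMSEQ_zero sums_summable by metis
  have "(v \<circ> \<pi>) sums 1" using sums_comp_bij_nonneg[OF \<pi>(1), of v] assms by (simp add: less_imp_le)
  then show ?thesis using \<pi> assms(1) by (auto simp: nabla_def less_imp_le)
qed

text \<open>The sum of a divergent series is an unspecified real, here \<open>c\<close>, so the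
  claim is proved for every \<open>c\<close>. It shows that the restriction of the image law to
  \<open>nabla\<close> discards the marks with divergent normaliser, whatever the default
  is.\<close>

lemma desc_not_in_nabla:
  assumes pos: "\<And>i. 0 < a i" and "\<not> summable a"
  shows "desc (\<lambda>i. a i / c) \<notin> nabla"
proof
  let ?v = "\<lambda>i. a i / c"
  assume nabla: "desc ?v \<in> nabla"
  then have s: "desc ?v sums 1" by (auto simp: nabla_def)
  then have lim0: "desc ?v \<longlonglongrightarrow> 0" using summable_LIMSEQ_zero sums_summable by blast
  have ns: "\<not> summable ?v" if "0 < c"
    using assms(2) that summable_mult[of ?v c] by auto
  show False
  proof (cases "0 < c")
    \<comment> \<open>This includes \<open>c = 0\<close>, where every quotient is 0.\<close>
    case False
    have v: "?v i \<le> 0" for i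
      using pos[of i] False by (simp add: divide_nonneg_nonpos)
    have "desc ?v n \<le> 0" for n
      unfolding desc_eq_Sup
    proof (rule cSup_least)
      fix x assume "x \<in> {x. top_level ?v n x}"
      then obtain A where "finite A" "card A = Suc n" "\<forall>i\<in>A. x \<le> ?v i" by (auto simp: top_level_def)
      then obtain i where "i \<in> A" "x \<le> ?v i" by fastforce
      then show "x \<le> 0" using v[of i] by linarith
    qed (use ex_top_level in auto)
    then have "1 \<le> (0::real)" using sums_le[OF _ s sums_zero] by blast
    then show False by simp
  next
    case c: True
    then have vpos: "0 < ?v i" for i using pos by simp
    show False
    proof (cases "?v \<longlonglongrightarrow> 0")
      case True
      then obtain \<pi> where \<pi>: "bij \<pi>" "desc ?v = ?v \<circ> \<pi>"
        using desc_positive_null[of ?v] vpos by metis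
      have "?v sums 1"
        using s sums_comp_bij_nonneg[OF \<pi>(1), of ?v 1] vpos by (simp add: less_imp_le \<pi>(2))
      then show False using ns[OF c] sums_summable by blast
    next
      case False
      then obtain e where e: "0 < e" "\<And>n. \<exists>i\<ge>n. e \<le> ?v i"
        using vpos unfolding LIMSEQ_iff
        by (metis abs_of_pos diff_zero not_le real_norm_def)
      \<comment> \<open>A positive sequence that is not null is at least some \<open>e > 0\<close>
        infinitely often, so each order statistic is at least \<open>e\<close> unless the values are
        unbounded.\<close>
      have inf: "infinite {i. e \<le> ?v i}"
        unfolding infinite_nat_iff_unbounded_le using e(2) by auto
      have tl: "top_level ?v n e" for n
        using infinite_arbitrarily_large[OF inf, of "Suc n"] unfolding top_level_def by blast
      obtain n where n: "desc ?v n < e" "desc ?v n < Sup UNIV \<or> Sup UNIV \<le> (0::real)" "0 \<le> desc ?v n"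
      proof -
        have "\<forall>\<^sub>F n in sequentially. desc ?v n < e" using order_tendstoD(2)[OF lim0 e(1)] .
        moreover have "\<forall>\<^sub>F n in sequentially. desc ?v n < Sup UNIV \<or> Sup UNIV \<le> (0::real)"
          using order_tendstoD(2)[OF lim0, of "Sup UNIV"] by (cases "0 < (Sup UNIV :: real)") (auto simp: not_less)
        ultimately have "\<forall>\<^sub>F n in sequentially. desc ?v n < e \<and> (desc ?v n < Sup UNIV \<or> Sup UNIV \<le> (0::real))"
          by eventually_elim auto
        then show ?thesis using that nabla by (auto simp: eventually_sequentially nabla_def)
      qed
      show False
      proof (cases "\<exists>m::nat. \<not> top_level ?v n (real m)")
        case True
        then obtain m :: nat where "\<not> top_level ?v n (real m)" by auto
        then have "bdd_above {x. top_level ?v n x}"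
          using top_level_antimono by (intro bdd_aboveI[of _ "real m"]) (metis linear mem_Collect_eq)
        then have "e \<le> desc ?v n" unfolding desc_eq_Sup using tl by (intro cSup_upper) auto
        then show False using n by simp
      next
        \<comment> \<open>Unbounded values: every real is exceeded infinitely often, so all order
          statistics equal the default \<open>Sup UNIV\<close>. A constant null sequence is 0 and
          cannot sum to 1.\<close>
        case False
        have all: "top_level ?v k x" for k x
        proof -
          have unb: "\<exists>i. x \<le> ?v i" for x
          proof -
            obtain m :: nat where "x \<le> real m" using real_arch_simple by blast
            then have "top_level ?v n x" using False top_level_antimono by blast
            then obtain A where A: "finite A" "card A = Suc n" "\<forall>i\<in>A. x \<le> ?v i" by (auto simp: top_level_def)
            then have "A \<noteq> {}" by auto
            then show ?thesis using A(3) by blast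
          qed
          have "infinite {i. x \<le> ?v i}"
          proof
            assume fin: "finite {i. x \<le> ?v i}"
            obtain i where i: "max x (Max (insert x (?v ` {i. x \<le> ?v i})) + 1) \<le> ?v i" using unb by blast
            then have "i \<in> {i. x \<le> ?v i}" by simp
            then have "?v i \<le> Max (insert x (?v ` {i. x \<le> ?v i}))" using fin by (intro Max_ge) auto
            then show False using i by simp
          qed
          from infinite_arbitrarily_large[OF this, of "Suc k"] show ?thesis
            unfolding top_level_def by blast
        qed
        have d: "desc ?v k = Sup UNIV" for k
        proof -
          have "{x. top_level ?v k x} = UNIV" using all by blast
          then show ?thesis unfolding desc_eq_Sup by simp
        qed
        then have "desc ?v = (\<lambda>_. Sup UNIV)" by auto
        then have "(\<lambda>_::nat. Sup UNIV) \<longlonglongrightarrow> (0::real)" using lim0 by simp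
        then have "(Sup UNIV :: real) = 0" using LIMSEQ_const_iff by blast
        then have "desc ?v = (\<lambda>_. 0)" using d by auto
        then show False using s sums_unique2[OF sums_zero] by (metis zero_neq_one)
      qed
    qed
  qed
qed

section \<open>Beta and gamma integrals\<close>

lemma nn_integral_scale_pos:
  assumes [measurable]: "g \<in> borel_measurable borel" and c: "0 < (c::real)"
  shows "(\<integral>\<^sup>+u\<in>{0<..}. g u \<partial>lborel) = ennreal c * (\<integral>\<^sup>+u\<in>{0<..}. g (c * u) \<partial>lborel)"
proof -
  have "(\<integral>\<^sup>+u\<in>{0<..}. g u \<partial>lborel) = ennreal \<bar>c\<bar> * (\<integral>\<^sup>+u. g (0 + c * u) * indicator {0<..} (0 + c * u) \<partial>lborel)"
    using c by (intro nn_integral_real_affine) auto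
  also have "(\<lambda>u. g (0 + c * u) * indicator {0<..} (0 + c * u)) = (\<lambda>u. g (c * u) * indicator {0<..} u)"
    using c by (auto simp: fun_eq_iff indicator_def zero_less_mult_iff)
  finally show ?thesis using c by simp
qed

text \<open>Reduces substitutions to compact intervals. The intervals from 1/(n+1) to n+1 are chosen
  because inversion maps each of them to itself.\<close>

lemma nn_integral_pos_eq_SUP:
  assumes [measurable]: "g \<in> borel_measurable borel"
  shows "(\<integral>\<^sup>+t\<in>{0<..}. g t \<partial>lborel) = (SUP n. \<integral>\<^sup>+t\<in>{inverse (real (Suc n))..real (Suc n)}. g t \<partial>lborel)"
proof -
  let ?A = "\<lambda>n. {inverse (real (Suc n))..real (Suc n)}"
  have inc: "incseq ?A"
    by (rule incseq_SucI) (auto simp: field_simps)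
  have "x \<in> (\<Union>n. ?A n)" if pos: "0 < x" for x :: real
  proof -
    obtain n where "x \<le> real n" using real_arch_simple by blast
    moreover obtain m where "inverse (real (Suc m)) < x" using reals_Archimedean[OF pos] by blast
    moreover have "inverse (real (Suc (max n m))) \<le> inverse (real (Suc m))"
      by (simp add: field_simps)
    moreover have "real n \<le> real (Suc (max n m))" by simp
    ultimately have "x \<in> ?A (max n m)" unfolding atLeastAtMost_iff by linarith
    then show ?thesis by blast
  qed
  moreover have "0 < x" if mem: "x \<in> (\<Union>n. ?A n)" for x :: real
  proof -
    obtain n where "inverse (real (Suc n)) \<le> x" using mem by auto
    moreover have "0 < inverse (real (Suc n))" by simp
    ultimately show ?thesis by linarith
  qed
  ultimately have "(\<Union>n. ?A n) = {0<..}" unfolding set_eq_iff greaterThan_iff by blast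
  then have "emeasure (density lborel g) {0<..} = (SUP n. emeasure (density lborel g) (?A n))"
    using SUP_emeasure_incseq[of ?A "density lborel g", OF _ inc] by (simp add: image_subset_iff)
  then show ?thesis by (simp add: emeasure_density)
qed

lemma nn_integral_inverse_pos:
  assumes [measurable]: "g \<in> borel_measurable borel"
  shows "(\<integral>\<^sup>+t\<in>{0<..}. g t \<partial>lborel) = (\<integral>\<^sup>+r\<in>{0<..}. g (1 / r) * ennreal (1 / r\<^sup>2) \<partial>lborel)"
proof -
  let ?A = "\<lambda>n. {inverse (real (Suc n))..real (Suc n)}"
  have "(\<integral>\<^sup>+t\<in>?A n. g t \<partial>lborel) = (\<integral>\<^sup>+r\<in>?A n. g (1 / r) * ennreal (1 / r\<^sup>2) \<partial>lborel)" for n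
  proof (cases "n = 0")
    \<comment> \<open>The interval is the single point 1, while the substitution rule asks for a
      nondegenerate interval.\<close>
    case True
    have "AE x in lborel. x \<noteq> (1::real)" by (rule AE_lborel_singleton)
    then have "AE x in lborel. x \<notin> {1::real..1}" by eventually_elim auto
    then show ?thesis
      unfolding True by (intro nn_integral_cong_AE) auto
  next
    case False
    \<comment> \<open>Inversion is decreasing, so the increasing map - 1 / x is used on the negative
      axis and followed by a reflection.\<close>
    let ?b = "real (Suc n)"
    have "1 * 1 < ?b * ?b" using False by (intro mult_strict_mono) auto
    then have ab: "- ?b < - inverse ?b" by (simp add: field_simps)
    have "(\<integral>\<^sup>+t. g t * indicator {- 1 / (- ?b) .. - 1 / (- inverse ?b)} t \<partial>lborel)
       = (\<integral>\<^sup>+x. g (- 1 / x) * ennreal (1 / x\<^sup>2) * indicator {- ?b .. - inverse ?b} x \<partial>lborel)"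
    proof (rule nn_integral_substitution_aux[where g = "\<lambda>x. - 1 / x" and g' = "\<lambda>x. 1 / x\<^sup>2"])
      fix x assume "x \<in> {- ?b .. - inverse ?b}"
      moreover have "- inverse ?b < 0" by simp
      ultimately have "x < 0" by (meson atLeastAtMost_iff le_less_trans)
      then show "((\<lambda>x. - 1 / x) has_real_derivative 1 / x\<^sup>2) (at x)"
        by (auto intro!: derivative_eq_intros simp: power2_eq_square)
    next
      have "- inverse ?b < 0" by simp
      then have "\<forall>x\<in>{- ?b .. - inverse ?b}. x\<^sup>2 \<noteq> 0" by (metis atLeastAtMost_iff less_irrefl order_le_less_trans power_eq_0_iff)
      then show "continuous_on {- ?b .. - inverse ?b} (\<lambda>x. 1 / x\<^sup>2)"
        by (intro continuous_intros) auto
    qed (use ab in auto)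
    also have "\<dots> = (\<integral>\<^sup>+x. g (1 / x) * ennreal (1 / x\<^sup>2) * indicator {inverse ?b .. ?b} x \<partial>lborel)"
      by (subst nn_integral_real_affine[where c = "-1" and t = 0])
        (auto intro!: nn_integral_cong simp: indicator_def)
    finally have "(\<integral>\<^sup>+t\<in>{- 1 / (- ?b) .. - 1 / (- inverse ?b)}. g t \<partial>lborel) = (\<integral>\<^sup>+r\<in>?A n. g (1 / r) * ennreal (1 / r\<^sup>2) \<partial>lborel)" .
    moreover have "- 1 / (- ?b) = inverse ?b" "- 1 / (- inverse ?b) = ?b" by (simp_all add: field_simps)
    ultimately show ?thesis by metis
  qed
  then show ?thesis by (simp add: nn_integral_pos_eq_SUP)
qed

lemma nn_integral_Gamma:
  assumes "0 < a" "0 < (s::real)"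
  shows "(\<integral>\<^sup>+u\<in>{0<..}. ennreal (u powr (a - 1) * exp (- s * u)) \<partial>lborel) = ennreal (Gamma a * s powr (- a))"
proof -
  have "(\<integral>\<^sup>+u\<in>{0<..}. ennreal (u powr (a - 1) * exp (- u)) \<partial>lborel) = ennreal (Gamma a)"
    unfolding Gamma_conv_nn_integral_real[OF assms(1)]
    using AE_lborel_singleton[of "0::real"]
    by (intro nn_integral_cong_AE) (auto simp: indicator_def exp_minus field_simps)
  also have "(\<integral>\<^sup>+u\<in>{0<..}. ennreal (u powr (a - 1) * exp (- u)) \<partial>lborel) =
     ennreal s * (\<integral>\<^sup>+u\<in>{0<..}. ennreal ((s * u) powr (a - 1) * exp (- (s * u))) \<partial>lborel)"
    by (rule nn_integral_scale_pos) (use assms in auto)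
  also have "(\<integral>\<^sup>+u\<in>{0<..}. ennreal ((s * u) powr (a - 1) * exp (- (s * u))) \<partial>lborel) =
     (\<integral>\<^sup>+u. ennreal (s powr (a - 1)) * (ennreal (u powr (a - 1) * exp (- s * u)) * indicator {0<..} u) \<partial>lborel)"
    using assms by (intro nn_integral_cong)
      (auto simp: indicator_def powr_mult ennreal_mult[symmetric] ac_simps)
  also have "\<dots> = ennreal (s powr (a - 1)) * (\<integral>\<^sup>+u\<in>{0<..}. ennreal (u powr (a - 1) * exp (- s * u)) \<partial>lborel)"
    by (rule nn_integral_cmult) auto
  finally have *: "ennreal (s powr a) * (\<integral>\<^sup>+u\<in>{0<..}. ennreal (u powr (a - 1) * exp (- s * u)) \<partial>lborel) = ennreal (Gamma a)"
    using assms by (simp add: mult.assoc[symmetric] ennreal_mult[symmetric] powr_diff)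
  have "ennreal (s powr (- a)) * ennreal (s powr a) = 1"
    using assms by (simp add: ennreal_mult[symmetric] powr_add[symmetric])
  then have "(\<integral>\<^sup>+u\<in>{0<..}. ennreal (u powr (a - 1) * exp (- s * u)) \<partial>lborel) = ennreal (s powr (- a)) * ennreal (Gamma a)"
    unfolding *[symmetric] by (simp add: mult.assoc[symmetric])
  then show ?thesis using assms by (simp add: ennreal_mult Gamma_real_pos mult.commute)
qed

lemma nn_integral_exp_atLeast:
  assumes "0 < (u::real)"
  shows "(\<integral>\<^sup>+q\<in>{s..}. ennreal (u * exp (- q * u)) \<partial>lborel) = ennreal (exp (- s * u))"
proof -
  have "(\<integral>\<^sup>+q\<in>{s..}. ennreal (u * exp (- q * u)) \<partial>lborel) = ennreal (0 - - exp (- s * u))"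
  proof (rule nn_integral_FTC_atLeast)
    show "((\<lambda>q. - exp (- q * u)) \<longlongrightarrow> 0) at_top"
    proof -
      have "((\<lambda>q. - exp (- (u * q))) \<longlongrightarrow> - 0) at_top"
        using assms by (intro tendsto_minus filterlim_compose[OF exp_at_bot] filterlim_compose[OF filterlim_uminus_at_bot_at_top]
            filterlim_tendsto_pos_mult_at_top[OF tendsto_const _ filterlim_ident])
      then show ?thesis by (simp add: mult.commute)
    qed
  qed (use assms in \<open>auto intro!: derivative_eq_intros\<close>)
  then show ?thesis by simp
qed

lemma nn_integral_exp_Icc:
  assumes "0 \<le> (u::real)" "a \<le> b"
  shows "(\<integral>\<^sup>+q\<in>{a..b}. ennreal (u * exp (- q * u)) \<partial>lborel) = ennreal (exp (- a * u) - exp (- b * u))"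
proof -
  have "(\<integral>\<^sup>+q\<in>{a..b}. ennreal (u * exp (- q * u)) \<partial>lborel) = ennreal (- exp (- b * u) - - exp (- a * u))"
    by (rule nn_integral_FTC_Icc) (use assms in \<open>auto intro!: derivative_eq_intros\<close>)
  then show ?thesis by simp
qed

lemma nn_integral_powr_Icc:
  assumes "0 < a" "0 \<le> (s::real)"
  shows "(\<integral>\<^sup>+q\<in>{0..s}. ennreal (q powr (a - 1)) \<partial>lborel) = ennreal (s powr a / a)"
  using has_integral_powr_from_0[of "a - 1" s] assms
  by (intro nn_integral_has_integral_lebesgue'[THEN trans]) auto

text \<open>Writing 1 - exp(-s x) as the integral of x exp(-q x) over q in [0, s] leads to the Gamma
  integral of order a + 1. The constant is - Gamma(a): this is the Gamma integral continued to -1 <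
  a < 0. It serves for the Laplace exponent and for negative \<theta>.\<close>

lemma nn_integral_one_minus_exp:
  assumes "- 1 < a" "a < 0" "0 \<le> (s::real)"
  shows "(\<integral>\<^sup>+x\<in>{0<..}. ennreal (x powr (a - 1) * (1 - exp (- s * x))) \<partial>lborel) = ennreal (Gamma (a + 1) / (- a) * s powr (- a))"
proof -
  have "(\<integral>\<^sup>+x\<in>{0<..}. ennreal (x powr (a - 1) * (1 - exp (- s * x))) \<partial>lborel) =
      (\<integral>\<^sup>+x. (\<integral>\<^sup>+q. ennreal (x powr a * exp (- q * x)) * indicator {0..s} q * indicator {0<..} x \<partial>lborel) \<partial>lborel)"
  proof (rule nn_integral_cong)
    fix x :: real
    show "ennreal (x powr (a - 1) * (1 - exp (- s * x))) * indicator {0<..} x =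
       (\<integral>\<^sup>+q. ennreal (x powr a * exp (- q * x)) * indicator {0..s} q * indicator {0<..} x \<partial>lborel)"
    proof (cases "0 < x")
      case True
      have "(\<integral>\<^sup>+q. ennreal (x powr a * exp (- q * x)) * indicator {0..s} q * indicator {0<..} x \<partial>lborel) =
         (\<integral>\<^sup>+q. ennreal (x powr (a - 1)) * (ennreal (x * exp (- q * x)) * indicator {0..s} q) \<partial>lborel)"
        using True by (intro nn_integral_cong)
          (auto simp: indicator_def ennreal_mult[symmetric] powr_diff)
      also have "\<dots> = ennreal (x powr (a - 1)) * ennreal (exp (- 0 * x) - exp (- s * x))"
        using True assms nn_integral_exp_Icc[of x 0 s] by (subst nn_integral_cmult) auto
      finally show ?thesis using True assms by (simp add: ennreal_mult)
    qed simp
  qed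
  also have "\<dots> = (\<integral>\<^sup>+q. (\<integral>\<^sup>+x. ennreal (x powr a * exp (- q * x)) * indicator {0..s} q * indicator {0<..} x \<partial>lborel) \<partial>lborel)"
    by (rule lborel_pair.Fubini') simp
  also have "\<dots> = (\<integral>\<^sup>+q. ennreal (Gamma (a + 1)) * (ennreal (q powr (- a - 1)) * indicator {0..s} q) \<partial>lborel)"
  proof (rule nn_integral_cong_AE, use AE_lborel_singleton[of 0] in eventually_elim)
    \<comment> \<open>At q = 0 the inner integral diverges; a single point is negligible.\<close>
    fix q :: real assume "q \<noteq> 0"
    show "(\<integral>\<^sup>+x. ennreal (x powr a * exp (- q * x)) * indicator {0..s} q * indicator {0<..} x \<partial>lborel) =
       ennreal (Gamma (a + 1)) * (ennreal (q powr (- a - 1)) * indicator {0..s} q)"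
      using nn_integral_Gamma[of "a + 1" q] \<open>q \<noteq> 0\<close> assms
      by (cases "q \<in> {0..s}") (auto simp: ennreal_mult)
  qed
  also have "\<dots> = ennreal (Gamma (a + 1)) * ennreal (s powr (- a) / (- a))"
    using nn_integral_powr_Icc[of "- a" s] assms by (subst nn_integral_cmult) auto
  also have "\<dots> = ennreal (Gamma (a + 1) / (- a) * s powr (- a))"
  proof -
    have "0 \<le> s powr (- a) / (- a)" using assms by (intro divide_nonneg_pos) auto
    then show ?thesis using assms by (subst ennreal_mult[symmetric]) (auto simp: Gamma_real_pos less_imp_le)
  qed
  finally show ?thesis .
qed

section \<open>Beta distributions and the beta-gamma identity\<close>

lemma nn_integral_Beta:
  assumes "0 < a" "0 < (b::real)"
  shows "(\<integral>\<^sup>+x\<in>{0<..<1}. ennreal (x powr (a - 1) * (1 - x) powr (b - 1)) \<partial>lborel) = ennreal (Beta a b)"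
  using has_integral_Beta_real[OF assms] unfolding has_integral_Icc_iff_Ioo
  by (rule nn_integral_has_integral_lebesgue'[rotated]) auto

lemma Beta_real_pos: "0 < a \<Longrightarrow> 0 < b \<Longrightarrow> 0 < Beta a (b::real)"
  by (simp add: Beta_def Gamma_real_pos)

lemma sets_beta_measure [simp, measurable_cong]: "sets (beta_measure a b) = sets borel"
  by (simp add: beta_measure_def)

lemma space_beta_measure [simp]: "space (beta_measure a b) = UNIV"
  by (simp add: beta_measure_def)

lemma nn_integral_beta_measure:
  assumes "0 < a" "0 < b" and [measurable]: "g \<in> borel_measurable borel"
  shows "(\<integral>\<^sup>+x. g x \<partial>beta_measure a b) =
    ennreal (1 / Beta a b) * (\<integral>\<^sup>+x\<in>{0<..<1}. ennreal (x powr (a - 1) * (1 - x) powr (b - 1)) * g x \<partial>lborel)"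
proof -
  have "(\<integral>\<^sup>+x. g x \<partial>beta_measure a b) =
     (\<integral>\<^sup>+x. ennreal (1 / Beta a b) * (ennreal (x powr (a - 1) * (1 - x) powr (b - 1)) * g x * indicator {0<..<1} x) \<partial>lborel)"
    unfolding beta_measure_def
    by (subst nn_integral_density)
      (auto intro!: nn_integral_cong simp: indicator_def mult.assoc[symmetric] ennreal_mult[symmetric]
         Beta_real_pos[OF assms(1,2)] less_imp_le)
  then show ?thesis by (simp add: nn_integral_cmult)
qed

lemma prob_space_beta_measure:
  assumes "0 < a" "0 < b"
  shows "prob_space (beta_measure a b)"
proof
  have "emeasure (beta_measure a b) (space (beta_measure a b)) = (\<integral>\<^sup>+x. 1 \<partial>beta_measure a b)"
    by simp
  also have "\<dots> = ennreal (1 / Beta a b) * ennreal (Beta a b)"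
    by (subst nn_integral_beta_measure) (use assms nn_integral_Beta in auto)
  also have "\<dots> = 1"
    using Beta_real_pos[OF assms] by (simp add: ennreal_mult[symmetric])
  finally show "emeasure (beta_measure a b) (space (beta_measure a b)) = 1" .
qed

lemma AE_beta_measure: "AE x in beta_measure a b. 0 < x \<and> x < 1"
  unfolding beta_measure_def by (subst AE_density) (auto simp: indicator_def)

lemma mean_beta_measure:
  assumes "0 < a" "0 < b"
  shows "(\<integral>\<^sup>+x. ennreal (1 - x) \<partial>beta_measure a b) = ennreal (b / (a + b))"
proof -
  have "(\<integral>\<^sup>+x. ennreal (1 - x) \<partial>beta_measure a b) = ennreal (1 / Beta a b) * ennreal (Beta a (b + 1))"
    unfolding nn_integral_Beta[OF assms(1) add_pos_pos[OF assms(2) zero_less_one], symmetric]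
    by (subst nn_integral_beta_measure)
      (use assms in \<open>auto intro!: arg_cong[where f = "(*) _"] nn_integral_cong simp: indicator_def ennreal_mult[symmetric] powr_diff\<close>)
  also have "\<dots> = ennreal (Beta a (b + 1) / Beta a b)"
    using Beta_real_pos[OF assms] Beta_real_pos[of a "b + 1"] assms by (simp add: ennreal_mult[symmetric])
  also have "Beta a (b + 1) / Beta a b = b / (a + b)"
  proof -
    have "Beta a (b + 1) * (a + b) = b * Beta a b"
      using Beta_plus1_right[of b a] assms by (simp add: nonpos_Ints_def mult.commute)
    then show ?thesis using Beta_real_pos[OF assms] assms by (simp add: field_simps)
  qed
  finally show ?thesis .
qed

text \<open>The map (u, x) to (u x, u (1 - x)) has Jacobian u and turns a power of u times a beta
  density into a product of two power weights. In the proof, the beta expectation becomes a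
  convolution, whose integral over the line factorises.\<close>

lemma beta_gamma_algebra:
  assumes ab: "0 < a" "0 < b" and [measurable]: "F \<in> borel_measurable borel" "G \<in> borel_measurable borel"
  shows "(\<integral>\<^sup>+u\<in>{0<..}. ennreal (u powr (a + b - 1)) * (\<integral>\<^sup>+x. F (u * x) * G (u * (1 - x)) \<partial>beta_measure a b) \<partial>lborel) =
    ennreal (1 / Beta a b) * ((\<integral>\<^sup>+x\<in>{0<..}. ennreal (x powr (a - 1)) * F x \<partial>lborel) *
                       (\<integral>\<^sup>+y\<in>{0<..}. ennreal (y powr (b - 1)) * G y \<partial>lborel))"
proof -
  let ?c = "ennreal (1 / Beta a b)"
  let ?f = "\<lambda>x. ennreal (x powr (a - 1)) * F x * indicator {0<..} x"
  let ?g = "\<lambda>y. ennreal (y powr (b - 1)) * G y * indicator {0<..} y"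
  have "ennreal (u powr (a + b - 1)) * (\<integral>\<^sup>+x. F (u * x) * G (u * (1 - x)) \<partial>beta_measure a b) * indicator {0<..} u =
        ?c * (\<integral>\<^sup>+x. ?f x * ?g (u - x) \<partial>lborel)" for u
  proof (cases "0 < u")
    case True
    have "(\<integral>\<^sup>+x. ?f x * ?g (u - x) \<partial>lborel) = ennreal u * (\<integral>\<^sup>+x. ?f (u * x) * ?g (u - u * x) \<partial>lborel)"
      using True nn_integral_real_affine[of "\<lambda>x. ?f x * ?g (u - x)" u 0] by simp
    also have "(\<integral>\<^sup>+x. ?f (u * x) * ?g (u - u * x) \<partial>lborel) =
       (\<integral>\<^sup>+x. ennreal (u powr (a + b - 2)) * (ennreal (x powr (a - 1) * (1 - x) powr (b - 1)) * (F (u * x) * G (u * (1 - x))) * indicator {0<..<1} x) \<partial>lborel)"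
    proof (rule nn_integral_cong)
      fix x
      have iff: "0 < u - u * x \<longleftrightarrow> x < 1" "0 < u * x \<longleftrightarrow> 0 < x"
        using True by (auto simp: zero_less_mult_iff)
      show "?f (u * x) * ?g (u - u * x) = ennreal (u powr (a + b - 2)) * (ennreal (x powr (a - 1) * (1 - x) powr (b - 1)) * (F (u * x) * G (u * (1 - x))) * indicator {0<..<1} x)"
      proof (cases "0 < x \<and> x < 1")
        case x: True
        have "ennreal ((u * x) powr (a - 1)) * ennreal ((u - u * x) powr (b - 1)) =
           ennreal (u powr (a + b - 2)) * ennreal (x powr (a - 1) * (1 - x) powr (b - 1))"
        proof -
          have "u - u * x = u * (1 - x)" by (simp add: algebra_simps)
          moreover have "u powr (a - 1) * u powr (b - 1) = u powr (a + b - 2)"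
            by (simp add: powr_add[symmetric])
          ultimately have "(u * x) powr (a - 1) * (u - u * x) powr (b - 1) =
             u powr (a + b - 2) * (x powr (a - 1) * (1 - x) powr (b - 1))"
            using x True by (simp add: powr_mult mult.assoc mult.left_commute)
          then show ?thesis
            by (simp add: ennreal_mult[symmetric])
        qed
        note eq = this
        have "?f (u * x) * ?g (u - u * x) =
          (ennreal ((u * x) powr (a - 1)) * ennreal ((u - u * x) powr (b - 1))) * (F (u * x) * G (u - u * x))"
          using x iff by (simp add: mult.assoc mult.left_commute)
        then show ?thesis
          unfolding eq using x by (simp add: mult.assoc right_diff_distrib)
      next
        case False
        then show ?thesis using iff by (auto simp: indicator_def)
      qed
    qed
    also have "\<dots> = ennreal (u powr (a + b - 2)) * (\<integral>\<^sup>+x\<in>{0<..<1}. ennreal (x powr (a - 1) * (1 - x) powr (b - 1)) * (F (u * x) * G (u * (1 - x))) \<partial>lborel)"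
      by (rule nn_integral_cmult) auto
    finally have *: "(\<integral>\<^sup>+x. ?f x * ?g (u - x) \<partial>lborel) = ennreal u * (ennreal (u powr (a + b - 2)) *
      (\<integral>\<^sup>+x\<in>{0<..<1}. ennreal (x powr (a - 1) * (1 - x) powr (b - 1)) * (F (u * x) * G (u * (1 - x))) \<partial>lborel))" .
    have "ennreal u * ennreal (u powr (a + b - 2)) = ennreal (u powr (a + b - 1))"
    proof -
      have "u * u powr (a + b - 2) = u powr (1 + (a + b - 2))"
        using True by (subst powr_add) simp
      then show ?thesis using True by (simp add: ennreal_mult[symmetric])
    qed
    then have "ennreal (u powr (a + b - 1)) * (\<integral>\<^sup>+x. F (u * x) * G (u * (1 - x)) \<partial>beta_measure a b) =
       ?c * (\<integral>\<^sup>+x. ?f x * ?g (u - x) \<partial>lborel)"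
      unfolding * by (subst nn_integral_beta_measure[OF ab]) (auto simp: mult.assoc[symmetric], simp only: mult.commute mult.left_commute)
    then show ?thesis using True by simp
  qed (auto simp: nn_integral_0_iff_AE indicator_def)
  then have "(\<integral>\<^sup>+u\<in>{0<..}. ennreal (u powr (a + b - 1)) * (\<integral>\<^sup>+x. F (u * x) * G (u * (1 - x)) \<partial>beta_measure a b) \<partial>lborel) =
     (\<integral>\<^sup>+u. ?c * (\<integral>\<^sup>+x. ?f x * ?g (u - x) \<partial>lborel) \<partial>lborel)" by simp
  also have "\<dots> = ?c * (\<integral>\<^sup>+u. (\<integral>\<^sup>+x. ?f x * ?g (u - x) \<partial>lborel) \<partial>lborel)"
    by (rule nn_integral_cmult) simp
  also have "(\<integral>\<^sup>+u. (\<integral>\<^sup>+x. ?f x * ?g (u - x) \<partial>lborel) \<partial>lborel) = (\<integral>\<^sup>+x. (\<integral>\<^sup>+u. ?f x * ?g (u - x) \<partial>lborel) \<partial>lborel)"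
    by (rule lborel_pair.Fubini') simp
  also have "\<dots> = (\<integral>\<^sup>+x. ?f x * (\<integral>\<^sup>+u. ?g u \<partial>lborel) \<partial>lborel)"
  proof (rule nn_integral_cong)
    fix x
    have "(\<integral>\<^sup>+u. ?f x * ?g (u - x) \<partial>lborel) = ?f x * (\<integral>\<^sup>+u. ?g (u - x) \<partial>lborel)"
      by (rule nn_integral_cmult) simp
    also have "(\<integral>\<^sup>+u. ?g (u - x) \<partial>lborel) = (\<integral>\<^sup>+u. ?g u \<partial>lborel)"
      using nn_integral_real_affine[of ?g 1 "- x"] by simp
    finally show "(\<integral>\<^sup>+u. ?f x * ?g (u - x) \<partial>lborel) = ?f x * (\<integral>\<^sup>+u. ?g u \<partial>lborel)" .
  qed
  also have "\<dots> = (\<integral>\<^sup>+x. ?f x \<partial>lborel) * (\<integral>\<^sup>+u. ?g u \<partial>lborel)"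
    by (rule nn_integral_multc) simp
  finally show ?thesis .
qed

section \<open>Stick-breaking sequences\<close>

text \<open>Peels the first coordinate off an infinite product with possibly different factors,
  checked on cylinders. Both the recursion in \<theta> and the factorisation over i.i.d. marks rest
  on it.\<close>

lemma distr_case_nat_PiM:
  assumes "\<And>i::nat. prob_space (M i)"
  shows "distr (M 0 \<Otimes>\<^sub>M (\<Pi>\<^sub>M i\<in>UNIV. M (Suc i))) (\<Pi>\<^sub>M i\<in>UNIV. M i) (\<lambda>(x, \<omega>). case_nat x \<omega>) = (\<Pi>\<^sub>M i\<in>UNIV. M i)"
    (is "distr (_ \<Otimes>\<^sub>M ?S) ?P ?f = _")
    and measurable_case_nat_PiM:
      "(\<lambda>(x, \<omega>). case_nat x \<omega>) \<in> measurable (M 0 \<Otimes>\<^sub>M (\<Pi>\<^sub>M i\<in>UNIV. M (Suc i))) (\<Pi>\<^sub>M i\<in>UNIV. M i)"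
proof -
  interpret M: prob_space "M i" for i by (rule assms)
  interpret P: product_prob_space M UNIV ..
  interpret S: product_prob_space "\<lambda>i. M (Suc i)" UNIV ..
  interpret SP: prob_space ?S by (rule prob_space_PiM) (rule assms)
  show f: "?f \<in> measurable (M 0 \<Otimes>\<^sub>M ?S) ?P"
  proof (rule measurable_PiM_single')
    fix i :: nat
    show "(\<lambda>\<omega>. (case \<omega> of (x, \<omega>) \<Rightarrow> case_nat x \<omega>) i) \<in> measurable (M 0 \<Otimes>\<^sub>M ?S) (M i)"
      by (cases i) (auto simp: split_beta')
  qed (auto simp: space_pair_measure space_PiM PiE_iff split: nat.split)
  show "distr (M 0 \<Otimes>\<^sub>M ?S) ?P ?f = ?P"
  proof (rule P.PiM_eq)
    fix J :: "nat set" and E assume J: "finite J" "J \<subseteq> UNIV" "\<And>j. j \<in> J \<Longrightarrow> E j \<in> sets (M j)"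
    let ?X = "prod_emb UNIV M J (\<Pi>\<^sub>E j\<in>J. E j)"
    let ?E = "if 0 \<in> J then E 0 else space (M 0)"
    let ?F = "prod_emb UNIV (\<lambda>i. M (Suc i)) (Suc -` J) (\<Pi>\<^sub>E j\<in>Suc -` J. E (Suc j))"
    have sp: "j \<in> J \<Longrightarrow> x \<in> E j \<Longrightarrow> x \<in> space (M j)" for j x
      using J(3)[THEN sets.sets_into_space] by auto
    have iff: "\<forall>x \<omega>. x \<in> space (M 0) \<longrightarrow> \<omega> \<in> (\<Pi>\<^sub>E i\<in>UNIV. space (M (Suc i))) \<longrightarrow> (case_nat x \<omega> \<in> ?X \<longleftrightarrow> x \<in> ?E \<and> \<omega> \<in> ?F)"
    proof (intro allI impI)
      fix x \<omega> assume x: "x \<in> space (M 0)" and \<omega>: "\<omega> \<in> (\<Pi>\<^sub>E i\<in>UNIV. space (M (Suc i)))"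
      have "case_nat x \<omega> \<in> ?X \<longleftrightarrow> (\<forall>j\<in>J. case_nat x \<omega> j \<in> E j)"
        using x \<omega> by (auto simp: prod_emb_def PiE_iff split: nat.split)
      also have "\<dots> \<longleftrightarrow> (0 \<in> J \<longrightarrow> x \<in> E 0) \<and> (\<forall>j. Suc j \<in> J \<longrightarrow> \<omega> j \<in> E (Suc j))"
        by (metis old.nat.simps(4,5) not0_implies_Suc)
      also have "\<dots> \<longleftrightarrow> x \<in> ?E \<and> \<omega> \<in> ?F"
        using x \<omega> by (auto simp: prod_emb_def PiE_iff)
      finally show "case_nat x \<omega> \<in> ?X \<longleftrightarrow> x \<in> ?E \<and> \<omega> \<in> ?F" .
    qed
    have sub: "?E \<subseteq> space (M 0)" "?F \<subseteq> (\<Pi>\<^sub>E i\<in>UNIV. space (M (Suc i)))"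
      using sp by (auto simp: prod_emb_def)
    have "?f -` X \<inter> space (M 0 \<Otimes>\<^sub>M ?S) = A \<times> B"
      if "\<forall>x \<omega>. x \<in> space (M 0) \<longrightarrow> \<omega> \<in> (\<Pi>\<^sub>E i\<in>UNIV. space (M (Suc i))) \<longrightarrow> (case_nat x \<omega> \<in> X \<longleftrightarrow> x \<in> A \<and> \<omega> \<in> B)"
        "A \<subseteq> space (M 0)" "B \<subseteq> (\<Pi>\<^sub>E i\<in>UNIV. space (M (Suc i)))" for A B X
      unfolding space_pair_measure space_PiM using that by auto blast+
    from this[OF iff sub] have "?f -` ?X \<inter> space (M 0 \<Otimes>\<^sub>M ?S) = ?E \<times> ?F" .
    then have "emeasure (distr (M 0 \<Otimes>\<^sub>M ?S) ?P ?f) ?X = emeasure (M 0 \<Otimes>\<^sub>M ?S) (?E \<times> ?F)"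
      using J by (subst emeasure_distr[OF f]) (auto intro!: sets_PiM_I)
    also have "\<dots> = emeasure (M 0) ?E * emeasure ?S ?F"
      using J by (intro S.P.emeasure_pair_measure_Times) (auto intro!: sets_PiM_I finite_vimageI)
    also have "emeasure ?S ?F = (\<Prod>j\<in>Suc -` J. emeasure (M (Suc j)) (E (Suc j)))"
      using J by (intro S.emeasure_PiM_emb) (simp_all add: finite_vimageI)
    also have "\<dots> = (\<Prod>j\<in>J - {0}. emeasure (M j) (E j))"
    proof -
      have eq: "J - {0} = Suc ` (Suc -` J)"
      proof (intro equalityI subsetI)
        fix j assume "j \<in> J - {0}"
        then show "j \<in> Suc ` (Suc -` J)" by (cases j) auto
      qed auto
      show ?thesis unfolding eq by (subst prod.reindex) (auto simp: o_def)
    qed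
    also have "emeasure (M 0) ?E * (\<Prod>j\<in>J - {0}. emeasure (M j) (E j)) = (\<Prod>j\<in>J. emeasure (M j) (E j))"
      using J by (auto simp: M.emeasure_space_1 prod.remove)
    finally show "emeasure (distr (M 0 \<Otimes>\<^sub>M ?S) ?P ?f) ?X = (\<Prod>j\<in>J. emeasure (M j) (E j))" .
  qed simp
qed

section \<open>The law of the break fractions (Griffiths, Engen, McCloskey)\<close>

definition gem :: "real \<Rightarrow> real \<Rightarrow> (nat \<Rightarrow> real) measure" where
  "gem \<alpha> \<theta> = (\<Pi>\<^sub>M i\<in>UNIV. beta_measure (1 - \<alpha>) (\<theta> + real (Suc i) * \<alpha>))"

text \<open>The expected length left after n breaks: a Beta(1 - \<alpha>, \<theta> + \<alpha>) break
  leaves the mean fraction (\<theta> + \<alpha>)/(\<theta> + 1), and \<theta> then becomes \<theta>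
  + \<alpha>. The same numbers control the error of the iteration that identifies
  \<open>Psi\<close>.\<close>

primrec shrink :: "real \<Rightarrow> nat \<Rightarrow> real \<Rightarrow> real" where
  "shrink \<alpha> 0 \<theta> = 1"
| "shrink \<alpha> (Suc n) \<theta> = (\<theta> + \<alpha>) / (\<theta> + 1) * shrink \<alpha> n (\<theta> + \<alpha>)"

lemma stick_breaking_case_nat_0: "stick_breaking (case_nat x \<omega>) 0 = x"
  by (simp add: stick_breaking_def)

lemma stick_breaking_case_nat_Suc: "stick_breaking (case_nat x \<omega>) (Suc n) = (1 - x) * stick_breaking \<omega> n"
  by (simp add: stick_breaking_def prod.lessThan_Suc_shift del: prod.lessThan_Suc)

lemma sum_stick_breaking: "(\<Sum>i<n. stick_breaking U i) = 1 - (\<Prod>i<n. 1 - U i)"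
  by (induction n) (auto simp: stick_breaking_def algebra_simps)

lemma stick_breaking_pos:
  assumes "\<And>i. 0 < U i \<and> U i < 1"
  shows "0 < stick_breaking U i"
  unfolding stick_breaking_def using assms by (intro mult_pos_pos prod_pos) auto

locale pd_index =
  fixes \<alpha> :: real
  assumes \<alpha>_pos: "0 < \<alpha>" and \<alpha>_less_1: "\<alpha> < 1"
begin

lemma shrink_nonneg: "- \<alpha> < \<theta> \<Longrightarrow> 0 \<le> shrink \<alpha> n \<theta>"
proof (induction n arbitrary: \<theta>)
  case (Suc n)
  then show ?case using \<alpha>_pos \<alpha>_less_1 by auto
qed simp

text \<open>The factors are 1 - (1 - \<alpha>)/(\<theta> + 1 + k \<alpha>), estimated by 1 + x \<le>
  exp x.\<close>

lemma shrink_le: "- \<alpha> < \<theta> \<Longrightarrow> shrink \<alpha> n \<theta> \<le> exp (- (1 - \<alpha>) * (\<Sum>k<n. 1 / (\<theta> + 1 + real k * \<alpha>)))"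
proof (induction n arbitrary: \<theta>)
  case (Suc n)
  have "(\<theta> + \<alpha>) / (\<theta> + 1) = 1 + - (1 - \<alpha>) / (\<theta> + 1)"
    using Suc.prems \<alpha>_less_1 by (simp add: field_simps)
  also have "\<dots> \<le> exp (- (1 - \<alpha>) / (\<theta> + 1))" by (rule exp_ge_add_one_self)
  finally have "(\<theta> + \<alpha>) / (\<theta> + 1) \<le> exp (- (1 - \<alpha>) / (\<theta> + 1))" .
  moreover have "shrink \<alpha> n (\<theta> + \<alpha>) \<le> exp (- (1 - \<alpha>) * (\<Sum>k<n. 1 / (\<theta> + \<alpha> + 1 + real k * \<alpha>)))"
    using Suc.prems \<alpha>_pos by (intro Suc.IH) auto
  ultimately have "shrink \<alpha> (Suc n) \<theta> \<le> exp (- (1 - \<alpha>) / (\<theta> + 1)) * exp (- (1 - \<alpha>) * (\<Sum>k<n. 1 / (\<theta> + \<alpha> + 1 + real k * \<alpha>)))"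
    unfolding shrink.simps using Suc.prems \<alpha>_pos shrink_nonneg[of "\<theta> + \<alpha>" n] by (intro mult_mono) auto
  also have "\<dots> = exp (- (1 - \<alpha>) * (1 / (\<theta> + 1) + (\<Sum>k<n. 1 / (\<theta> + \<alpha> + 1 + real k * \<alpha>))))"
    by (simp add: exp_add[symmetric] algebra_simps)
  also have "1 / (\<theta> + 1) + (\<Sum>k<n. 1 / (\<theta> + \<alpha> + 1 + real k * \<alpha>)) = (\<Sum>k<Suc n. 1 / (\<theta> + 1 + real k * \<alpha>))"
    by (subst sum.lessThan_Suc_shift) (simp add: algebra_simps)
  finally show ?case .
qed simp

lemma shrink_tendsto_0:
  assumes "- \<alpha> < \<theta>"
  shows "(\<lambda>n. shrink \<alpha> n \<theta>) \<longlonglongrightarrow> 0"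
proof (rule tendsto_sandwich[OF _ _ tendsto_const])
  \<comment> \<open>From \<theta> + 1 + k \<alpha> \<le> (\<theta> + 2)(k + 1): the exponent is at
    least c times the n-th harmonic number, which is at least ln (n + 1).\<close>
  define c where "c = (1 - \<alpha>) / (\<theta> + 2)"
  have c: "0 < c" using assms \<alpha>_less_1 by (auto simp: c_def)
  show "(\<lambda>n. real (Suc n) powr (- c)) \<longlonglongrightarrow> 0"
    by (rule tendsto_neg_powr[OF c[THEN iffD2[OF neg_less_0_iff_less]]])
      (rule filterlim_compose[OF filterlim_real_sequentially filterlim_Suc])
  have "shrink \<alpha> n \<theta> \<le> real (Suc n) powr (- c)" for n
  proof -
    have "1 / (\<theta> + 2) * (1 / real (Suc k)) \<le> 1 / (\<theta> + 1 + real k * \<alpha>)" for k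
    proof -
      have "real k * \<alpha> \<le> real k" using \<alpha>_less_1 by (simp add: mult_left_le)
      moreover have "0 \<le> real k * (\<theta> + 1)" using assms \<alpha>_less_1 by simp
      ultimately have "\<theta> + 1 + real k * \<alpha> \<le> (\<theta> + 2) * real (Suc k)"
        by (simp add: algebra_simps)
      moreover have "0 < \<theta> + 1 + real k * \<alpha>"
        using assms \<alpha>_less_1 \<alpha>_pos by (intro add_pos_nonneg[of "\<theta> + 1"]) auto
      ultimately show ?thesis by (simp add: frac_le)
    qed
    moreover have "harm n = (\<Sum>k<n. 1 / real (Suc k))"
      by (induction n) (auto simp: harm_def inverse_eq_divide)
    ultimately have "1 / (\<theta> + 2) * harm n \<le> (\<Sum>k<n. 1 / (\<theta> + 1 + real k * \<alpha>))"
      by (simp only: sum_distrib_left) (intro sum_mono)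
    moreover have "1 / (\<theta> + 2) * ln (real (Suc n)) \<le> 1 / (\<theta> + 2) * harm n"
      using assms \<alpha>_less_1 ln_le_harm[of n] by (intro mult_left_mono) (auto simp: add.commute)
    ultimately have "(1 - \<alpha>) * (1 / (\<theta> + 2) * ln (real (Suc n))) \<le> (1 - \<alpha>) * (\<Sum>k<n. 1 / (\<theta> + 1 + real k * \<alpha>))"
      using \<alpha>_less_1 by (intro mult_left_mono) auto
    then have "exp (- (1 - \<alpha>) * (\<Sum>k<n. 1 / (\<theta> + 1 + real k * \<alpha>))) \<le> exp (- c * ln (real (Suc n)))"
      unfolding exp_le_cancel_iff c_def minus_mult_left[symmetric] neg_le_iff_le by (simp add: mult.assoc)
    also have "\<dots> = real (Suc n) powr (- c)" by (simp add: powr_def)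
    finally show ?thesis using shrink_le[OF assms, of n] by linarith
  qed
  then show "\<forall>\<^sub>F n in sequentially. shrink \<alpha> n \<theta> \<le> real (Suc n) powr (- c)" by simp
qed (use shrink_nonneg[OF assms] in simp)

lemma prob_space_stick:
  assumes "- \<alpha> < \<theta>"
  shows "prob_space (beta_measure (1 - \<alpha>) (\<theta> + real (Suc i) * \<alpha>))"
proof (rule prob_space_beta_measure)
  have "\<alpha> \<le> real (Suc i) * \<alpha>" using \<alpha>_pos by simp
  then show "0 < \<theta> + real (Suc i) * \<alpha>" using assms by linarith
qed (use \<alpha>_less_1 in simp)

lemma sets_gem [measurable_cong]: "sets (gem \<alpha> \<theta>) = sets (\<Pi>\<^sub>M i\<in>UNIV. borel)"
  unfolding gem_def by (rule sets_PiM_cong) auto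

lemma prob_space_gem: "- \<alpha> < \<theta> \<Longrightarrow> prob_space (gem \<alpha> \<theta>)"
  unfolding gem_def by (rule prob_space_PiM) (rule prob_space_stick)

lemma measurable_stick_breaking [measurable]:
  "(\<lambda>U. stick_breaking U i) \<in> borel_measurable (\<Pi>\<^sub>M i\<in>UNIV. borel)"
  unfolding stick_breaking_def by measurable

text \<open>Self-similarity: after the first break the parameters are \<theta> + (i + 2) \<alpha> =
  (\<theta> + \<alpha>) + (i + 1) \<alpha>, so the remaining fractions form the same process with
  \<theta> raised by \<alpha>.\<close>

lemma nn_integral_gem:
  assumes \<theta>: "- \<alpha> < \<theta>" and g[measurable]: "g \<in> borel_measurable (\<Pi>\<^sub>M i\<in>UNIV. borel)"
  shows "(\<integral>\<^sup>+U. g U \<partial>gem \<alpha> \<theta>) = (\<integral>\<^sup>+x. (\<integral>\<^sup>+U. g (case_nat x U) \<partial>gem \<alpha> (\<theta> + \<alpha>)) \<partial>beta_measure (1 - \<alpha>) (\<theta> + \<alpha>))"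
proof -
  let ?M = "\<lambda>i. beta_measure (1 - \<alpha>) (\<theta> + real (Suc i) * \<alpha>)"
  have P: "prob_space (?M i)" for i by (rule prob_space_stick[OF \<theta>])
  have S: "(\<Pi>\<^sub>M i\<in>UNIV. ?M (Suc i)) = gem \<alpha> (\<theta> + \<alpha>)"
    unfolding gem_def by (simp add: algebra_simps)
  have M0: "?M 0 = beta_measure (1 - \<alpha>) (\<theta> + \<alpha>)" by simp
  have eq: "distr (beta_measure (1 - \<alpha>) (\<theta> + \<alpha>) \<Otimes>\<^sub>M gem \<alpha> (\<theta> + \<alpha>)) (gem \<alpha> \<theta>) (\<lambda>(x, \<omega>). case_nat x \<omega>) = gem \<alpha> \<theta>"
    using distr_case_nat_PiM[of ?M, OF P] unfolding S M0 by (simp add: gem_def)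
  have meas: "(\<lambda>(x, \<omega>). case_nat x \<omega>) \<in> measurable (beta_measure (1 - \<alpha>) (\<theta> + \<alpha>) \<Otimes>\<^sub>M gem \<alpha> (\<theta> + \<alpha>)) (gem \<alpha> \<theta>)"
    using measurable_case_nat_PiM[of ?M, OF P] unfolding S M0 by (simp add: gem_def)
  interpret G: prob_space "gem \<alpha> (\<theta> + \<alpha>)" using \<theta> \<alpha>_pos by (intro prob_space_gem) auto
  have gm: "g \<in> borel_measurable (gem \<alpha> \<theta>)" by simp
  have "(\<integral>\<^sup>+U. g U \<partial>gem \<alpha> \<theta>) = (\<integral>\<^sup>+p. g (case p of (x, \<omega>) \<Rightarrow> case_nat x \<omega>) \<partial>(beta_measure (1 - \<alpha>) (\<theta> + \<alpha>) \<Otimes>\<^sub>M gem \<alpha> (\<theta> + \<alpha>)))"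
    by (subst eq[symmetric], rule nn_integral_distr[OF meas]) (use gm in simp)
  also have "\<dots> = (\<integral>\<^sup>+x. (\<integral>\<^sup>+U. g (case_nat x U) \<partial>gem \<alpha> (\<theta> + \<alpha>)) \<partial>beta_measure (1 - \<alpha>) (\<theta> + \<alpha>))"
    using measurable_compose[OF meas gm] by (subst G.nn_integral_fst[symmetric]) auto
  finally show ?thesis .
qed

lemma AE_gem_unit:
  assumes "- \<alpha> < \<theta>"
  shows "AE U in gem \<alpha> \<theta>. \<forall>i. 0 < U i \<and> U i < 1"
  unfolding AE_all_countable
proof
  fix i
  show "AE U in gem \<alpha> \<theta>. 0 < U i \<and> U i < 1"
    unfolding gem_def by (rule AE_PiM_component[OF prob_space_stick[OF assms] _ AE_beta_measure]) simp
qed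

lemma nn_integral_gem_remainder:
  assumes "- \<alpha> < \<theta>"
  shows "(\<integral>\<^sup>+U. (\<Prod>i<n. ennreal (1 - U i)) \<partial>gem \<alpha> \<theta>) = ennreal (shrink \<alpha> n \<theta>)"
  using assms
proof (induction n arbitrary: \<theta>)
  case 0
  then interpret prob_space "gem \<alpha> \<theta>" by (rule prob_space_gem)
  show ?case by (simp add: emeasure_space_1)
next
  case (Suc n)
  have \<theta>: "- \<alpha> < \<theta> + \<alpha>" using Suc.prems \<alpha>_pos by simp
  have "(\<integral>\<^sup>+U. (\<Prod>i<Suc n. ennreal (1 - U i)) \<partial>gem \<alpha> \<theta>) =
     (\<integral>\<^sup>+x. (\<integral>\<^sup>+U. ennreal (1 - x) * (\<Prod>i<n. ennreal (1 - U i)) \<partial>gem \<alpha> (\<theta> + \<alpha>)) \<partial>beta_measure (1 - \<alpha>) (\<theta> + \<alpha>))"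
    by (subst nn_integral_gem[OF Suc.prems]) (auto simp: prod.lessThan_Suc_shift simp del: prod.lessThan_Suc)
  also have "\<dots> = (\<integral>\<^sup>+x. ennreal (1 - x) * ennreal (shrink \<alpha> n (\<theta> + \<alpha>)) \<partial>beta_measure (1 - \<alpha>) (\<theta> + \<alpha>))"
    by (subst nn_integral_cmult) (auto simp: Suc.IH[OF \<theta>])
  also have "\<dots> = ennreal ((\<theta> + \<alpha>) / (\<theta> + 1)) * ennreal (shrink \<alpha> n (\<theta> + \<alpha>))"
    using mean_beta_measure[of "1 - \<alpha>" "\<theta> + \<alpha>"] Suc.prems \<alpha>_less_1
    by (subst nn_integral_multc) (auto simp: algebra_simps)
  finally show ?case
    using shrink_nonneg[OF \<theta>, of n] Suc.prems \<alpha>_less_1 by (simp add: ennreal_mult[symmetric])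
qed

text \<open>The length left over decreases to a limit whose mean is at most
  \<open>shrink \<alpha> n \<theta>\<close> for every \<open>n\<close>, hence 0.\<close>

lemma AE_gem_sums:
  assumes "- \<alpha> < \<theta>"
  shows "AE U in gem \<alpha> \<theta>. stick_breaking U sums 1"
proof -
  \<comment> \<open>Clipping to [0, 1] changes nothing almost surely and keeps the limit of the
    partial products meaningful for every \<open>U\<close>.\<close>
  define X where "X U = iprod (\<lambda>i. max 0 (min 1 (1 - U i)))" for U :: "nat \<Rightarrow> real"
  have [measurable]: "X \<in> borel_measurable (\<Pi>\<^sub>M i\<in>UNIV. borel)"
    unfolding X_def[abs_def] by measurable
  have "(\<integral>\<^sup>+U. ennreal (X U) \<partial>gem \<alpha> \<theta>) \<le> ennreal (shrink \<alpha> n \<theta>)" for n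
    unfolding nn_integral_gem_remainder[OF assms, symmetric]
  proof (rule nn_integral_mono_AE, use AE_gem_unit[OF assms] in eventually_elim)
    fix U :: "nat \<Rightarrow> real" assume U: "\<forall>i. 0 < U i \<and> U i < 1"
    have "X U \<le> (\<Prod>i<n. max 0 (min 1 (1 - U i)))"
      unfolding X_def by (rule iprod_le_prod) auto
    also have "\<dots> = (\<Prod>i<n. 1 - U i)" using U by (intro prod.cong) (auto simp: less_imp_le)
    finally show "ennreal (X U) \<le> (\<Prod>i<n. ennreal (1 - U i))"
      using U by (subst prod_ennreal) (auto simp: less_imp_le intro: ennreal_leI)
  qed
  moreover have "(\<lambda>n. ennreal (shrink \<alpha> n \<theta>)) \<longlonglongrightarrow> ennreal 0"
    by (intro tendsto_ennrealI shrink_tendsto_0 assms)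
  ultimately have "(\<integral>\<^sup>+U. ennreal (X U) \<partial>gem \<alpha> \<theta>) \<le> 0"
    by (intro LIMSEQ_le_const) auto
  then have "AE U in gem \<alpha> \<theta>. ennreal (X U) = 0"
    by (subst (asm) le_zero_eq, subst (asm) nn_integral_0_iff_AE) auto
  then show ?thesis
    using AE_gem_unit[OF assms]
  proof eventually_elim
    fix U :: "nat \<Rightarrow> real" assume 0: "ennreal (X U) = 0" and U: "\<forall>i. 0 < U i \<and> U i < 1"
    have "0 \<le> X U" unfolding X_def using iprod_range[of "\<lambda>i. max 0 (min 1 (1 - U i))"] by auto
    then have "X U = 0" using 0 by (simp add: ennreal_eq_0_iff)
    have "(\<lambda>n. \<Prod>i<n. max 0 (min 1 (1 - U i))) \<longlonglongrightarrow> X U"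
      unfolding X_def by (rule iprod_LIMSEQ) auto
    moreover have "max 0 (min 1 (1 - U i)) = 1 - U i" for i using U[rule_format, of i] by auto
    ultimately have "(\<lambda>n. \<Prod>i<n. 1 - U i) \<longlonglongrightarrow> 0" using \<open>X U = 0\<close> by simp
    then have "(\<lambda>n. 1 - (\<Prod>i<n. 1 - U i)) \<longlonglongrightarrow> 1 - 0" by (intro tendsto_intros)
    then show "stick_breaking U sums 1" unfolding sums_def sum_stick_breaking by simp
  qed
qed

end

section \<open>The functional \<open>Psi\<close> and its recursion in \<theta>\<close>

definition Psi :: "real \<Rightarrow> (real \<Rightarrow> real) \<Rightarrow> real \<Rightarrow> real \<Rightarrow> ennreal" where
  "Psi \<alpha> \<rho> \<theta> u = (\<integral>\<^sup>+U. ennreal (iprod (\<lambda>i. \<rho> (u * stick_breaking U i))) \<partial>gem \<alpha> \<theta>)"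

locale pd_unit = pd_index +
  fixes \<rho> :: "real \<Rightarrow> real"
  assumes \<rho>_meas [measurable]: "\<rho> \<in> borel_measurable borel"
    and \<rho>_range: "\<And>x. \<rho> x \<in> {0..1}"
begin

lemma \<rho>_nonneg: "0 \<le> \<rho> x" and \<rho>_le_1: "\<rho> x \<le> 1"
  using \<rho>_range[of x] by auto

lemma measurable_Psi [measurable]:
  assumes "- \<alpha> < \<theta>"
  shows "Psi \<alpha> \<rho> \<theta> \<in> borel_measurable borel"
proof -
  interpret G: prob_space "gem \<alpha> \<theta>" using assms by (rule prob_space_gem)
  show ?thesis unfolding Psi_def[abs_def] by measurable
qed

lemma Psi_le_1: 
  assumes "- \<alpha> < \<theta>"
  shows "Psi \<alpha> \<rho> \<theta> u \<le> 1"
proof -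
  interpret G: prob_space "gem \<alpha> \<theta>" using assms by (rule prob_space_gem)
  have "Psi \<alpha> \<rho> \<theta> u \<le> (\<integral>\<^sup>+U. 1 \<partial>gem \<alpha> \<theta>)"
    unfolding Psi_def
    by (intro nn_integral_mono) (use iprod_range[of "\<lambda>i. \<rho> (u * stick_breaking _ i)", OF \<rho>_range] in auto)
  then show ?thesis by (simp add: G.emeasure_space_1)
qed

lemma Psi_rec:
  assumes "- \<alpha> < \<theta>"
  shows "Psi \<alpha> \<rho> \<theta> u = (\<integral>\<^sup>+x. ennreal (\<rho> (u * x)) * Psi \<alpha> \<rho> (\<theta> + \<alpha>) (u * (1 - x)) \<partial>beta_measure (1 - \<alpha>) (\<theta> + \<alpha>))"
proof -
  have "iprod (\<lambda>i. \<rho> (u * stick_breaking (case_nat x U) i)) =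
      \<rho> (u * x) * iprod (\<lambda>i. \<rho> (u * (1 - x) * stick_breaking U i))" for x U
    by (subst iprod_Suc[OF \<rho>_range]) (simp add: stick_breaking_case_nat_0 stick_breaking_case_nat_Suc mult.assoc)
  then have "Psi \<alpha> \<rho> \<theta> u = (\<integral>\<^sup>+x. (\<integral>\<^sup>+U. ennreal (\<rho> (u * x)) * ennreal (iprod (\<lambda>i. \<rho> (u * (1 - x) * stick_breaking U i))) \<partial>gem \<alpha> (\<theta> + \<alpha>)) \<partial>beta_measure (1 - \<alpha>) (\<theta> + \<alpha>))"
    unfolding Psi_def using assms by (subst nn_integral_gem) (auto simp: ennreal_mult' \<rho>_nonneg)
  then show ?thesis by (simp add: nn_integral_cmult Psi_def)
qed

text \<open>The weight exp(-s u) splits as exp(-s u x) exp(-s u (1 - x)), and \<theta> = a + b - 1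
  for a = 1 - \<alpha>, b = \<theta> + \<alpha>. So the beta-gamma identity separates the first
  stick from the others.\<close>

lemma Psi_moment_rec:
  assumes \<theta>: "- \<alpha> < \<theta>"
  shows "(\<integral>\<^sup>+u\<in>{0<..}. ennreal (u powr \<theta> * exp (- s * u)) * Psi \<alpha> \<rho> \<theta> u \<partial>lborel) =
    ennreal (1 / Beta (1 - \<alpha>) (\<theta> + \<alpha>)) * ((\<integral>\<^sup>+x\<in>{0<..}. ennreal (x powr (- \<alpha>) * exp (- s * x) * \<rho> x) \<partial>lborel) *
        (\<integral>\<^sup>+y\<in>{0<..}. ennreal (y powr (\<theta> + \<alpha> - 1) * exp (- s * y)) * Psi \<alpha> \<rho> (\<theta> + \<alpha>) y \<partial>lborel))"
proof -
  have pos: "0 < 1 - \<alpha>" "0 < \<theta> + \<alpha>" "- \<alpha> < \<theta> + \<alpha>" using \<theta> \<alpha>_pos \<alpha>_less_1 by auto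
  note [measurable] = measurable_Psi[OF pos(3)]
  let ?F = "\<lambda>x. ennreal (exp (- s * x) * \<rho> x)" and ?G = "\<lambda>y. ennreal (exp (- s * y)) * Psi \<alpha> \<rho> (\<theta> + \<alpha>) y"
  have "(\<integral>\<^sup>+u\<in>{0<..}. ennreal (u powr \<theta> * exp (- s * u)) * Psi \<alpha> \<rho> \<theta> u \<partial>lborel) =
    (\<integral>\<^sup>+u\<in>{0<..}. ennreal (u powr (1 - \<alpha> + (\<theta> + \<alpha>) - 1)) * (\<integral>\<^sup>+x. ?F (u * x) * ?G (u * (1 - x)) \<partial>beta_measure (1 - \<alpha>) (\<theta> + \<alpha>)) \<partial>lborel)"
  proof (rule nn_integral_cong)
    fix u :: real
    have "?F (u * x) * ?G (u * (1 - x)) = ennreal (exp (- s * u)) * (ennreal (\<rho> (u * x)) * Psi \<alpha> \<rho> (\<theta> + \<alpha>) (u * (1 - x)))" for x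
    proof -
      have "exp (- s * (u * x)) * \<rho> (u * x) * exp (- s * (u * (1 - x))) = exp (- s * u) * \<rho> (u * x)"
        by (simp add: exp_add[symmetric] algebra_simps)
      then have "ennreal (exp (- s * (u * x)) * \<rho> (u * x)) * ennreal (exp (- s * (u * (1 - x)))) = ennreal (exp (- s * u)) * ennreal (\<rho> (u * x))"
        by (simp add: ennreal_mult[symmetric] \<rho>_nonneg)
      then show ?thesis by (simp add: mult.assoc[symmetric])
    qed
    then have "(\<integral>\<^sup>+x. ?F (u * x) * ?G (u * (1 - x)) \<partial>beta_measure (1 - \<alpha>) (\<theta> + \<alpha>)) = ennreal (exp (- s * u)) * Psi \<alpha> \<rho> \<theta> u"
      by (simp add: nn_integral_cmult Psi_rec[OF \<theta>])
    then show "ennreal (u powr \<theta> * exp (- s * u)) * Psi \<alpha> \<rho> \<theta> u * indicator {0<..} u =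
      ennreal (u powr (1 - \<alpha> + (\<theta> + \<alpha>) - 1)) * (\<integral>\<^sup>+x. ?F (u * x) * ?G (u * (1 - x)) \<partial>beta_measure (1 - \<alpha>) (\<theta> + \<alpha>)) * indicator {0<..} u"
      by (simp add: ennreal_mult mult.assoc)
  qed
  also have "\<dots> = ennreal (1 / Beta (1 - \<alpha>) (\<theta> + \<alpha>)) * ((\<integral>\<^sup>+x\<in>{0<..}. ennreal (x powr (1 - \<alpha> - 1)) * ?F x \<partial>lborel) *
                       (\<integral>\<^sup>+y\<in>{0<..}. ennreal (y powr (\<theta> + \<alpha> - 1)) * ?G y \<partial>lborel))"
    by (rule beta_gamma_algebra) (use pos in auto)
  finally show ?thesis by (simp add: ennreal_mult \<rho>_nonneg mult.assoc)
qed

end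

section \<open>The Laplace exponent\<close>

definition levy_int :: "real \<Rightarrow> (real \<Rightarrow> real) \<Rightarrow> ennreal" where
  "levy_int \<alpha> \<psi> = (\<integral>\<^sup>+x\<in>{0<..}. ennreal (x powr (- \<alpha> - 1) * (1 - \<psi> x)) \<partial>lborel)"

text \<open>Normalised so that \<rho> = 1 gives \<open>s powr \<alpha>\<close>, the exponent of the
  stable subordinator. \<open>enn2real\<close> would send an infinite integral to 0, which is why
  \<open>pd_levy\<close> asks for finiteness.\<close>

definition Phi :: "real \<Rightarrow> (real \<Rightarrow> real) \<Rightarrow> real \<Rightarrow> real" where
  "Phi \<alpha> \<rho> s = \<alpha> / Gamma (1 - \<alpha>) * enn2real (levy_int \<alpha> (\<lambda>x. exp (- s * x) * \<rho> x))"

definition kern :: "real \<Rightarrow> (real \<Rightarrow> real) \<Rightarrow> real \<Rightarrow> ennreal" where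
  "kern \<alpha> \<rho> s = (\<integral>\<^sup>+x\<in>{0<..}. ennreal (x powr (- \<alpha>) * exp (- s * x) * \<rho> x) \<partial>lborel)"

text \<open>Normalised so that \<open>\<alpha> * Kf \<alpha> \<rho> s\<close> is the derivative of
  \<open>Phi\<close> and \<rho> = 1 gives \<open>s powr (\<alpha> - 1)\<close>.\<close>

definition Kf :: "real \<Rightarrow> (real \<Rightarrow> real) \<Rightarrow> real \<Rightarrow> real" where
  "Kf \<alpha> \<rho> s = enn2real (kern \<alpha> \<rho> s) / Gamma (1 - \<alpha>)"

text \<open>The antiderivative \<open>D\<close> with \<open>D' z = - \<Gamma>(\<theta> + 1) / \<alpha> \<cdot> z\<^sup>-\<^sup>\<theta>\<^sup>/\<^sup>\<alpha>\<^sup>-\<^sup>1\<close>.\<close>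

definition Dfun :: "real \<Rightarrow> real \<Rightarrow> real \<Rightarrow> real" where
  "Dfun \<alpha> \<theta> z = (if \<theta> = 0 then - ln z / \<alpha> else Gamma \<theta> * z powr (- \<theta> / \<alpha>))"

text \<open>Equals s^(-\<eta>) times the mean of \<open>Psi\<close> at a gamma variable of shape
  \<eta> and rate s. The target value is
  \<open>Phi \<alpha> \<rho> s powr (- \<eta> / \<alpha>)\<close>; for \<rho> = 1 both are
  \<open>s powr (- \<eta>)\<close>.\<close>

definition Hn :: "real \<Rightarrow> (real \<Rightarrow> real) \<Rightarrow> real \<Rightarrow> real \<Rightarrow> ennreal" where
  "Hn \<alpha> \<rho> \<eta> s = ennreal (1 / Gamma \<eta>) * (\<integral>\<^sup>+y\<in>{0<..}. ennreal (y powr (\<eta> - 1) * exp (- s * y)) * Psi \<alpha> \<rho> \<eta> y \<partial>lborel)"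

lemma nn_integral_powr_atLeast:
  assumes "0 < a" "0 < (s::real)"
  shows "(\<integral>\<^sup>+q\<in>{s..}. ennreal (q powr (- a - 1)) \<partial>lborel) = ennreal (s powr (- a) / a)"
proof -
  have "(\<integral>\<^sup>+q\<in>{s..}. ennreal (q powr (- a - 1)) \<partial>lborel) = ennreal (0 - - (s powr (- a) / a))"
  proof (rule nn_integral_FTC_atLeast)
    fix q assume "s \<le> q"
    then show "((\<lambda>q. - (q powr (- a) / a)) has_real_derivative q powr (- a - 1)) (at q)"
      using assms by (auto intro!: derivative_eq_intros)
  next
    have "((\<lambda>q. - (q powr (- a) / a)) \<longlongrightarrow> - (0 / a)) at_top"
      using assms by (intro tendsto_intros tendsto_neg_powr filterlim_ident) auto
    then show "((\<lambda>q. - (q powr (- a) / a)) \<longlongrightarrow> 0) at_top" by simp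
  qed auto
  then show ?thesis by simp
qed

context pd_index
begin

lemma Gamma_1_\<alpha>_pos: "0 < Gamma (1 - \<alpha>)"
  using \<alpha>_less_1 by (intro Gamma_real_pos) auto

end

context pd_unit
begin

lemma kern_le:
  assumes "0 < s"
  shows "kern \<alpha> \<rho> s \<le> ennreal (Gamma (1 - \<alpha>) * s powr (\<alpha> - 1))"
proof -
  have "kern \<alpha> \<rho> s \<le> (\<integral>\<^sup>+x\<in>{0<..}. ennreal (x powr ((1 - \<alpha>) - 1) * exp (- s * x)) \<partial>lborel)"
    unfolding kern_def using \<rho>_nonneg \<rho>_le_1
    by (intro nn_integral_mono mult_right_mono ennreal_leI) (auto intro!: mult_left_le)
  also have "\<dots> = ennreal (Gamma (1 - \<alpha>) * s powr (- (1 - \<alpha>)))"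
    using assms \<alpha>_less_1 by (intro nn_integral_Gamma) auto
  finally show ?thesis by simp
qed

lemma kern_eq:
  assumes "0 < s"
  shows "kern \<alpha> \<rho> s = ennreal (Gamma (1 - \<alpha>) * Kf \<alpha> \<rho> s)"
proof -
  have "kern \<alpha> \<rho> s < \<infinity>" using le_less_trans[OF kern_le[OF assms]] by simp
  then show ?thesis using Gamma_1_\<alpha>_pos by (simp add: Kf_def)
qed

lemma Kf_nonneg: "0 \<le> Kf \<alpha> \<rho> s"
  using Gamma_1_\<alpha>_pos by (simp add: Kf_def)

lemma Kf_le:
  assumes "0 < s"
  shows "Kf \<alpha> \<rho> s \<le> s powr (\<alpha> - 1)"
proof -
  have "ennreal (Gamma (1 - \<alpha>) * Kf \<alpha> \<rho> s) \<le> ennreal (Gamma (1 - \<alpha>) * s powr (\<alpha> - 1))"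
    using kern_le[OF assms] kern_eq[OF assms] by simp
  then show ?thesis using Gamma_1_\<alpha>_pos by (simp add: ennreal_le_iff)
qed

lemma measurable_kern [measurable]: "kern \<alpha> \<rho> \<in> borel_measurable borel"
  unfolding kern_def[abs_def] by measurable

lemma measurable_Kf [measurable]: "Kf \<alpha> \<rho> \<in> borel_measurable borel"
  unfolding Kf_def[abs_def] by measurable

text \<open>The three Gamma factors of the beta constant normalise the kernel, the transform at
  \<theta> + \<alpha> and the moment. Since \<theta> + \<alpha> > 0, this also gives access to
  -\<alpha> < \<theta> \<le> 0, where the transform at \<theta> itself may diverge.\<close>

lemma moment_eq_Hn:
  assumes \<theta>: "- \<alpha> < \<theta>" and s: "0 < s"
  shows "(\<integral>\<^sup>+u\<in>{0<..}. ennreal (u powr \<theta> * exp (- s * u)) * Psi \<alpha> \<rho> \<theta> u \<partial>lborel) =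
    ennreal (Gamma (\<theta> + 1) * Kf \<alpha> \<rho> s) * Hn \<alpha> \<rho> (\<theta> + \<alpha>) s"
proof -
  let ?I = "\<integral>\<^sup>+y\<in>{0<..}. ennreal (y powr (\<theta> + \<alpha> - 1) * exp (- s * y)) * Psi \<alpha> \<rho> (\<theta> + \<alpha>) y \<partial>lborel"
  have g: "0 < Gamma (\<theta> + \<alpha>)" "0 < Gamma (\<theta> + 1)"
    using \<theta> \<alpha>_less_1 by (auto intro!: Gamma_real_pos)
  have "1 / Beta (1 - \<alpha>) (\<theta> + \<alpha>) * (Gamma (1 - \<alpha>) * Kf \<alpha> \<rho> s) = Gamma (\<theta> + 1) * Kf \<alpha> \<rho> s * (1 / Gamma (\<theta> + \<alpha>))"
    using g Gamma_1_\<alpha>_pos by (simp add: Beta_def field_simps)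
  then have "ennreal (1 / Beta (1 - \<alpha>) (\<theta> + \<alpha>)) * ennreal (Gamma (1 - \<alpha>) * Kf \<alpha> \<rho> s) =
     ennreal (Gamma (\<theta> + 1) * Kf \<alpha> \<rho> s) * ennreal (1 / Gamma (\<theta> + \<alpha>))"
    using g Gamma_1_\<alpha>_pos Kf_nonneg[of s] Beta_real_pos[of "1 - \<alpha>" "\<theta> + \<alpha>"] \<theta> \<alpha>_less_1
    by (simp add: ennreal_mult[symmetric])
  then show ?thesis
    unfolding Psi_moment_rec[OF \<theta>] kern_def[symmetric] kern_eq[OF s] Hn_def
    by (simp add: mult.assoc[symmetric])
qed

text \<open>Writing exp(-s y) as the integral of y exp(-q y) over q \<ge> s raises the power of y
  from \<eta> - 1 to \<eta>, and the inner integral becomes the moment computed in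
  \<open>moment_eq_Hn\<close>.\<close>

lemma Hn_rec:
  assumes \<eta>: "0 < \<eta>" and s: "0 < s"
  shows "Hn \<alpha> \<rho> \<eta> s = (\<integral>\<^sup>+q\<in>{s..}. ennreal (\<eta> * Kf \<alpha> \<rho> q) * Hn \<alpha> \<rho> (\<eta> + \<alpha>) q \<partial>lborel)"
proof -
  have \<eta>': "- \<alpha> < \<eta>" "- \<alpha> < \<eta> + \<alpha>" using \<eta> \<alpha>_pos by auto
  note [measurable] = measurable_Psi[OF \<eta>'(1)] measurable_Psi[OF \<eta>'(2)]
  have g: "0 < Gamma \<eta>" "Gamma (\<eta> + 1) = \<eta> * Gamma \<eta>"
    using \<eta> by (auto intro!: Gamma_real_pos simp: Gamma_plus1 nonpos_Ints_def)
  have g': "Gamma \<eta> \<noteq> 0" using g(1) by linarith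
  have "(\<integral>\<^sup>+y\<in>{0<..}. ennreal (y powr (\<eta> - 1) * exp (- s * y)) * Psi \<alpha> \<rho> \<eta> y \<partial>lborel) =
    (\<integral>\<^sup>+y. (\<integral>\<^sup>+q. ennreal (y powr \<eta> * exp (- q * y)) * Psi \<alpha> \<rho> \<eta> y * indicator {0<..} y * indicator {s..} q \<partial>lborel) \<partial>lborel)"
  proof (rule nn_integral_cong)
    fix y :: real
    show "ennreal (y powr (\<eta> - 1) * exp (- s * y)) * Psi \<alpha> \<rho> \<eta> y * indicator {0<..} y =
       (\<integral>\<^sup>+q. ennreal (y powr \<eta> * exp (- q * y)) * Psi \<alpha> \<rho> \<eta> y * indicator {0<..} y * indicator {s..} q \<partial>lborel)"
    proof (cases "0 < y")
      case True
      have "(\<integral>\<^sup>+q. ennreal (y powr \<eta> * exp (- q * y)) * Psi \<alpha> \<rho> \<eta> y * indicator {0<..} y * indicator {s..} q \<partial>lborel) =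
         (\<integral>\<^sup>+q. (ennreal (y powr (\<eta> - 1)) * Psi \<alpha> \<rho> \<eta> y) * (ennreal (y * exp (- q * y)) * indicator {s..} q) \<partial>lborel)"
      proof (rule nn_integral_cong)
        fix q
        have "ennreal (y powr \<eta> * exp (- q * y)) = ennreal (y powr (\<eta> - 1)) * ennreal (y * exp (- q * y))"
          using True by (simp add: ennreal_mult[symmetric] powr_diff)
        then show "ennreal (y powr \<eta> * exp (- q * y)) * Psi \<alpha> \<rho> \<eta> y * indicator {0<..} y * indicator {s..} q =
           (ennreal (y powr (\<eta> - 1)) * Psi \<alpha> \<rho> \<eta> y) * (ennreal (y * exp (- q * y)) * indicator {s..} q)"
          using True by (simp add: mult.assoc mult.left_commute)
      qed
      also have "\<dots> = (ennreal (y powr (\<eta> - 1)) * Psi \<alpha> \<rho> \<eta> y) * ennreal (exp (- s * y))"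
        by (subst nn_integral_cmult) (auto simp: nn_integral_exp_atLeast[OF True, simplified])
      finally show ?thesis using True by (simp add: ennreal_mult ac_simps)
    qed simp
  qed
  also have "\<dots> = (\<integral>\<^sup>+q. (\<integral>\<^sup>+y. ennreal (y powr \<eta> * exp (- q * y)) * Psi \<alpha> \<rho> \<eta> y * indicator {0<..} y * indicator {s..} q \<partial>lborel) \<partial>lborel)"
    by (rule lborel_pair.Fubini') simp
  also have "\<dots> = (\<integral>\<^sup>+q\<in>{s..}. ennreal (Gamma (\<eta> + 1) * Kf \<alpha> \<rho> q) * Hn \<alpha> \<rho> (\<eta> + \<alpha>) q \<partial>lborel)"
  proof (rule nn_integral_cong)
    fix q
    show "(\<integral>\<^sup>+y. ennreal (y powr \<eta> * exp (- q * y)) * Psi \<alpha> \<rho> \<eta> y * indicator {0<..} y * indicator {s..} q \<partial>lborel) =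
      ennreal (Gamma (\<eta> + 1) * Kf \<alpha> \<rho> q) * Hn \<alpha> \<rho> (\<eta> + \<alpha>) q * indicator {s..} q"
      using moment_eq_Hn[OF \<eta>'(1), of q] s by (cases "s \<le> q") auto
  qed
  finally have "Hn \<alpha> \<rho> \<eta> s = ennreal (1 / Gamma \<eta>) * (\<integral>\<^sup>+q\<in>{s..}. ennreal (Gamma (\<eta> + 1) * Kf \<alpha> \<rho> q) * Hn \<alpha> \<rho> (\<eta> + \<alpha>) q \<partial>lborel)"
    unfolding Hn_def by simp
  also have "\<dots> = (\<integral>\<^sup>+q. ennreal (1 / Gamma \<eta>) * (ennreal (Gamma (\<eta> + 1) * Kf \<alpha> \<rho> q) * Hn \<alpha> \<rho> (\<eta> + \<alpha>) q * indicator {s..} q) \<partial>lborel)"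
    unfolding Hn_def[abs_def] by (rule nn_integral_cmult[symmetric]) measurable
  also have "\<dots> = (\<integral>\<^sup>+q\<in>{s..}. ennreal (\<eta> * Kf \<alpha> \<rho> q) * Hn \<alpha> \<rho> (\<eta> + \<alpha>) q \<partial>lborel)"
  proof (rule nn_integral_cong)
    fix q
    have "ennreal (1 / Gamma \<eta>) * ennreal (Gamma (\<eta> + 1) * Kf \<alpha> \<rho> q) = ennreal (\<eta> * Kf \<alpha> \<rho> q)"
      using g g' \<eta> Kf_nonneg[of q] by (simp add: ennreal_mult[symmetric])
    then show "ennreal (1 / Gamma \<eta>) * (ennreal (Gamma (\<eta> + 1) * Kf \<alpha> \<rho> q) * Hn \<alpha> \<rho> (\<eta> + \<alpha>) q * indicator {s..} q) =
        ennreal (\<eta> * Kf \<alpha> \<rho> q) * Hn \<alpha> \<rho> (\<eta> + \<alpha>) q * indicator {s..} q"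
      by (simp add: mult.assoc[symmetric])
  qed
  finally show ?thesis .
qed

lemma measurable_Hn: "- \<alpha> < \<eta> \<Longrightarrow> Hn \<alpha> \<rho> \<eta> \<in> borel_measurable borel"
  using measurable_Psi[of \<eta>] unfolding Hn_def[abs_def] by measurable

lemma Kf_isCont:
  assumes s: "0 < s"
  shows "isCont (Kf \<alpha> \<rho>) s"
proof (rule continuous_at_sequentiallyI)
  fix q assume q: "q \<longlonglongrightarrow> s"
  \<comment> \<open>Cutting the arguments off below s/2 gives one dominating function for the whole
    sequence; eventually the cut-off is inactive.\<close>
  let ?w = "\<lambda>x. ennreal (x powr (- \<alpha>) * exp (- (s / 2) * x)) * indicator {0<..} x"
  have "(\<lambda>n. kern \<alpha> \<rho> (max (s / 2) (q n))) \<longlonglongrightarrow> kern \<alpha> \<rho> (max (s / 2) s)"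
    unfolding kern_def
  proof (rule nn_integral_dominated_convergence[where w = ?w])
    show "(\<integral>\<^sup>+x. ?w x \<partial>lborel) < \<infinity>"
      using nn_integral_Gamma[of "1 - \<alpha>" "s / 2"] s \<alpha>_less_1 by simp
    show "AE x in lborel. (\<lambda>n. ennreal (x powr - \<alpha> * exp (- max (s / 2) (q n) * x) * \<rho> x) * indicator {0<..} x)
        \<longlonglongrightarrow> ennreal (x powr - \<alpha> * exp (- max (s / 2) s * x) * \<rho> x) * indicator {0<..} x"
      by (auto simp: indicator_def intro!: tendsto_intros q tendsto_max)
    fix n
    show "AE x in lborel. ennreal (x powr - \<alpha> * exp (- max (s / 2) (q n) * x) * \<rho> x) * indicator {0<..} x \<le> ?w x"
    proof (rule AE_I2)
      fix x :: real
      have "x powr - \<alpha> * exp (- max (s / 2) (q n) * x) * \<rho> x \<le> x powr - \<alpha> * exp (- (s / 2) * x)" if "0 < x"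
      proof -
        have "exp (- max (s / 2) (q n) * x) * \<rho> x \<le> exp (- (s / 2) * x) * 1"
          using that \<rho>_nonneg \<rho>_le_1 by (intro mult_mono) auto
        then show ?thesis by (simp add: mult.assoc mult_left_mono)
      qed
      then show "ennreal (x powr - \<alpha> * exp (- max (s / 2) (q n) * x) * \<rho> x) * indicator {0<..} x \<le> ?w x"
        by (auto simp: indicator_def intro: ennreal_leI)
    qed
  qed measurable
  moreover have "max (s / 2) s = s" using s by simp
  ultimately have "(\<lambda>n. kern \<alpha> \<rho> (max (s / 2) (q n))) \<longlonglongrightarrow> ennreal (Gamma (1 - \<alpha>) * Kf \<alpha> \<rho> s)"
    by (simp add: kern_eq[OF s])
  then have "(\<lambda>n. enn2real (kern \<alpha> \<rho> (max (s / 2) (q n)))) \<longlonglongrightarrow> Gamma (1 - \<alpha>) * Kf \<alpha> \<rho> s"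
    by (rule tendsto_enn2real) (use Gamma_1_\<alpha>_pos Kf_nonneg in auto)
  then have "(\<lambda>n. Kf \<alpha> \<rho> (max (s / 2) (q n))) \<longlonglongrightarrow> Gamma (1 - \<alpha>) * Kf \<alpha> \<rho> s / Gamma (1 - \<alpha>)"
    unfolding Kf_def[of _ _ "max _ _"] using Gamma_1_\<alpha>_pos by (intro tendsto_divide tendsto_const) auto
  then have "(\<lambda>n. Kf \<alpha> \<rho> (max (s / 2) (q n))) \<longlonglongrightarrow> Kf \<alpha> \<rho> s" using Gamma_1_\<alpha>_pos by simp
  moreover have "\<forall>\<^sub>F n in sequentially. Kf \<alpha> \<rho> (max (s / 2) (q n)) = Kf \<alpha> \<rho> (q n)"
  proof -
    have "\<forall>\<^sub>F n in sequentially. s / 2 < q n" using order_tendstoD(1)[OF q, of "s / 2"] s by simp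
    then show ?thesis by eventually_elim (simp add: max_def)
  qed
  ultimately show "(\<lambda>n. Kf \<alpha> \<rho> (q n)) \<longlonglongrightarrow> Kf \<alpha> \<rho> s" by (rule Lim_transform_eventually)
qed

text \<open>Separates the pure stable part from the correction by 1 - \<rho>. The lower and the
  upper bound on \<open>Phi\<close> are both read off from it.\<close>

lemma levy_int_split:
  assumes "0 < s"
  shows "levy_int \<alpha> (\<lambda>x. exp (- s * x) * \<rho> x) = ennreal (Gamma (1 - \<alpha>) / \<alpha> * s powr \<alpha>) +
      (\<integral>\<^sup>+x\<in>{0<..}. ennreal (x powr (- \<alpha> - 1) * (exp (- s * x) * (1 - \<rho> x))) \<partial>lborel)"
proof -
  have "ennreal (x powr (- \<alpha> - 1) * (1 - exp (- s * x) * \<rho> x)) * indicator {0<..} x =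
     ennreal (x powr (- \<alpha> - 1) * (1 - exp (- s * x))) * indicator {0<..} x +
     ennreal (x powr (- \<alpha> - 1) * (exp (- s * x) * (1 - \<rho> x))) * indicator {0<..} x" for x
    using assms \<rho>_le_1[of x] by (auto simp: indicator_def ennreal_plus[symmetric] algebra_simps simp del: ennreal_plus)
  then have "levy_int \<alpha> (\<lambda>x. exp (- s * x) * \<rho> x) =
     (\<integral>\<^sup>+x\<in>{0<..}. ennreal (x powr (- \<alpha> - 1) * (1 - exp (- s * x))) \<partial>lborel) +
     (\<integral>\<^sup>+x\<in>{0<..}. ennreal (x powr (- \<alpha> - 1) * (exp (- s * x) * (1 - \<rho> x))) \<partial>lborel)"
    unfolding levy_int_def by (simp only:) (rule nn_integral_add; measurable)
  then show ?thesis
    using nn_integral_one_minus_exp[of "- \<alpha>" s] \<alpha>_pos \<alpha>_less_1 assms by simp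
qed

text \<open>The derivative of the exponent in integrated form. The additive shape avoids subtracting
  values that are not yet known to be finite.\<close>

lemma levy_int_increment:
  assumes "0 < a" "a \<le> b"
  shows "levy_int \<alpha> (\<lambda>x. exp (- b * x) * \<rho> x) = levy_int \<alpha> (\<lambda>x. exp (- a * x) * \<rho> x) + (\<integral>\<^sup>+q\<in>{a..b}. kern \<alpha> \<rho> q \<partial>lborel)"
proof -
  have "(\<integral>\<^sup>+q\<in>{a..b}. kern \<alpha> \<rho> q \<partial>lborel) =
    (\<integral>\<^sup>+q. (\<integral>\<^sup>+x. ennreal (x powr (- \<alpha>) * exp (- q * x) * \<rho> x) * indicator {0<..} x * indicator {a..b} q \<partial>lborel) \<partial>lborel)"
    unfolding kern_def by (subst nn_integral_multc) auto
  also have "\<dots> = (\<integral>\<^sup>+x. (\<integral>\<^sup>+q. ennreal (x powr (- \<alpha>) * exp (- q * x) * \<rho> x) * indicator {0<..} x * indicator {a..b} q \<partial>lborel) \<partial>lborel)"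
    by (rule lborel_pair.Fubini') simp
  also have "\<dots> = (\<integral>\<^sup>+x\<in>{0<..}. ennreal (x powr (- \<alpha> - 1) * (\<rho> x * (exp (- a * x) - exp (- b * x)))) \<partial>lborel)"
  proof (rule nn_integral_cong)
    fix x :: real
    show "(\<integral>\<^sup>+q. ennreal (x powr (- \<alpha>) * exp (- q * x) * \<rho> x) * indicator {0<..} x * indicator {a..b} q \<partial>lborel) =
       ennreal (x powr (- \<alpha> - 1) * (\<rho> x * (exp (- a * x) - exp (- b * x)))) * indicator {0<..} x"
    proof (cases "0 < x")
      case True
      have "(\<integral>\<^sup>+q. ennreal (x powr (- \<alpha>) * exp (- q * x) * \<rho> x) * indicator {0<..} x * indicator {a..b} q \<partial>lborel) =
        (\<integral>\<^sup>+q. ennreal (x powr (- \<alpha> - 1) * \<rho> x) * (ennreal (x * exp (- q * x)) * indicator {a..b} q) \<partial>lborel)"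
        using True by (intro nn_integral_cong)
          (auto simp: indicator_def ennreal_mult[symmetric] powr_diff \<rho>_nonneg)
      also have "\<dots> = ennreal (x powr (- \<alpha> - 1) * \<rho> x) * ennreal (exp (- a * x) - exp (- b * x))"
        using nn_integral_exp_Icc[of x a b] True assms by (subst nn_integral_cmult) auto
      finally show ?thesis
        using True assms by (simp add: ennreal_mult[symmetric] \<rho>_nonneg mult.assoc mult_right_mono)
    qed simp
  qed
  finally have *: "(\<integral>\<^sup>+q\<in>{a..b}. kern \<alpha> \<rho> q \<partial>lborel) = \<dots>" .
  have "ennreal (x powr (- \<alpha> - 1) * (1 - exp (- b * x) * \<rho> x)) * indicator {0<..} x =
     ennreal (x powr (- \<alpha> - 1) * (1 - exp (- a * x) * \<rho> x)) * indicator {0<..} x +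
     ennreal (x powr (- \<alpha> - 1) * (\<rho> x * (exp (- a * x) - exp (- b * x)))) * indicator {0<..} x" for x
  proof (cases "0 < x")
    case True
    have "exp (- a * x) * \<rho> x \<le> 1 * 1"
      using True assms \<rho>_le_1[of x] \<rho>_nonneg[of x] by (intro mult_mono) auto
    moreover have "0 \<le> \<rho> x * (exp (- a * x) - exp (- b * x))"
      using True assms \<rho>_nonneg[of x] by (intro mult_nonneg_nonneg) (auto intro: mult_right_mono)
    moreover have "x powr (- \<alpha> - 1) * (1 - exp (- b * x) * \<rho> x) =
      x powr (- \<alpha> - 1) * (1 - exp (- a * x) * \<rho> x) + x powr (- \<alpha> - 1) * (\<rho> x * (exp (- a * x) - exp (- b * x)))"
      by (simp add: algebra_simps)
    ultimately show ?thesis using True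
      by (simp only:) (subst ennreal_plus, auto)
  qed simp
  then show ?thesis unfolding * levy_int_def by (simp only:) (rule nn_integral_add; measurable)
qed

end

section \<open>Bounds, derivative and powers of the Laplace exponent\<close>

locale pd_levy = pd_unit +
  assumes levy_finite: "\<And>s. 0 < s \<Longrightarrow> levy_int \<alpha> (\<lambda>x. exp (- s * x) * \<rho> x) < \<infinity>"
begin

lemma levy_int_eq:
  assumes "0 < s"
  shows "levy_int \<alpha> (\<lambda>x. exp (- s * x) * \<rho> x) = ennreal (Gamma (1 - \<alpha>) / \<alpha> * Phi \<alpha> \<rho> s)"
  using levy_finite[OF assms] Gamma_1_\<alpha>_pos \<alpha>_pos by (simp add: Phi_def)

lemma Phi_nonneg: "0 \<le> Phi \<alpha> \<rho> s"
  using Gamma_1_\<alpha>_pos \<alpha>_pos by (simp add: Phi_def)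

lemma Phi_ge:
  assumes "0 < s"
  shows "s powr \<alpha> \<le> Phi \<alpha> \<rho> s"
proof -
  have "ennreal (Gamma (1 - \<alpha>) / \<alpha> * s powr \<alpha>) \<le> ennreal (Gamma (1 - \<alpha>) / \<alpha> * Phi \<alpha> \<rho> s)"
    unfolding levy_int_eq[OF assms, symmetric] levy_int_split[OF assms]
    by (rule add_increasing2[OF zero_le order_refl])
  then have "Gamma (1 - \<alpha>) / \<alpha> * s powr \<alpha> \<le> Gamma (1 - \<alpha>) / \<alpha> * Phi \<alpha> \<rho> s"
    using Gamma_1_\<alpha>_pos \<alpha>_pos Phi_nonneg[of s] by (subst (asm) ennreal_le_iff) auto
  then show ?thesis
    by (rule mult_le_cancel_left_pos[THEN iffD1, rotated]) (use Gamma_1_\<alpha>_pos \<alpha>_pos in auto)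
qed

lemma Phi_pos: "0 < s \<Longrightarrow> 0 < Phi \<alpha> \<rho> s"
  using Phi_ge[of s] by (smt (verit) powr_gt_zero)

text \<open>No differentiation under the integral: on [s/2, 2 s] the increment formula exhibits
  \<open>Phi\<close> as an integral of the continuous function \<open>Kf\<close>.\<close>

lemma Phi_DERIV:
  assumes s: "0 < s"
  shows "(Phi \<alpha> \<rho> has_real_derivative \<alpha> * Kf \<alpha> \<rho> s) (at s)"
proof -
  let ?a = "s / 2" and ?b = "2 * s"
  have cont: "continuous_on {?a..?b} (Kf \<alpha> \<rho>)"
    using s by (intro continuous_at_imp_continuous_on ballI Kf_isCont) auto
  have eq: "Phi \<alpha> \<rho> x = Phi \<alpha> \<rho> ?a + \<alpha> * integral {?a..x} (Kf \<alpha> \<rho>)" if x: "x \<in> {?a..?b}" for x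
  proof -
    have a: "0 < ?a" "0 < x" "?a \<le> x" using s x by auto
    have int: "Kf \<alpha> \<rho> integrable_on {?a..x}"
      using x by (intro integrable_continuous_real continuous_on_subset[OF cont]) auto
    have "(\<integral>\<^sup>+q\<in>{?a..x}. kern \<alpha> \<rho> q \<partial>lborel) = (\<integral>\<^sup>+q. ennreal (Gamma (1 - \<alpha>)) * (ennreal (Kf \<alpha> \<rho> q) * indicator {?a..x} q) \<partial>lborel)"
      using a Gamma_1_\<alpha>_pos Kf_nonneg by (intro nn_integral_cong) (auto simp: indicator_def kern_eq ennreal_mult)
    also have "\<dots> = ennreal (Gamma (1 - \<alpha>)) * (\<integral>\<^sup>+q\<in>{?a..x}. ennreal (Kf \<alpha> \<rho> q) \<partial>lborel)"
      by (rule nn_integral_cmult) measurable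
    also have "(\<integral>\<^sup>+q\<in>{?a..x}. ennreal (Kf \<alpha> \<rho> q) \<partial>lborel) = ennreal (integral {?a..x} (Kf \<alpha> \<rho>))"
      by (rule nn_integral_has_integral_lebesgue') (use int Kf_nonneg in \<open>auto simp: has_integral_integral\<close>)
    finally have k: "(\<integral>\<^sup>+q\<in>{?a..x}. kern \<alpha> \<rho> q \<partial>lborel) = ennreal (Gamma (1 - \<alpha>) * integral {?a..x} (Kf \<alpha> \<rho>))"
      using Gamma_1_\<alpha>_pos int Kf_nonneg by (simp add: ennreal_mult integral_nonneg)
    have "ennreal (Gamma (1 - \<alpha>) / \<alpha> * Phi \<alpha> \<rho> x) = ennreal (Gamma (1 - \<alpha>) / \<alpha> * Phi \<alpha> \<rho> ?a + Gamma (1 - \<alpha>) * integral {?a..x} (Kf \<alpha> \<rho>))"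
      using levy_int_increment[OF a(1,3)] unfolding k levy_int_eq[OF a(1)] levy_int_eq[OF a(2)]
      using Gamma_1_\<alpha>_pos \<alpha>_pos Phi_nonneg[of ?a] int Kf_nonneg
      by (simp add: ennreal_plus[symmetric] integral_nonneg del: ennreal_plus)
    then have "Gamma (1 - \<alpha>) / \<alpha> * Phi \<alpha> \<rho> x = Gamma (1 - \<alpha>) / \<alpha> * Phi \<alpha> \<rho> ?a + Gamma (1 - \<alpha>) * integral {?a..x} (Kf \<alpha> \<rho>)"
      using Gamma_1_\<alpha>_pos \<alpha>_pos Phi_nonneg int Kf_nonneg
      by (subst (asm) ennreal_inj) (auto intro!: add_nonneg_nonneg mult_nonneg_nonneg integral_nonneg)
    also have "\<dots> = Gamma (1 - \<alpha>) / \<alpha> * (Phi \<alpha> \<rho> ?a + \<alpha> * integral {?a..x} (Kf \<alpha> \<rho>))"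
      using \<alpha>_pos by (simp add: field_simps)
    finally show ?thesis
      by (rule mult_left_cancel[THEN iffD1, rotated]) (use Gamma_1_\<alpha>_pos \<alpha>_pos in auto)
  qed
  have "((\<lambda>x. Phi \<alpha> \<rho> ?a + \<alpha> * integral {?a..x} (Kf \<alpha> \<rho>)) has_real_derivative 0 + \<alpha> * Kf \<alpha> \<rho> s) (at s within {?a..?b})"
    using s by (intro derivative_intros DERIV_cmult integral_has_real_derivative cont) auto
  then have "(Phi \<alpha> \<rho> has_real_derivative 0 + \<alpha> * Kf \<alpha> \<rho> s) (at s within {?a..?b})"
    by (rule has_field_derivative_transform_within[OF _ zero_less_one]) (use s in simp, rule eq[symmetric])
  moreover have "at s within {?a..?b} = at s"
    using s by (intro at_within_Icc_at) auto
  ultimately show ?thesis by simp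
qed

text \<open>The integrand is the derivative of
  \<open>- (Phi \<alpha> \<rho> q powr (- \<eta> / \<alpha>))\<close>, and the boundary term at
  infinity vanishes because \<open>Phi\<close> dominates q^\<alpha>. This is the recursion
  \<open>Hn_rec\<close> with the power in place of \<open>Hn\<close>.\<close>

lemma powr_Phi_rec:
  assumes \<eta>: "0 < \<eta>" and s: "0 < s"
  shows "ennreal (Phi \<alpha> \<rho> s powr (- \<eta> / \<alpha>)) = (\<integral>\<^sup>+q\<in>{s..}. ennreal (\<eta> * Kf \<alpha> \<rho> q) * ennreal (Phi \<alpha> \<rho> q powr (- (\<eta> + \<alpha>) / \<alpha>)) \<partial>lborel)"
proof -
  have "(\<integral>\<^sup>+q\<in>{s..}. ennreal (\<eta> * Kf \<alpha> \<rho> q) * ennreal (Phi \<alpha> \<rho> q powr (- (\<eta> + \<alpha>) / \<alpha>)) \<partial>lborel) =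
    (\<integral>\<^sup>+q\<in>{s..}. ennreal (\<eta> * Kf \<alpha> \<rho> q * Phi \<alpha> \<rho> q powr (- (\<eta> + \<alpha>) / \<alpha>)) \<partial>lborel)"
    using \<eta> Kf_nonneg by (simp add: ennreal_mult)
  also have "\<dots> = ennreal (0 - - (Phi \<alpha> \<rho> s powr (- \<eta> / \<alpha>)))"
  proof (rule nn_integral_FTC_atLeast)
    have [measurable]: "Phi \<alpha> \<rho> \<in> borel_measurable borel"
      unfolding Phi_def[abs_def] levy_int_def by measurable
    show "(\<lambda>q. \<eta> * Kf \<alpha> \<rho> q * Phi \<alpha> \<rho> q powr (- (\<eta> + \<alpha>) / \<alpha>)) \<in> borel_measurable borel" by measurable
    fix q assume "s \<le> q"
    then have q: "0 < q" using s by simp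
    have eq: "- (\<eta> + \<alpha>) / \<alpha> = - \<eta> / \<alpha> - 1" using \<alpha>_pos by (simp add: field_simps)
    show "((\<lambda>q. - (Phi \<alpha> \<rho> q powr (- \<eta> / \<alpha>))) has_real_derivative \<eta> * Kf \<alpha> \<rho> q * Phi \<alpha> \<rho> q powr (- (\<eta> + \<alpha>) / \<alpha>)) (at q)"
      unfolding eq using Phi_pos[OF q] \<alpha>_pos
      by (auto intro!: derivative_eq_intros Phi_DERIV[OF q])
    show "0 \<le> \<eta> * Kf \<alpha> \<rho> q * Phi \<alpha> \<rho> q powr (- (\<eta> + \<alpha>) / \<alpha>)"
      using \<eta> Kf_nonneg by simp
  next
    have "((\<lambda>q. Phi \<alpha> \<rho> q powr (- \<eta> / \<alpha>)) \<longlongrightarrow> 0) at_top"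
    proof (rule tendsto_neg_powr)
      show "filterlim (Phi \<alpha> \<rho>) at_top at_top"
      proof (rule filterlim_at_top_mono)
        show "filterlim (\<lambda>q::real. exp (\<alpha> * ln q)) at_top at_top"
          by (intro filterlim_compose[OF exp_at_top] filterlim_tendsto_pos_mult_at_top[OF tendsto_const \<alpha>_pos ln_at_top])
        show "\<forall>\<^sub>F q in at_top. exp (\<alpha> * ln q) \<le> Phi \<alpha> \<rho> q"
          using eventually_gt_at_top[of 0] by eventually_elim (use Phi_ge in \<open>simp add: powr_def\<close>)
      qed
    qed (use \<eta> \<alpha>_pos in auto)
    then have "((\<lambda>q. - (Phi \<alpha> \<rho> q powr (- \<eta> / \<alpha>))) \<longlongrightarrow> - 0) at_top" by (rule tendsto_minus)
    then show "((\<lambda>q. - (Phi \<alpha> \<rho> q powr (- \<eta> / \<alpha>))) \<longlongrightarrow> 0) at_top" by simp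
  qed
  finally show ?thesis by simp
qed

end

section \<open>The Mellin identity\<close>

text \<open>The linear bound at 0 brings both solutions within C \<eta> s^(-\<eta> - 1) of
  s^(-\<eta>), the order at which the iteration contracts. It also implies that the Laplace exponent
  is finite.\<close>

locale pd_lip = pd_unit +
  fixes C :: real
  assumes C_nonneg: "0 \<le> C" and lip: "\<And>x. 0 \<le> x \<Longrightarrow> 1 - \<rho> x \<le> C * x"
begin

text \<open>The product inequality loses at most C u times the total length of the sticks, which is
  1 almost surely.\<close>

lemma Psi_ge:
  assumes \<theta>: "- \<alpha> < \<theta>" and u: "0 \<le> u"
  shows "1 \<le> Psi \<alpha> \<rho> \<theta> u + ennreal (C * u)"
proof -
  interpret G: prob_space "gem \<alpha> \<theta>" using \<theta> by (rule prob_space_gem)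
  have "(1::ennreal) = (\<integral>\<^sup>+U. 1 \<partial>gem \<alpha> \<theta>)" by (simp add: G.emeasure_space_1)
  also have "\<dots> \<le> (\<integral>\<^sup>+U. ennreal (iprod (\<lambda>i. \<rho> (u * stick_breaking U i))) + ennreal (C * u) \<partial>gem \<alpha> \<theta>)"
  proof (rule nn_integral_mono_AE, use AE_gem_unit[OF \<theta>] AE_gem_sums[OF \<theta>] in eventually_elim)
    fix U :: "nat \<Rightarrow> real" assume U: "\<forall>i. 0 < U i \<and> U i < 1" and s: "stick_breaking U sums 1"
    have pos: "0 < stick_breaking U i" for i using stick_breaking_pos U by blast
    have "1 - C * u \<le> iprod (\<lambda>i. \<rho> (u * stick_breaking U i))"
    proof (rule iprod_ge_one_minus[OF \<rho>_range])
      fix n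
      have "(\<Sum>i<n. 1 - \<rho> (u * stick_breaking U i)) \<le> (\<Sum>i<n. C * u * stick_breaking U i)"
        using u pos by (intro sum_mono) (use lip in \<open>simp add: less_imp_le mult.assoc\<close>)
      also have "\<dots> = C * u * (\<Sum>i<n. stick_breaking U i)" by (simp add: sum_distrib_left)
      also have "\<dots> \<le> C * u * 1"
        using s pos u C_nonneg by (intro mult_left_mono sum_le_suminf[THEN order_trans])
          (auto simp: sums_iff less_imp_le)
      finally show "(\<Sum>i<n. 1 - \<rho> (u * stick_breaking U i)) \<le> C * u" by simp
    qed
    then have "ennreal 1 \<le> ennreal (iprod (\<lambda>i. \<rho> (u * stick_breaking U i)) + C * u)"
      by (intro ennreal_leI) simp
    also have "\<dots> = ennreal (iprod (\<lambda>i. \<rho> (u * stick_breaking U i))) + ennreal (C * u)"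
      using iprod_range[of "\<lambda>i. \<rho> (u * stick_breaking U i)", OF \<rho>_range] u C_nonneg by (intro ennreal_plus) auto
    finally show "1 \<le> ennreal (iprod (\<lambda>i. \<rho> (u * stick_breaking U i))) + ennreal (C * u)"
      by simp
  qed
  also have "\<dots> = Psi \<alpha> \<rho> \<theta> u + ennreal (C * u)"
    unfolding Psi_def by (subst nn_integral_add) (auto simp: G.emeasure_space_1)
  finally show ?thesis .
qed

lemma Hn_le:
  assumes \<eta>: "0 < \<eta>" and s: "0 < s"
  shows "Hn \<alpha> \<rho> \<eta> s \<le> ennreal (s powr (- \<eta>))"
proof -
  have g: "0 < Gamma \<eta>" using \<eta> by (rule Gamma_real_pos)
  have "(\<integral>\<^sup>+y\<in>{0<..}. ennreal (y powr (\<eta> - 1) * exp (- s * y)) * Psi \<alpha> \<rho> \<eta> y \<partial>lborel) \<le>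
      (\<integral>\<^sup>+y\<in>{0<..}. ennreal (y powr (\<eta> - 1) * exp (- s * y)) * 1 \<partial>lborel)"
    using Psi_le_1[of \<eta>] \<eta> \<alpha>_pos by (intro nn_integral_mono mult_right_mono mult_left_mono) auto
  also have "\<dots> = ennreal (Gamma \<eta> * s powr (- \<eta>))"
    using nn_integral_Gamma[OF \<eta> s] by simp
  finally have "Hn \<alpha> \<rho> \<eta> s \<le> ennreal (1 / Gamma \<eta>) * ennreal (Gamma \<eta> * s powr (- \<eta>))"
    unfolding Hn_def by (rule mult_left_mono) simp
  then show ?thesis using g by (simp add: ennreal_mult[symmetric])
qed

lemma Hn_ge:
  assumes \<eta>: "0 < \<eta>" and s: "0 < s"
  shows "ennreal (s powr (- \<eta>)) \<le> Hn \<alpha> \<rho> \<eta> s + ennreal (C * \<eta> * s powr (- \<eta> - 1))"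
proof -
  have g: "0 < Gamma \<eta>" "Gamma (\<eta> + 1) = \<eta> * Gamma \<eta>"
    using \<eta> by (auto intro!: Gamma_real_pos simp: Gamma_plus1 nonpos_Ints_def)
  have \<eta>': "- \<alpha> < \<eta>" using \<eta> \<alpha>_pos by simp
  note [measurable] = measurable_Psi[OF \<eta>']
  let ?f = "\<lambda>y. ennreal (y powr (\<eta> - 1) * exp (- s * y))"
  have "ennreal (Gamma \<eta> * s powr (- \<eta>)) = (\<integral>\<^sup>+y\<in>{0<..}. ?f y \<partial>lborel)"
    using nn_integral_Gamma[OF \<eta> s] by simp
  also have "\<dots> \<le> (\<integral>\<^sup>+y. ?f y * Psi \<alpha> \<rho> \<eta> y * indicator {0<..} y + ennreal C * (ennreal (y powr (\<eta> + 1 - 1) * exp (- s * y)) * indicator {0<..} y) \<partial>lborel)"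
  proof (rule nn_integral_mono)
    fix y :: real
    show "?f y * indicator {0<..} y \<le> ?f y * Psi \<alpha> \<rho> \<eta> y * indicator {0<..} y + ennreal C * (ennreal (y powr (\<eta> + 1 - 1) * exp (- s * y)) * indicator {0<..} y)"
    proof (cases "0 < y")
      case True
      have "?f y * 1 \<le> ?f y * (Psi \<alpha> \<rho> \<eta> y + ennreal (C * y))"
        using Psi_ge[OF \<eta>', of y] True by (intro mult_left_mono) auto
      moreover have "?f y * ennreal (C * y) = ennreal C * ennreal (y powr (\<eta> + 1 - 1) * exp (- s * y))"
        using True C_nonneg by (simp add: ennreal_mult[symmetric] powr_diff)
      ultimately show ?thesis using True by (simp add: distrib_left)
    qed simp
  qed
  also have "\<dots> = (\<integral>\<^sup>+y\<in>{0<..}. ?f y * Psi \<alpha> \<rho> \<eta> y \<partial>lborel) + ennreal C * ennreal (Gamma (\<eta> + 1) * s powr (- (\<eta> + 1)))"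
    using nn_integral_Gamma[of "\<eta> + 1" s] \<eta> s by (subst nn_integral_add) (auto simp: nn_integral_cmult)
  finally have "ennreal (1 / Gamma \<eta>) * ennreal (Gamma \<eta> * s powr (- \<eta>)) \<le> ennreal (1 / Gamma \<eta>) *
     ((\<integral>\<^sup>+y\<in>{0<..}. ?f y * Psi \<alpha> \<rho> \<eta> y \<partial>lborel) + ennreal C * ennreal (Gamma (\<eta> + 1) * s powr (- (\<eta> + 1))))"
    by (rule mult_left_mono) simp
  moreover have "ennreal (1 / Gamma \<eta>) * (ennreal C * ennreal (Gamma (\<eta> + 1) * s powr (- (\<eta> + 1)))) = ennreal (C * \<eta> * s powr (- \<eta> - 1))"
  proof -
    have "- (\<eta> + 1) = - \<eta> - 1" by simp
    moreover have "1 / Gamma \<eta> * (C * (\<eta> * Gamma \<eta> * s powr (- \<eta> - 1))) = C * \<eta> * s powr (- \<eta> - 1)"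
      using g(1) by simp
    ultimately show ?thesis
      unfolding g(2) using g(1) \<eta> C_nonneg by (simp only: ennreal_mult[symmetric] mult_nonneg_nonneg less_imp_le powr_ge_zero zero_le_divide_1_iff)
  qed
  moreover have "ennreal (1 / Gamma \<eta>) * ennreal (Gamma \<eta> * s powr (- \<eta>)) = ennreal (s powr (- \<eta>))"
    using g by (simp add: ennreal_mult[symmetric])
  ultimately show ?thesis unfolding Hn_def by (simp add: distrib_left)
qed

lemma levy_int_le:
  assumes s: "0 < s"
  shows "levy_int \<alpha> (\<lambda>x. exp (- s * x) * \<rho> x) \<le> ennreal (Gamma (1 - \<alpha>) / \<alpha> * (s powr \<alpha> + C * \<alpha> * s powr (\<alpha> - 1)))"
proof -
  have "(\<integral>\<^sup>+x\<in>{0<..}. ennreal (x powr (- \<alpha> - 1) * (exp (- s * x) * (1 - \<rho> x))) \<partial>lborel) \<le>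
     (\<integral>\<^sup>+x. ennreal C * (ennreal (x powr (1 - \<alpha> - 1) * exp (- s * x)) * indicator {0<..} x) \<partial>lborel)"
  proof (rule nn_integral_mono)
    fix x :: real
    show "ennreal (x powr (- \<alpha> - 1) * (exp (- s * x) * (1 - \<rho> x))) * indicator {0<..} x \<le>
      ennreal C * (ennreal (x powr (1 - \<alpha> - 1) * exp (- s * x)) * indicator {0<..} x)"
    proof (cases "0 < x")
      case True
      have "x powr (- \<alpha> - 1) * (exp (- s * x) * (1 - \<rho> x)) \<le> x powr (- \<alpha> - 1) * (exp (- s * x) * (C * x))"
        using lip[of x] True by (intro mult_left_mono) auto
      also have "\<dots> = C * (x powr (1 - \<alpha> - 1) * exp (- s * x))"
        using True by (simp add: powr_diff)
      finally show ?thesis using True C_nonneg by (simp add: ennreal_mult[symmetric] ennreal_leI)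
    qed simp
  qed
  also have "\<dots> = ennreal C * ennreal (Gamma (1 - \<alpha>) * s powr (- (1 - \<alpha>)))"
    using nn_integral_Gamma[of "1 - \<alpha>" s] s \<alpha>_less_1 by (subst nn_integral_cmult) auto
  finally have "levy_int \<alpha> (\<lambda>x. exp (- s * x) * \<rho> x) \<le> ennreal (Gamma (1 - \<alpha>) / \<alpha> * s powr \<alpha>) + ennreal C * ennreal (Gamma (1 - \<alpha>) * s powr (- (1 - \<alpha>)))"
    unfolding levy_int_split[OF s] by (rule add_left_mono)
  also have "\<dots> = ennreal (Gamma (1 - \<alpha>) / \<alpha> * s powr \<alpha> + C * (Gamma (1 - \<alpha>) * s powr (- (1 - \<alpha>))))"
    using Gamma_1_\<alpha>_pos \<alpha>_pos C_nonneg by (simp add: ennreal_mult[symmetric])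
  also have "Gamma (1 - \<alpha>) / \<alpha> * s powr \<alpha> + C * (Gamma (1 - \<alpha>) * s powr (- (1 - \<alpha>))) =
     Gamma (1 - \<alpha>) / \<alpha> * (s powr \<alpha> + C * \<alpha> * s powr (\<alpha> - 1))"
    using \<alpha>_pos by (simp add: field_simps)
  finally show ?thesis .
qed

end

sublocale pd_lip \<subseteq> pd_levy
  by unfold_locales (rule le_less_trans[OF levy_int_le], auto)

context pd_lip
begin

lemma Phi_le:
  assumes s: "0 < s"
  shows "Phi \<alpha> \<rho> s \<le> s powr \<alpha> + C * \<alpha> * s powr (\<alpha> - 1)"
proof -
  have "Gamma (1 - \<alpha>) / \<alpha> * Phi \<alpha> \<rho> s \<le> Gamma (1 - \<alpha>) / \<alpha> * (s powr \<alpha> + C * \<alpha> * s powr (\<alpha> - 1))"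
    using levy_int_le[OF s] unfolding levy_int_eq[OF s]
    using Gamma_1_\<alpha>_pos \<alpha>_pos C_nonneg by (subst (asm) ennreal_le_iff) (auto intro!: add_nonneg_nonneg)
  then show ?thesis
    by (rule mult_le_cancel_left_pos[THEN iffD1, rotated]) (use Gamma_1_\<alpha>_pos \<alpha>_pos in auto)
qed

lemma powr_Phi_le:
  assumes \<eta>: "0 < \<eta>" and s: "0 < s"
  shows "Phi \<alpha> \<rho> s powr (- \<eta> / \<alpha>) \<le> s powr (- \<eta>)"
proof -
  have "Phi \<alpha> \<rho> s powr (- \<eta> / \<alpha>) \<le> (s powr \<alpha>) powr (- \<eta> / \<alpha>)"
    using Phi_ge[OF s] \<eta> \<alpha>_pos s by (intro powr_mono2') auto
  then show ?thesis using \<alpha>_pos by (simp add: powr_powr)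
qed

text \<open>With y = C \<alpha> / s one has \<Phi>(s) \<le> s^\<alpha> (1 + y), and (1 +
  y)^(-\<eta>/\<alpha>) \<ge> 1 - \<eta> y / \<alpha> follows from ln (1 + y) \<le> y and 1 + x
  \<le> exp x. The resulting error is the one already obtained in \<open>Hn_ge\<close>.\<close>

lemma powr_Phi_ge:
  assumes \<eta>: "0 < \<eta>" and s: "0 < s"
  shows "s powr (- \<eta>) \<le> Phi \<alpha> \<rho> s powr (- \<eta> / \<alpha>) + C * \<eta> * s powr (- \<eta> - 1)"
proof -
  let ?y = "C * \<alpha> / s"
  have y: "0 \<le> ?y" using C_nonneg \<alpha>_pos s by simp
  have "1 - \<eta> / \<alpha> * ?y \<le> 1 + - (\<eta> / \<alpha> * ln (1 + ?y))"
    using ln_add_one_self_le_self[OF y] \<eta> \<alpha>_pos by (simp add: mult_left_mono del: times_divide_eq_left times_divide_eq_right)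
  also have "\<dots> \<le> exp (- (\<eta> / \<alpha> * ln (1 + ?y)))" by (rule exp_ge_add_one_self)
  also have "\<dots> = (1 + ?y) powr (- \<eta> / \<alpha>)" using y by (simp add: powr_def)
  finally have "s powr (- \<eta>) * (1 - \<eta> / \<alpha> * ?y) \<le> s powr (- \<eta>) * (1 + ?y) powr (- \<eta> / \<alpha>)"
    by (rule mult_left_mono) simp
  also have "s powr (- \<eta>) * (1 + ?y) powr (- \<eta> / \<alpha>) = (s powr \<alpha> * (1 + ?y)) powr (- \<eta> / \<alpha>)"
    using y \<alpha>_pos by (simp add: powr_mult powr_powr)
  also have "s powr \<alpha> * (1 + ?y) = s powr \<alpha> + C * \<alpha> * s powr (\<alpha> - 1)"
    using s by (simp add: powr_diff field_simps)
  also have "(s powr \<alpha> + C * \<alpha> * s powr (\<alpha> - 1)) powr (- \<eta> / \<alpha>) \<le> Phi \<alpha> \<rho> s powr (- \<eta> / \<alpha>)"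
    using Phi_le[OF s] Phi_pos[OF s] \<eta> \<alpha>_pos by (intro powr_mono2') auto
  also have "s powr (- \<eta>) * (1 - \<eta> / \<alpha> * ?y) = s powr (- \<eta>) - C * \<eta> * s powr (- \<eta> - 1)"
    using s \<alpha>_pos by (simp add: powr_diff right_diff_distrib)
  finally show ?thesis by simp
qed

text \<open>For \<open>n = 0\<close> this is the deviation from s^(-\<eta>) granted to either
  solution. The recursion keeps the power of s and shrinks the coefficient.\<close>

definition err :: "nat \<Rightarrow> real \<Rightarrow> real \<Rightarrow> real" where
  "err n \<eta> s = C * \<eta> * shrink \<alpha> n \<eta> * s powr (- \<eta> - 1)"

text \<open>By \<open>Kf_le\<close> the integrand is at most a constant times q^(-\<eta> - 2), whose
  integral over q \<ge> s is s^(-\<eta> - 1)/(\<eta> + 1). Together with the factor \<eta> +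
  \<alpha> from the error at \<eta> + \<alpha> this is the next factor of
  \<open>shrink\<close>.\<close>

lemma err_step:
  assumes \<eta>: "0 < \<eta>" and s: "0 < s"
  shows "(\<integral>\<^sup>+q\<in>{s..}. ennreal (\<eta> * Kf \<alpha> \<rho> q) * ennreal (err n (\<eta> + \<alpha>) q) \<partial>lborel) \<le> ennreal (err (Suc n) \<eta> s)"
proof -
  let ?c = "\<eta> * (C * (\<eta> + \<alpha>) * shrink \<alpha> n (\<eta> + \<alpha>))"
  have sh: "0 \<le> shrink \<alpha> n (\<eta> + \<alpha>)" using \<eta> \<alpha>_pos by (intro shrink_nonneg) auto
  have c: "0 \<le> ?c" using sh \<eta> \<alpha>_pos C_nonneg by simp
  have "(\<integral>\<^sup>+q\<in>{s..}. ennreal (\<eta> * Kf \<alpha> \<rho> q) * ennreal (err n (\<eta> + \<alpha>) q) \<partial>lborel) \<le>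
     (\<integral>\<^sup>+q. ennreal ?c * (ennreal (q powr (- (\<eta> + 1) - 1)) * indicator {s..} q) \<partial>lborel)"
  proof (rule nn_integral_mono)
    fix q :: real
    show "ennreal (\<eta> * Kf \<alpha> \<rho> q) * ennreal (err n (\<eta> + \<alpha>) q) * indicator {s..} q \<le> ennreal ?c * (ennreal (q powr (- (\<eta> + 1) - 1)) * indicator {s..} q)"
    proof (cases "s \<le> q")
      case True
      then have q: "0 < q" using s by simp
      have "\<eta> * Kf \<alpha> \<rho> q * err n (\<eta> + \<alpha>) q = ?c * (Kf \<alpha> \<rho> q * q powr (- (\<eta> + \<alpha>) - 1))"
        by (simp add: err_def)
      also have "\<dots> \<le> ?c * (q powr (\<alpha> - 1) * q powr (- (\<eta> + \<alpha>) - 1))"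
        using Kf_le[OF q] by (intro mult_left_mono[OF _ c] mult_right_mono) auto
      also have "q powr (\<alpha> - 1) * q powr (- (\<eta> + \<alpha>) - 1) = q powr (- (\<eta> + 1) - 1)"
        by (simp add: powr_add[symmetric])
      finally show ?thesis using True c \<eta> Kf_nonneg[of q]
        by (simp add: ennreal_mult'[symmetric] ennreal_leI)
    qed simp
  qed
  also have "\<dots> = ennreal ?c * ennreal (s powr (- (\<eta> + 1)) / (\<eta> + 1))"
    using nn_integral_powr_atLeast[of "\<eta> + 1" s] \<eta> s by (subst nn_integral_cmult) auto
  also have "\<dots> = ennreal (err (Suc n) \<eta> s)"
  proof -
    have "?c * (s powr (- (\<eta> + 1)) / (\<eta> + 1)) = err (Suc n) \<eta> s"
      using \<eta> by (simp add: err_def)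
    moreover have "0 \<le> s powr (- (\<eta> + 1)) / (\<eta> + 1)" using \<eta> by simp
    ultimately show ?thesis using ennreal_mult[OF c] by metis
  qed
  finally show ?thesis .
qed

text \<open>Both functions solve the same linear recursion with a nonnegative kernel, so a bound at
  \<eta> + \<alpha> propagates to \<eta>. The pair of additive inequalities expresses an absolute
  difference between extended nonnegative reals.\<close>

lemma Hn_Phi_bounds:
  assumes "0 < \<eta>" "0 < s"
  shows "Hn \<alpha> \<rho> \<eta> s \<le> ennreal (Phi \<alpha> \<rho> s powr (- \<eta> / \<alpha>)) + ennreal (err n \<eta> s) \<and>
         ennreal (Phi \<alpha> \<rho> s powr (- \<eta> / \<alpha>)) \<le> Hn \<alpha> \<rho> \<eta> s + ennreal (err n \<eta> s)"
  using assms
proof (induction n arbitrary: \<eta> s)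
  case 0
  have e: "err 0 \<eta> s = C * \<eta> * s powr (- \<eta> - 1)" by (simp add: err_def)
  have "ennreal (s powr (- \<eta>)) \<le> ennreal (Phi \<alpha> \<rho> s powr (- \<eta> / \<alpha>)) + ennreal (err 0 \<eta> s)"
    using ennreal_leI[OF powr_Phi_ge[OF 0]] 0 C_nonneg unfolding e by (simp add: ennreal_plus)
  moreover have "ennreal (Phi \<alpha> \<rho> s powr (- \<eta> / \<alpha>)) \<le> ennreal (s powr (- \<eta>))"
    using powr_Phi_le[OF 0] by (rule ennreal_leI)
  ultimately show ?case
    using Hn_le[OF 0] Hn_ge[OF 0] unfolding e by (meson order_trans)
next
  case (Suc n)
  let ?k = "\<lambda>q. ennreal (\<eta> * Kf \<alpha> \<rho> q)" and ?Z = "\<lambda>q. ennreal (Phi \<alpha> \<rho> q powr (- (\<eta> + \<alpha>) / \<alpha>))"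
  let ?H = "Hn \<alpha> \<rho> (\<eta> + \<alpha>)" and ?e = "\<lambda>q. ennreal (err n (\<eta> + \<alpha>) q)"
  have [measurable]: "Phi \<alpha> \<rho> \<in> borel_measurable borel" "?H \<in> borel_measurable borel"
    "err n (\<eta> + \<alpha>) \<in> borel_measurable borel"
    using measurable_Hn[of "\<eta> + \<alpha>"] Suc.prems \<alpha>_pos
    by (auto simp: Phi_def[abs_def] levy_int_def err_def[abs_def])
  have mono: "(\<integral>\<^sup>+q\<in>{s..}. ?k q * A q \<partial>lborel) \<le> (\<integral>\<^sup>+q\<in>{s..}. ?k q * B q \<partial>lborel) + ennreal (err (Suc n) \<eta> s)"
    if [measurable]: "B \<in> borel_measurable borel" and le: "\<And>q. s \<le> q \<Longrightarrow> A q \<le> B q + ?e q" for A B :: "real \<Rightarrow> ennreal"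
  proof -
    have "(\<integral>\<^sup>+q\<in>{s..}. ?k q * A q \<partial>lborel) \<le> (\<integral>\<^sup>+q. ?k q * B q * indicator {s..} q + ?k q * ?e q * indicator {s..} q \<partial>lborel)"
      by (intro nn_integral_mono) (auto simp: indicator_def distrib_left[symmetric] le mult_left_mono)
    also have "\<dots> = (\<integral>\<^sup>+q\<in>{s..}. ?k q * B q \<partial>lborel) + (\<integral>\<^sup>+q\<in>{s..}. ?k q * ?e q \<partial>lborel)"
      by (rule nn_integral_add) measurable
    also have "\<dots> \<le> (\<integral>\<^sup>+q\<in>{s..}. ?k q * B q \<partial>lborel) + ennreal (err (Suc n) \<eta> s)"
      using err_step[OF Suc.prems] by (rule add_left_mono)
    finally show ?thesis .
  qed
  have IH: "?H q \<le> ?Z q + ?e q" "?Z q \<le> ?H q + ?e q" if "s \<le> q" for q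
    using Suc.IH[of "\<eta> + \<alpha>" q] Suc.prems \<alpha>_pos that by auto
  show ?case
    unfolding Hn_rec[OF Suc.prems] powr_Phi_rec[OF Suc.prems]
    by (intro conjI mono IH) measurable
qed

lemma Hn_eq_powr_Phi:
  assumes "0 < \<eta>" "0 < s"
  shows "Hn \<alpha> \<rho> \<eta> s = ennreal (Phi \<alpha> \<rho> s powr (- \<eta> / \<alpha>))"
proof -
  have "(\<lambda>n. shrink \<alpha> n \<eta>) \<longlonglongrightarrow> 0" using assms \<alpha>_pos by (intro shrink_tendsto_0) auto
  then have "(\<lambda>n. err n \<eta> s) \<longlonglongrightarrow> C * \<eta> * 0 * s powr (- \<eta> - 1)"
    unfolding err_def by (intro tendsto_intros)
  then have e: "(\<lambda>n. ennreal (err n \<eta> s)) \<longlonglongrightarrow> 0"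
    using tendsto_ennrealI by fastforce
  have lim: "(\<lambda>n. x + ennreal (err n \<eta> s)) \<longlonglongrightarrow> x" for x
    using tendsto_add[OF tendsto_const e, of x] by simp
  show ?thesis
    by (rule antisym; rule LIMSEQ_le_const[OF lim]) (use Hn_Phi_bounds[OF assms] in auto)
qed

lemma moment_identity_lip:
  assumes \<theta>: "- \<alpha> < \<theta>" and s: "0 < s"
  shows "(\<integral>\<^sup>+u\<in>{0<..}. ennreal (u powr \<theta> * exp (- s * u)) * Psi \<alpha> \<rho> \<theta> u \<partial>lborel) =
    ennreal (Gamma (\<theta> + 1) * Kf \<alpha> \<rho> s * Phi \<alpha> \<rho> s powr (- (\<theta> + \<alpha>) / \<alpha>))"
proof -
  have "0 \<le> Gamma (\<theta> + 1) * Kf \<alpha> \<rho> s"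
    using \<theta> \<alpha>_less_1 Kf_nonneg[of s] Gamma_real_pos[of "\<theta> + 1"] by simp
  then show ?thesis
    unfolding moment_eq_Hn[OF \<theta> s] using Hn_eq_powr_Phi[of "\<theta> + \<alpha>" s] \<theta> s by (simp add: ennreal_mult)
qed

end

section \<open>Removing the Lipschitz condition by approximation\<close>

locale pd_full = pd_levy +
  assumes \<rho>_0: "\<rho> 0 = 1"
begin

text \<open>Raises \<rho> near 0 just enough to satisfy the linear bound with constant
  \<open>n\<close>; \<rho>(0) = 1 ensures convergence at 0 as well. Factors averaged over the marks
  call for this, as they can fail the linear bound when f has infinite mean.\<close>

definition approx :: "nat \<Rightarrow> real \<Rightarrow> real" where
  "approx n x = max (\<rho> x) (1 - real n * \<bar>x\<bar>)"

lemma pd_lip_approx: "pd_lip \<alpha> (approx n) (real n)"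
proof
  show "approx n \<in> borel_measurable borel" unfolding approx_def[abs_def] by measurable
  show "approx n x \<in> {0..1}" for x using \<rho>_range[of x] by (auto simp: approx_def)
  show "1 - approx n x \<le> real n * x" if "0 \<le> x" for x using that by (auto simp: approx_def)
qed simp

lemma approx_range: "approx n x \<in> {0..1}"
  using \<rho>_range[of x] by (auto simp: approx_def)

lemma measurable_approx [measurable]: "approx n \<in> borel_measurable borel"
  unfolding approx_def[abs_def] by measurable

lemma approx_ge: "\<rho> x \<le> approx n x"
  by (simp add: approx_def)

lemma approx_tendsto: "(\<lambda>n. approx n x) \<longlonglongrightarrow> \<rho> x"
proof (cases "x = 0")
  case False
  have "\<forall>\<^sub>F n in sequentially. 1 / \<bar>x\<bar> \<le> real n"
    using eventually_ge_at_top[of "nat \<lceil>1 / \<bar>x\<bar>\<rceil>"] by eventually_elim linarith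
  then have "\<forall>\<^sub>F n in sequentially. approx n x = \<rho> x"
  proof eventually_elim
    case (elim n)
    then have "1 \<le> real n * \<bar>x\<bar>" using False by (simp add: field_simps)
    then show ?case using \<rho>_nonneg[of x] by (simp add: approx_def)
  qed
  then show ?thesis by (rule tendsto_eventually)
qed (simp add: approx_def \<rho>_0)

lemma Psi_approx_tendsto:
  assumes \<theta>: "- \<alpha> < \<theta>"
  shows "(\<lambda>n. Psi \<alpha> (approx n) \<theta> u) \<longlonglongrightarrow> Psi \<alpha> \<rho> \<theta> u"
proof -
  interpret G: prob_space "gem \<alpha> \<theta>" using \<theta> by (rule prob_space_gem)
  show ?thesis
    unfolding Psi_def
  proof (rule nn_integral_dominated_convergence[where w = "\<lambda>_. 1"])
    show "AE U in gem \<alpha> \<theta>. ennreal (iprod (\<lambda>i. approx n (u * stick_breaking U i))) \<le> 1" for n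
      using iprod_range[of "\<lambda>i. approx n (u * stick_breaking _ i)", OF approx_range] by auto
    show "AE U in gem \<alpha> \<theta>. (\<lambda>n. ennreal (iprod (\<lambda>i. approx n (u * stick_breaking U i)))) \<longlonglongrightarrow> ennreal (iprod (\<lambda>i. \<rho> (u * stick_breaking U i)))"
      by (intro AE_I2 tendsto_ennrealI iprod_decseq_limit approx_range \<rho>_range approx_ge approx_tendsto)
  qed (auto simp: G.emeasure_space_1)
qed

lemma Kf_approx_tendsto:
  assumes s: "0 < s"
  shows "(\<lambda>n. Kf \<alpha> (approx n) s) \<longlonglongrightarrow> Kf \<alpha> \<rho> s"
proof -
  have "(\<lambda>n. kern \<alpha> (approx n) s) \<longlonglongrightarrow> kern \<alpha> \<rho> s"
    unfolding kern_def
  proof (rule nn_integral_dominated_convergence[where w = "\<lambda>x. ennreal (x powr (- \<alpha>) * exp (- s * x)) * indicator {0<..} x"])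
    show "(\<integral>\<^sup>+x. ennreal (x powr (- \<alpha>) * exp (- s * x)) * indicator {0<..} x \<partial>lborel) < \<infinity>"
      using nn_integral_Gamma[of "1 - \<alpha>" s] s \<alpha>_less_1 by simp
    show "AE x in lborel. (\<lambda>n. ennreal (x powr - \<alpha> * exp (- s * x) * approx n x) * indicator {0<..} x)
        \<longlonglongrightarrow> ennreal (x powr - \<alpha> * exp (- s * x) * \<rho> x) * indicator {0<..} x"
      by (auto simp: indicator_def intro!: tendsto_intros approx_tendsto)
    show "AE x in lborel. ennreal (x powr - \<alpha> * exp (- s * x) * approx n x) * indicator {0<..} x
         \<le> ennreal (x powr (- \<alpha>) * exp (- s * x)) * indicator {0<..} x" for n
      using approx_range[of n] by (intro AE_I2 mult_right_mono ennreal_leI mult_left_le) auto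
  qed measurable
  then have "(\<lambda>n. enn2real (kern \<alpha> (approx n) s)) \<longlonglongrightarrow> Gamma (1 - \<alpha>) * Kf \<alpha> \<rho> s"
    unfolding kern_eq[OF s] by (rule tendsto_enn2real) (use Gamma_1_\<alpha>_pos Kf_nonneg in auto)
  then have "(\<lambda>n. Kf \<alpha> (approx n) s) \<longlonglongrightarrow> Gamma (1 - \<alpha>) * Kf \<alpha> \<rho> s / Gamma (1 - \<alpha>)"
    unfolding Kf_def[of _ "approx _"] using Gamma_1_\<alpha>_pos by (intro tendsto_divide tendsto_const) auto
  then show ?thesis using Gamma_1_\<alpha>_pos by simp
qed

text \<open>The approximations lie above \<rho>, so the integrand belonging to \<rho> dominates all
  the others, and its integral is finite.\<close>

lemma Phi_approx_tendsto:
  assumes s: "0 < s"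
  shows "(\<lambda>n. Phi \<alpha> (approx n) s) \<longlonglongrightarrow> Phi \<alpha> \<rho> s"
proof -
  have "(\<lambda>n. levy_int \<alpha> (\<lambda>x. exp (- s * x) * approx n x)) \<longlonglongrightarrow> levy_int \<alpha> (\<lambda>x. exp (- s * x) * \<rho> x)"
    unfolding levy_int_def
  proof (rule nn_integral_dominated_convergence[where w = "\<lambda>x. ennreal (x powr (- \<alpha> - 1) * (1 - exp (- s * x) * \<rho> x)) * indicator {0<..} x"])
    show "(\<integral>\<^sup>+x. ennreal (x powr (- \<alpha> - 1) * (1 - exp (- s * x) * \<rho> x)) * indicator {0<..} x \<partial>lborel) < \<infinity>"
      using levy_finite[OF s] by (simp add: levy_int_def)
    show "AE x in lborel. (\<lambda>n. ennreal (x powr (- \<alpha> - 1) * (1 - exp (- s * x) * approx n x)) * indicator {0<..} x)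
        \<longlonglongrightarrow> ennreal (x powr (- \<alpha> - 1) * (1 - exp (- s * x) * \<rho> x)) * indicator {0<..} x"
      by (auto simp: indicator_def intro!: tendsto_intros approx_tendsto)
    show "AE x in lborel. ennreal (x powr (- \<alpha> - 1) * (1 - exp (- s * x) * approx n x)) * indicator {0<..} x
         \<le> ennreal (x powr (- \<alpha> - 1) * (1 - exp (- s * x) * \<rho> x)) * indicator {0<..} x" for n
      using approx_ge by (intro AE_I2 mult_right_mono ennreal_leI mult_left_mono diff_left_mono) auto
  qed measurable
  then have "(\<lambda>n. enn2real (levy_int \<alpha> (\<lambda>x. exp (- s * x) * approx n x))) \<longlonglongrightarrow> Gamma (1 - \<alpha>) / \<alpha> * Phi \<alpha> \<rho> s"
    unfolding levy_int_eq[OF s] by (rule tendsto_enn2real) (use Gamma_1_\<alpha>_pos Phi_nonneg \<alpha>_pos in auto)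
  then have "(\<lambda>n. Phi \<alpha> (approx n) s) \<longlonglongrightarrow> \<alpha> / Gamma (1 - \<alpha>) * (Gamma (1 - \<alpha>) / \<alpha> * Phi \<alpha> \<rho> s)"
    unfolding Phi_def[of _ "approx _"] by (intro tendsto_mult tendsto_const)
  then show ?thesis using Gamma_1_\<alpha>_pos \<alpha>_pos by simp
qed

theorem moment_identity:
  assumes \<theta>: "- \<alpha> < \<theta>" and s: "0 < s"
  shows "(\<integral>\<^sup>+u\<in>{0<..}. ennreal (u powr \<theta> * exp (- s * u)) * Psi \<alpha> \<rho> \<theta> u \<partial>lborel) =
    ennreal (Gamma (\<theta> + 1) * Kf \<alpha> \<rho> s * Phi \<alpha> \<rho> s powr (- (\<theta> + \<alpha>) / \<alpha>))"
proof (rule LIMSEQ_unique)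
  let ?G = "\<lambda>\<psi>. (\<integral>\<^sup>+u\<in>{0<..}. ennreal (u powr \<theta> * exp (- s * u)) * Psi \<alpha> \<psi> \<theta> u \<partial>lborel)"
  interpret A: pd_lip \<alpha> "approx n" "real n" for n by (rule pd_lip_approx)
  note [measurable] = measurable_Psi[OF \<theta>] A.measurable_Psi[OF \<theta>]
  show "(\<lambda>n. ?G (approx n)) \<longlonglongrightarrow> ?G \<rho>"
  proof (rule nn_integral_dominated_convergence[where w = "\<lambda>u. ennreal (u powr (\<theta> + 1 - 1) * exp (- s * u)) * indicator {0<..} u"])
    show "(\<integral>\<^sup>+u. ennreal (u powr (\<theta> + 1 - 1) * exp (- s * u)) * indicator {0<..} u \<partial>lborel) < \<infinity>"
      using nn_integral_Gamma[of "\<theta> + 1" s] s \<theta> \<alpha>_less_1 by simp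
    show "AE u in lborel. (\<lambda>n. ennreal (u powr \<theta> * exp (- s * u)) * Psi \<alpha> (approx n) \<theta> u * indicator {0<..} u)
        \<longlonglongrightarrow> ennreal (u powr \<theta> * exp (- s * u)) * Psi \<alpha> \<rho> \<theta> u * indicator {0<..} u"
      using Psi_approx_tendsto[OF \<theta>] by (auto simp: indicator_def intro!: ennreal_tendsto_cmult)
    show "AE u in lborel. ennreal (u powr \<theta> * exp (- s * u)) * Psi \<alpha> (approx n) \<theta> u * indicator {0<..} u
         \<le> ennreal (u powr (\<theta> + 1 - 1) * exp (- s * u)) * indicator {0<..} u" for n
      using mult_left_mono[OF A.Psi_le_1[OF \<theta>, of n], of "ennreal (_ powr \<theta> * exp (- s * _))"]
      by (intro AE_I2 mult_right_mono) (simp_all add: mult.commute)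
  qed measurable
  show "(\<lambda>n. ?G (approx n)) \<longlonglongrightarrow> ennreal (Gamma (\<theta> + 1) * Kf \<alpha> \<rho> s * Phi \<alpha> \<rho> s powr (- (\<theta> + \<alpha>) / \<alpha>))"
    unfolding A.moment_identity_lip[OF \<theta> s]
    using Phi_pos[OF s] by (intro tendsto_ennrealI tendsto_intros Kf_approx_tendsto[OF s] Phi_approx_tendsto[OF s]) auto
qed

lemma Dfun_DERIV:
  assumes \<theta>: "- \<alpha> < \<theta>" and q: "0 < q"
  shows "((\<lambda>q. - Dfun \<alpha> \<theta> (Phi \<alpha> \<rho> q)) has_real_derivative
     Gamma (\<theta> + 1) * Kf \<alpha> \<rho> q * Phi \<alpha> \<rho> q powr (- (\<theta> + \<alpha>) / \<alpha>)) (at q)"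
proof (cases "\<theta> = 0")
  case True
  have "- (\<theta> + \<alpha>) / \<alpha> = - 1" using True \<alpha>_pos by simp
  then show ?thesis
    unfolding Dfun_def using True \<alpha>_pos Phi_pos[OF q]
    by (auto intro!: derivative_eq_intros Phi_DERIV[OF q] simp: powr_minus field_simps)
next
  case False
  have eq: "- (\<theta> + \<alpha>) / \<alpha> = - \<theta> / \<alpha> - 1" using \<alpha>_pos by (simp add: field_simps)
  have "\<theta> \<notin> \<int>\<^sub>\<le>\<^sub>0"
    using \<theta> \<alpha>_less_1 False by (auto elim!: nonpos_Ints_cases)
  then have g: "Gamma (\<theta> + 1) = \<theta> * Gamma \<theta>" by (rule Gamma_plus1)
  show ?thesis
    unfolding Dfun_def eq g using False \<alpha>_pos Phi_pos[OF q]
    by (auto intro!: derivative_eq_intros Phi_DERIV[OF q])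
qed

lemma Dfun_antimono:
  assumes \<theta>: "- \<alpha> < \<theta>"
  shows "0 \<le> Dfun \<alpha> \<theta> (Phi \<alpha> \<rho> 1) - Dfun \<alpha> \<theta> (Phi \<alpha> \<rho> 2)"
proof -
  have "0 < Gamma (\<theta> + 1)" using \<theta> \<alpha>_less_1 by (intro Gamma_real_pos) auto
  then have "0 \<le> Gamma (\<theta> + 1) * Kf \<alpha> \<rho> q * Phi \<alpha> \<rho> q powr (- (\<theta> + \<alpha>) / \<alpha>)" for q
    using Kf_nonneg by simp
  moreover have "((\<lambda>q. - Dfun \<alpha> \<theta> (Phi \<alpha> \<rho> q)) has_real_derivative
     Gamma (\<theta> + 1) * Kf \<alpha> \<rho> q * Phi \<alpha> \<rho> q powr (- (\<theta> + \<alpha>) / \<alpha>)) (at q)" if "1 \<le> q" for q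
    by (rule Dfun_DERIV[OF \<theta>]) (use that in simp)
  ultimately have "\<exists>y. ((\<lambda>q. - Dfun \<alpha> \<theta> (Phi \<alpha> \<rho> q)) has_real_derivative y) (at q) \<and> 0 \<le> y" if "1 \<le> q" for q
    using that by blast
  then have "- Dfun \<alpha> \<theta> (Phi \<alpha> \<rho> 1) \<le> - Dfun \<alpha> \<theta> (Phi \<alpha> \<rho> 2)"
    by (intro DERIV_nonneg_imp_nondecreasing[of 1 2 "\<lambda>q. - Dfun \<alpha> \<theta> (Phi \<alpha> \<rho> q)"]) simp_all
  then show ?thesis by simp
qed

text \<open>The moment identity integrated over its parameter in [1, 2], where the integral of u
  exp(-q u) is exp(-u) - exp(-2 u); the right side is the increment of an antiderivative. Unlike
  u^(\<theta> - 1) exp(-u), this weight is integrable at 0 for every \<theta> > -1.\<close>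

theorem mellin_identity:
  assumes \<theta>: "- \<alpha> < \<theta>"
  shows "(\<integral>\<^sup>+u\<in>{0<..}. ennreal (u powr (\<theta> - 1) * (exp (- u) - exp (- 2 * u))) * Psi \<alpha> \<rho> \<theta> u \<partial>lborel) =
    ennreal (Dfun \<alpha> \<theta> (Phi \<alpha> \<rho> 1) - Dfun \<alpha> \<theta> (Phi \<alpha> \<rho> 2))"
proof -
  note [measurable] = measurable_Psi[OF \<theta>]
  have [measurable]: "Phi \<alpha> \<rho> \<in> borel_measurable borel"
    unfolding Phi_def[abs_def] levy_int_def by measurable
  have "(\<integral>\<^sup>+u\<in>{0<..}. ennreal (u powr (\<theta> - 1) * (exp (- u) - exp (- 2 * u))) * Psi \<alpha> \<rho> \<theta> u \<partial>lborel) =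
    (\<integral>\<^sup>+u. (\<integral>\<^sup>+q. ennreal (u powr \<theta> * exp (- q * u)) * Psi \<alpha> \<rho> \<theta> u * indicator {0<..} u * indicator {1..2} q \<partial>lborel) \<partial>lborel)"
  proof (rule nn_integral_cong)
    fix u :: real
    show "ennreal (u powr (\<theta> - 1) * (exp (- u) - exp (- 2 * u))) * Psi \<alpha> \<rho> \<theta> u * indicator {0<..} u =
      (\<integral>\<^sup>+q. ennreal (u powr \<theta> * exp (- q * u)) * Psi \<alpha> \<rho> \<theta> u * indicator {0<..} u * indicator {1..2} q \<partial>lborel)"
    proof (cases "0 < u")
      case True
      have "(\<integral>\<^sup>+q. ennreal (u powr \<theta> * exp (- q * u)) * Psi \<alpha> \<rho> \<theta> u * indicator {0<..} u * indicator {1..2} q \<partial>lborel) =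
         (\<integral>\<^sup>+q. (ennreal (u powr (\<theta> - 1)) * Psi \<alpha> \<rho> \<theta> u) * (ennreal (u * exp (- q * u)) * indicator {1..2} q) \<partial>lborel)"
      proof (rule nn_integral_cong)
        fix q
        have "ennreal (u powr \<theta> * exp (- q * u)) = ennreal (u powr (\<theta> - 1)) * ennreal (u * exp (- q * u))"
          using True by (simp add: ennreal_mult[symmetric] powr_diff)
        then show "ennreal (u powr \<theta> * exp (- q * u)) * Psi \<alpha> \<rho> \<theta> u * indicator {0<..} u * indicator {1..2} q =
           (ennreal (u powr (\<theta> - 1)) * Psi \<alpha> \<rho> \<theta> u) * (ennreal (u * exp (- q * u)) * indicator {1..2} q)"
          using True by (simp add: mult.assoc mult.left_commute)
      qed
      also have "\<dots> = (ennreal (u powr (\<theta> - 1)) * Psi \<alpha> \<rho> \<theta> u) * ennreal (exp (- 1 * u) - exp (- 2 * u))"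
        using nn_integral_exp_Icc[of u 1 2] True by (subst nn_integral_cmult) auto
      finally show ?thesis using True by (simp add: ennreal_mult ac_simps)
    qed simp
  qed
  also have "\<dots> = (\<integral>\<^sup>+q. (\<integral>\<^sup>+u. ennreal (u powr \<theta> * exp (- q * u)) * Psi \<alpha> \<rho> \<theta> u * indicator {0<..} u * indicator {1..2} q \<partial>lborel) \<partial>lborel)"
    by (rule lborel_pair.Fubini') simp
  also have "\<dots> = (\<integral>\<^sup>+q\<in>{1..2}. ennreal (Gamma (\<theta> + 1) * Kf \<alpha> \<rho> q * Phi \<alpha> \<rho> q powr (- (\<theta> + \<alpha>) / \<alpha>)) \<partial>lborel)"
  proof (rule nn_integral_cong)
    fix q :: real
    show "(\<integral>\<^sup>+u. ennreal (u powr \<theta> * exp (- q * u)) * Psi \<alpha> \<rho> \<theta> u * indicator {0<..} u * indicator {1..2} q \<partial>lborel) =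
      ennreal (Gamma (\<theta> + 1) * Kf \<alpha> \<rho> q * Phi \<alpha> \<rho> q powr (- (\<theta> + \<alpha>) / \<alpha>)) * indicator {1..2} q"
      using moment_identity[OF \<theta>, of q] by (cases "q \<in> {1..2}") auto
  qed
  also have "\<dots> = ennreal (- Dfun \<alpha> \<theta> (Phi \<alpha> \<rho> 2) - - Dfun \<alpha> \<theta> (Phi \<alpha> \<rho> 1))"
  proof (rule nn_integral_FTC_Icc)
    have "0 < Gamma (\<theta> + 1)" using \<theta> \<alpha>_less_1 by (intro Gamma_real_pos) auto
    then show "0 \<le> Gamma (\<theta> + 1) * Kf \<alpha> \<rho> q * Phi \<alpha> \<rho> q powr (- (\<theta> + \<alpha>) / \<alpha>)" for q
      using Kf_nonneg by simp
    show "((\<lambda>q. - Dfun \<alpha> \<theta> (Phi \<alpha> \<rho> q)) has_real_derivative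
       Gamma (\<theta> + 1) * Kf \<alpha> \<rho> q * Phi \<alpha> \<rho> q powr (- (\<theta> + \<alpha>) / \<alpha>)) (at q)" if "q \<in> {1..2}" for q
      by (rule Dfun_DERIV[OF \<theta>]) (use that in auto)
  qed auto
  finally show ?thesis by simp
qed

end

section \<open>Measures on the ordered simplex\<close>

text \<open>Once the lower coefficients vanish, dividing by r^k and letting r tend to 0 isolates
  \<open>d k\<close>. Only positive r are available, hence the limit from the right.\<close>

lemma power_series_eq_0:
  fixes d :: "nat \<Rightarrow> real"
  assumes bd: "\<And>k. \<bar>d k\<bar> \<le> B" and 0: "\<And>r. 0 < r \<Longrightarrow> r < 1 \<Longrightarrow> (\<lambda>k. d k * r ^ k) sums 0"
  shows "d k = 0"
proof (induction k rule: less_induct)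
  case (less k)
  let ?f = "\<lambda>r. \<Sum>i. d (i + k) * r ^ i"
  have sum: "summable (\<lambda>i. d (i + k) * r ^ i)" if "norm r < 1" for r :: real
  proof (rule summable_comparison_test)
    show "\<exists>N. \<forall>n\<ge>N. norm (d (n + k) * r ^ n) \<le> B * norm r ^ n"
      using bd by (auto simp: abs_mult power_abs intro!: mult_right_mono)
    show "summable (\<lambda>n. B * norm r ^ n)" using that by (intro summable_mult summable_geometric) auto
  qed
  have z: "?f r = 0" if r: "0 < r" "r < 1" for r
  proof -
    have "(\<lambda>i. d (i + k) * r ^ (i + k)) sums (0 - (\<Sum>i<k. d i * r ^ i))"
      using sums_split_initial_segment[OF 0[OF r]] by simp
    then have "(\<lambda>i. d (i + k) * r ^ (i + k)) sums 0"
      using less.IH by simp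
    then have "(\<lambda>i. inverse (r ^ k) * (d (i + k) * r ^ (i + k))) sums (inverse (r ^ k) * 0)"
      by (rule sums_mult)
    moreover have "inverse (r ^ k) * (d (i + k) * r ^ (i + k)) = d (i + k) * r ^ i" for i
      using r by (simp add: power_add field_simps)
    ultimately show ?thesis by (simp add: sums_iff)
  qed
  have "\<forall>\<^sub>F r in at_right 0. ?f r = 0"
    using eventually_at_right_less[of "0::real"] order_tendstoD(2)[OF tendsto_ident_at zero_less_one]
    by eventually_elim (rule z)
  moreover have "(?f \<longlongrightarrow> d (0 + k)) (at 0)"
    by (rule powser_limit_0[where s = 1]) (use sum in \<open>auto intro: summable_sums\<close>)
  then have "(?f \<longlongrightarrow> d k) (at_right 0)"
    by (auto intro: filterlim_mono at_le)
  ultimately have "((\<lambda>_. 0) \<longlongrightarrow> d k) (at_right (0::real))"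
    by (rule Lim_transform_eventually[rotated])
  then show "d k = 0" by (simp add: tendsto_const_iff)
qed

lemma nn_integral_generating_function:
  fixes Y :: "'a \<Rightarrow> ennreal" and N :: "'a \<Rightarrow> nat"
  assumes [measurable]: "Y \<in> borel_measurable M" and N: "N \<in> measurable M (count_space UNIV)"
  shows "(\<integral>\<^sup>+x. Y x * g (N x) \<partial>M) = (\<Sum>k. g k * (\<integral>\<^sup>+x. Y x * indicator {k} (N x) \<partial>M))"
proof -
  have [measurable]: "(\<lambda>x. indicator {k} (N x) :: ennreal) \<in> borel_measurable M" for k
    by (rule measurable_compose[OF N]) simp
  have "(\<integral>\<^sup>+x. Y x * g (N x) \<partial>M) = (\<integral>\<^sup>+x. (\<Sum>k. g k * (Y x * indicator {k} (N x))) \<partial>M)"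
  proof (rule nn_integral_cong)
    fix x
    have "(\<Sum>k. g k * (Y x * indicator {k} (N x))) = (\<Sum>k\<in>{N x}. g k * (Y x * indicator {k} (N x)))"
      by (rule suminf_finite) (auto simp: indicator_def)
    then show "Y x * g (N x) = (\<Sum>k. g k * (Y x * indicator {k} (N x)))" by (simp add: mult.commute)
  qed
  also have "\<dots> = (\<Sum>k. \<integral>\<^sup>+x. g k * (Y x * indicator {k} (N x)) \<partial>M)"
    by (rule nn_integral_suminf) measurable
  also have "\<dots> = (\<Sum>k. g k * (\<integral>\<^sup>+x. Y x * indicator {k} (N x) \<partial>M))"
    by (intro suminf_cong nn_integral_cmult) measurable
  finally show ?thesis .
qed

text \<open>Both sides are power series in r with bounded coefficients, so equality on (0, 1) forces
  equal coefficients. The weight \<open>Y\<close> allows the argument to be applied to one count at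
  a time while it carries the others.\<close>

lemma generating_function_unique:
  fixes Y :: "'a \<Rightarrow> ennreal" and N :: "'a \<Rightarrow> nat"
  assumes sets: "sets M1 = sets M2" and fin: "finite_measure M1" "finite_measure M2"
    and Y[measurable]: "Y \<in> borel_measurable M1" and Y1: "\<And>x. Y x \<le> 1"
    and N[measurable]: "N \<in> measurable M1 (count_space UNIV)"
    and eq: "\<And>r. 0 < r \<Longrightarrow> r < 1 \<Longrightarrow> (\<integral>\<^sup>+x. Y x * ennreal (r ^ N x) \<partial>M1) = (\<integral>\<^sup>+x. Y x * ennreal (r ^ N x) \<partial>M2)"
  shows "(\<integral>\<^sup>+x. Y x * indicator A (N x) \<partial>M1) = (\<integral>\<^sup>+x. Y x * indicator A (N x) \<partial>M2)"
proof -
  have [measurable]: "Y \<in> borel_measurable M2" "N \<in> measurable M2 (count_space UNIV)"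
    using Y N sets measurable_cong_sets by blast+
  define c where "c M k = (\<integral>\<^sup>+x. Y x * indicator {k} (N x) \<partial>M)" for M k
  have cfin: "c M k \<le> emeasure M (space M)" for M k
  proof -
    have "Y x * indicator {k} (N x) \<le> 1" for x using Y1 by (auto simp: indicator_def)
    then have "c M k \<le> (\<integral>\<^sup>+x. 1 \<partial>M)" unfolding c_def by (intro nn_integral_mono) auto
    then show ?thesis by simp
  qed
  define r1 where "r1 M k = enn2real (c M k)" for M k
  have cr: "c M k = ennreal (r1 M k)" "0 \<le> r1 M k" "r1 M k \<le> measure M (space M)" if "finite_measure M" for M k
  proof -
    interpret finite_measure M by fact
    have lt: "c M k < \<infinity>" using cfin[of M k] emeasure_finite by (metis infinity_ennreal_def order_le_less_trans top.not_eq_extremum)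
    then show "c M k = ennreal (r1 M k)" by (simp add: r1_def)
    show "0 \<le> r1 M k" by (simp add: r1_def)
    show "r1 M k \<le> measure M (space M)"
      using cfin[of M k] by (auto simp: r1_def measure_def intro!: enn2real_mono emeasure_finite less_top[THEN iffD1])
  qed
  have sums: "(\<lambda>k. r1 M k * r ^ k) sums enn2real (\<integral>\<^sup>+x. Y x * ennreal (r ^ N x) \<partial>M)"
    if M: "finite_measure M" "Y \<in> borel_measurable M" "N \<in> measurable M (count_space UNIV)" and r: "0 < r" "r < 1" for M r
  proof -
    interpret finite_measure M by fact
    have summ: "summable (\<lambda>k. r1 M k * r ^ k)"
    proof (rule summable_comparison_test)
      show "\<exists>N. \<forall>n\<ge>N. norm (r1 M n * r ^ n) \<le> measure M (space M) * r ^ n"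
        using cr[OF M(1)] r by (auto simp: abs_mult intro!: mult_right_mono)
      show "summable (\<lambda>n. measure M (space M) * r ^ n)" using r by (intro summable_mult summable_geometric) auto
    qed
    have "(\<integral>\<^sup>+x. Y x * ennreal (r ^ N x) \<partial>M) = (\<Sum>k. ennreal (r ^ k) * c M k)"
      unfolding c_def by (rule nn_integral_generating_function[OF M(2,3)])
    also have "\<dots> = (\<Sum>k. ennreal (r1 M k * r ^ k))"
      using cr[OF M(1)] r by (simp add: ennreal_mult[symmetric] mult.commute)
    also have "\<dots> = ennreal (\<Sum>k. r1 M k * r ^ k)"
      using cr[OF M(1)] r summ by (intro suminf_ennreal2) auto
    finally show ?thesis using summ cr[OF M(1)] r by (simp add: summable_sums suminf_nonneg)
  qed
  have "r1 M1 k - r1 M2 k = 0" for k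
  proof (rule power_series_eq_0)
    show "\<bar>r1 M1 k - r1 M2 k\<bar> \<le> measure M1 (space M1) + measure M2 (space M2)" for k
      using cr(2,3)[OF fin(1), of k] cr(2,3)[OF fin(2), of k] by linarith
    show "(\<lambda>k. (r1 M1 k - r1 M2 k) * r ^ k) sums 0" if r: "0 < r" "r < 1" for r
      using sums_diff[OF sums[OF fin(1) _ _ r] sums[OF fin(2) _ _ r]] eq[OF r] by (simp add: left_diff_distrib)
  qed
  then have "c M1 k = c M2 k" for k using cr(1)[OF fin(1)] cr(1)[OF fin(2)] by simp
  then show ?thesis
    by (subst (1 2) nn_integral_generating_function) (auto simp: c_def[symmetric])
qed

section \<open>Encoding a decreasing sequence by its level counts\<close>

definition pos_rat :: "nat \<Rightarrow> real" where
  "pos_rat n = (if 0 < (from_nat n :: rat) then of_rat (from_nat n) else 1)"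

lemma pos_rat_pos: "0 < pos_rat n"
  by (simp add: pos_rat_def)

lemma pos_rat_dense:
  assumes "0 \<le> x" "x < y"
  obtains n where "x < pos_rat n" "pos_rat n < y"
proof -
  obtain q :: rat where q: "x < of_rat q" "of_rat q < y" using of_rat_dense[OF assms(2)] by blast
  then have "0 < (of_rat q :: real)" using assms(1) by linarith
  then have "pos_rat (to_nat q) = of_rat q" by (simp add: pos_rat_def)
  then show ?thesis using that q by metis
qed

text \<open>For a decreasing null sequence the first index at or below a level counts the entries
  strictly above it; positive levels make this finite.\<close>

definition count_above :: "(nat \<Rightarrow> real) \<Rightarrow> nat \<Rightarrow> nat" where
  "count_above x n = (LEAST k. x k \<le> pos_rat n)"

text \<open>Left inverse of \<open>count_above\<close> on positive multiples of elements of
  \<open>nabla\<close>: an entry is the supremum of the positive rationals below it, or 0.\<close>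

definition uncount :: "(nat \<Rightarrow> nat) \<Rightarrow> nat \<Rightarrow> real" where
  "uncount \<omega> i = enn2real (SUP n. if i < \<omega> n then ennreal (pos_rat n) else 0)"

lemma count_above_iff:
  assumes p: "p \<in> nabla"
  shows "i < count_above (\<lambda>i. t * p i) n \<longleftrightarrow> pos_rat n < t * p i"
proof -
  let ?x = "\<lambda>i. t * p i"
  have dec: "decseq p" and nn: "\<And>i. 0 \<le> p i" and lim: "p \<longlonglongrightarrow> 0"
    using p summable_LIMSEQ_zero[of p] by (auto simp: nabla_def sums_iff)
  have "?x \<longlonglongrightarrow> t * 0" by (intro tendsto_mult_left lim)
  then have "\<forall>\<^sub>F k in sequentially. ?x k < pos_rat n"
    using order_tendstoD(2) pos_rat_pos by fastforce
  then obtain k where "?x k \<le> pos_rat n" by (auto simp: eventually_sequentially intro: less_imp_le)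
  then have L: "?x (count_above ?x n) \<le> pos_rat n" unfolding count_above_def by (rule LeastI)
  show ?thesis
  proof
    assume "i < count_above ?x n"
    then show "pos_rat n < ?x i" unfolding count_above_def using not_less_Least by (metis not_less)
  next
    assume gt: "pos_rat n < ?x i"
    show "i < count_above ?x n"
    proof (rule ccontr)
      assume "\<not> i < count_above ?x n"
      then have le: "p i \<le> p (count_above ?x n)" using decseqD[OF dec] by simp
      have "0 < t * p i" using gt pos_rat_pos[of n] by linarith
      then have "0 < t" using nn[of i] by (metis mult_nonpos_nonneg not_less)
      then have "?x i \<le> ?x (count_above ?x n)" using le by simp
      then show False using L gt by linarith
    qed
  qed
qed

lemma uncount_count_above:
  assumes p: "p \<in> nabla" and t: "0 < t"
  shows "uncount (count_above (\<lambda>i. t * p i)) i = t * p i"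
proof -
  have nn: "0 \<le> t * p i" using p t by (auto simp: nabla_def)
  have "(SUP n. if i < count_above (\<lambda>i. t * p i) n then ennreal (pos_rat n) else 0) = ennreal (t * p i)"
  proof (rule antisym)
    show "(SUP n. if i < count_above (\<lambda>i. t * p i) n then ennreal (pos_rat n) else 0) \<le> ennreal (t * p i)"
      by (rule SUP_least) (auto simp: count_above_iff[OF p] intro: ennreal_leI)
    show "ennreal (t * p i) \<le> (SUP n. if i < count_above (\<lambda>i. t * p i) n then ennreal (pos_rat n) else 0)"
    proof (rule dense_le)
      fix y assume y: "y < ennreal (t * p i)"
      then obtain z where z: "y = ennreal z" "0 \<le> z" by (cases y) auto
      then have "z < t * p i" using y nn by (simp add: ennreal_less_iff)
      then obtain n where n: "z < pos_rat n" "pos_rat n < t * p i" using pos_rat_dense[OF z(2)] by blast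
      have "y \<le> (if i < count_above (\<lambda>i. t * p i) n then ennreal (pos_rat n) else 0)"
        using n z by (simp add: count_above_iff[OF p] ennreal_leI)
      also have "\<dots> \<le> (SUP n. if i < count_above (\<lambda>i. t * p i) n then ennreal (pos_rat n) else 0)"
        by (rule SUP_upper) simp
      finally show "y \<le> (SUP n. if i < count_above (\<lambda>i. t * p i) n then ennreal (pos_rat n) else 0)" .
    qed
  qed
  then show ?thesis using nn by (simp add: uncount_def)
qed

lemma measurable_uncount [measurable]:
  "(\<lambda>\<omega>. uncount \<omega> i) \<in> borel_measurable (\<Pi>\<^sub>M n\<in>UNIV. count_space UNIV)"
proof -
  have [measurable]: "Measurable.pred (\<Pi>\<^sub>M n\<in>UNIV. count_space UNIV) (\<lambda>\<omega>::nat \<Rightarrow> nat. i < \<omega> n)" for n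
    by measurable
  show ?thesis unfolding uncount_def by measurable
qed

text \<open>The law of the random scale, up to its total mass ln 2. Its form anticipates the change
  of variables: dt/t is scale invariant, and the difference of exponentials comes from the
  parameters k = 1 and k = 2 of the marked factors.\<close>

definition kap :: "real measure" where
  "kap = density lborel (\<lambda>t. ennreal (indicator {0<..} t * ((exp (- t) - exp (- 2 * t)) / t)))"

lemma sets_kap [simp, measurable_cong]: "sets kap = sets borel"
  by (simp add: kap_def)

lemma space_kap [simp]: "space kap = UNIV"
  by (simp add: kap_def)

lemma AE_kap_pos: "AE t in kap. 0 < t"
  unfolding kap_def by (subst AE_density) (auto simp: indicator_def)

lemma nn_integral_kap:
  assumes [measurable]: "g \<in> borel_measurable borel"
  shows "(\<integral>\<^sup>+t. g t \<partial>kap) = (\<integral>\<^sup>+t\<in>{0<..}. ennreal ((exp (- t) - exp (- 2 * t)) / t) * g t \<partial>lborel)"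
  unfolding kap_def by (subst nn_integral_density) (auto intro!: nn_integral_cong simp: indicator_def)

lemma emeasure_kap: "emeasure kap UNIV \<noteq> 0" "emeasure kap UNIV < \<infinity>"
proof -
  have eq: "emeasure kap UNIV = (\<integral>\<^sup>+t\<in>{0<..}. ennreal ((exp (- t) - exp (- 2 * t)) / t) \<partial>lborel)"
    using nn_integral_kap[of "\<lambda>_. 1"] by simp
  have pos: "0 < (exp (- t) - exp (- 2 * t)) / t" if "0 < t" for t :: real using that by simp
  show "emeasure kap UNIV \<noteq> 0"
  proof
    assume "emeasure kap UNIV = 0"
    then have "AE t in lborel. ennreal ((exp (- t) - exp (- 2 * t)) / t) * indicator {0<..} t = 0"
      unfolding eq by (subst (asm) nn_integral_0_iff_AE) auto
    then have "AE t in lborel. t \<notin> {0<..<1::real}"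
    proof eventually_elim
      case (elim t)
      show ?case
      proof
        assume t: "t \<in> {0<..<1}"
        then have "(exp (- t) - exp (- 2 * t)) / t \<le> 0"
          using elim by (auto simp: ennreal_eq_0_iff)
        moreover have "0 < t" using t by simp
        ultimately show False using pos[of t] by linarith
      qed
    qed
    then have "emeasure lborel {0<..<1::real} = 0"
      by (subst (asm) AE_iff_measurable[where N = "{0<..<1}"]) auto
    then show False by simp
  qed
  have "emeasure kap UNIV \<le> (\<integral>\<^sup>+t\<in>{0<..}. ennreal (t powr (1 - 1) * exp (- 1 * t)) \<partial>lborel)"
    unfolding eq
  proof (intro nn_integral_mono)
    fix t :: real
    have "(exp (- t) - exp (- 2 * t)) / t \<le> exp (- t)" if "0 < t"
    proof -
      have "exp (- t) - exp (- 2 * t) = exp (- t) * (1 - exp (- t))"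
        by (simp add: right_diff_distrib exp_add[symmetric])
      also have "\<dots> \<le> exp (- t) * t"
        using exp_ge_add_one_self[of "- t"] by (intro mult_left_mono) auto
      finally show ?thesis using that by (simp add: field_simps)
    qed
    then show "ennreal ((exp (- t) - exp (- 2 * t)) / t) * indicator {0<..} t \<le> ennreal (t powr (1 - 1) * exp (- 1 * t)) * indicator {0<..} t"
      by (auto simp: indicator_def intro!: ennreal_leI)
  qed
  also have "\<dots> = ennreal 1" using nn_integral_Gamma[of 1 1] by simp
  finally show "emeasure kap UNIV < \<infinity>" by (rule le_less_trans) simp
qed

lemma finite_measure_kap: "finite_measure kap"
  by standard (use emeasure_kap in \<open>auto simp: less_top\<close>)

text \<open>Step functions serve as test functions: one factor \<open>r j\<close> for each entry
  above level \<open>j\<close> accumulates to a power of the count, and only finitely many entries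
  contribute.\<close>

lemma iprod_power_count_above:
  assumes p: "p \<in> nabla" and J: "finite J"
  shows "iprod (\<lambda>i. \<Prod>j\<in>J. if pos_rat j < t * p i then r j else 1) = (\<Prod>j\<in>J. r j ^ count_above (\<lambda>i. t * p i) j)"
proof -
  let ?N = "count_above (\<lambda>i. t * p i)"
  define m where "m = Max (insert 0 (?N ` J))"
  have m: "?N j \<le> m" if "j \<in> J" for j using that J by (auto simp: m_def)
  have "iprod (\<lambda>i. \<Prod>j\<in>J. if pos_rat j < t * p i then r j else 1) = (\<Prod>i<m. \<Prod>j\<in>J. if pos_rat j < t * p i then r j else 1)"
  proof (rule iprod_eq_prod)
    fix i assume "m \<le> i"
    show "(\<Prod>j\<in>J. if pos_rat j < t * p i then r j else 1) = 1"
    proof (rule prod.neutral, rule ballI)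
      fix j assume "j \<in> J"
      then have "\<not> i < ?N j" using m[of j] \<open>m \<le> i\<close> by simp
      then show "(if pos_rat j < t * p i then r j else 1) = 1" by (simp add: count_above_iff[OF p])
    qed
  qed
  also have "\<dots> = (\<Prod>j\<in>J. \<Prod>i<m. if pos_rat j < t * p i then r j else 1)" by (rule prod.swap)
  also have "\<dots> = (\<Prod>j\<in>J. r j ^ ?N j)"
  proof (rule prod.cong[OF refl])
    fix j assume j: "j \<in> J"
    have "(\<Prod>i<m. if pos_rat j < t * p i then r j else 1) = (\<Prod>i<m. if i \<in> {..<?N j} then r j else 1)"
      by (simp add: count_above_iff[OF p])
    also have "\<dots> = (\<Prod>i\<in>{..<m} \<inter> {..<?N j}. r j)"
      by (rule prod.inter_restrict[symmetric]) simp
    also have "{..<m} \<inter> {..<?N j} = {..<?N j}" using m[OF j] by auto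
    finally show "(\<Prod>i<m. if pos_rat j < t * p i then r j else 1) = r j ^ ?N j" by simp
  qed
  finally show ?thesis .
qed

text \<open>Only averages over the scale t are given, so the law of the level counts of t p is
  identified under the product of \<open>kap\<close> with the measure. From the counts p is
  recovered by normalising, which forgets t because p sums to 1.\<close>

theorem nabla_measure_eqI:
  assumes fin: "finite_measure \<mu>1" "finite_measure \<mu>2"
    and sets1: "sets \<mu>1 = sets (restrict_space borel nabla)" and sets2: "sets \<mu>2 = sets (restrict_space borel nabla)"
    and eq: "\<And>\<rho> C. \<rho> \<in> borel_measurable borel \<Longrightarrow> (\<And>x. \<rho> x \<in> {0..1}) \<Longrightarrow> \<rho> 0 = 1 \<Longrightarrow> 0 \<le> C \<Longrightarrow> (\<And>x. 0 \<le> x \<Longrightarrow> 1 - \<rho> x \<le> C * x) \<Longrightarrow>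
      (\<integral>\<^sup>+p. (\<integral>\<^sup>+t. ennreal (iprod (\<lambda>i. \<rho> (t * p i))) \<partial>kap) \<partial>\<mu>1) = (\<integral>\<^sup>+p. (\<integral>\<^sup>+t. ennreal (iprod (\<lambda>i. \<rho> (t * p i))) \<partial>kap) \<partial>\<mu>2)"
  shows "\<mu>1 = \<mu>2"
proof (rule measure_eqI)
  show ss: "sets \<mu>1 = sets \<mu>2" using sets1 sets2 by simp
  interpret K: finite_measure kap by (rule finite_measure_kap)
  let ?R = "restrict_space borel nabla :: (nat \<Rightarrow> real) measure"
  let ?S = "kap \<Otimes>\<^sub>M ?R"
  let ?P = "\<Pi>\<^sub>M n\<in>(UNIV::nat set). (count_space UNIV :: nat measure)"
  define cnt where "cnt = (\<lambda>(t, p). count_above (\<lambda>i. t * p i))"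
  have coord [measurable]: "(\<lambda>p. p i) \<in> borel_measurable ?R" for i
    by (intro measurable_restrict_space1 borel_measurable_continuous_onI)
      (simp add: continuous_on_product_coordinates)
  have cnt_coord [measurable]: "(\<lambda>x. cnt x n) \<in> measurable ?S (count_space UNIV)" for n
    unfolding cnt_def count_above_def split_beta' by measurable
  have cnt [measurable]: "cnt \<in> measurable ?S ?P"
    by (rule measurable_PiM_single') (auto simp: space_PiM)
  have pw: "(\<lambda>x. ennreal (\<Prod>j\<in>K. r j ^ cnt x j)) \<in> borel_measurable ?S" for K and r :: "nat \<Rightarrow> real"
    by (intro measurable_compose[OF _ measurable_ennreal] borel_measurable_prod measurable_compose[OF cnt_coord]) simp
  have ind: "(\<lambda>x. \<Prod>j\<in>J. indicator (A j) (cnt x j) :: ennreal) \<in> borel_measurable ?S" for J and A :: "nat \<Rightarrow> nat set"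
    by (intro borel_measurable_prod_ennreal measurable_compose[OF cnt_coord]) simp
  have space_R: "space \<mu> = nabla" if "sets \<mu> = sets ?R" for \<mu>
    using sets_eq_imp_space_eq[OF that] by (simp add: space_restrict_space)
  have setsS: "sets (kap \<Otimes>\<^sub>M \<mu>) = sets ?S" if "sets \<mu> = sets ?R" for \<mu>
    using that by (intro sets_pair_measure_cong) auto
  have finS: "finite_measure (kap \<Otimes>\<^sub>M \<mu>)" if "finite_measure \<mu>" for \<mu>
    using that K.finite_measure_axioms by (rule finite_measure_pair_measure)
  have gf: "(\<integral>\<^sup>+x. ennreal (\<Prod>j\<in>J. r j ^ cnt x j) \<partial>(kap \<Otimes>\<^sub>M \<mu>1)) = (\<integral>\<^sup>+x. ennreal (\<Prod>j\<in>J. r j ^ cnt x j) \<partial>(kap \<Otimes>\<^sub>M \<mu>2))"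
    if J: "finite J" and r: "\<And>j. r j \<in> {0..1}" for J r
  proof -
    let ?\<rho> = "\<lambda>x. \<Prod>j\<in>J. if pos_rat j < x then r j else 1"
    have int: "(\<integral>\<^sup>+x. ennreal (\<Prod>j\<in>J. r j ^ cnt x j) \<partial>(kap \<Otimes>\<^sub>M \<mu>)) = (\<integral>\<^sup>+p. (\<integral>\<^sup>+t. ennreal (iprod (\<lambda>i. ?\<rho> (t * p i))) \<partial>kap) \<partial>\<mu>)"
      if \<mu>: "finite_measure \<mu>" "sets \<mu> = sets ?R" for \<mu>
    proof -
      interpret M: finite_measure \<mu> by fact
      interpret pair_sigma_finite kap \<mu> ..
      have [measurable_cong]: "sets \<mu> = sets ?R" by fact
      have "(\<lambda>x. ennreal (\<Prod>j\<in>J. r j ^ cnt x j)) \<in> borel_measurable (kap \<Otimes>\<^sub>M \<mu>)"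
        using pw[where K = J and r = r] measurable_cong_sets[OF setsS[OF \<mu>(2)] refl] by blast
      from nn_integral_snd[OF this[folded case_prod_eta]]
      have "(\<integral>\<^sup>+x. ennreal (\<Prod>j\<in>J. r j ^ cnt x j) \<partial>(kap \<Otimes>\<^sub>M \<mu>)) = (\<integral>\<^sup>+p. (\<integral>\<^sup>+t. ennreal (\<Prod>j\<in>J. r j ^ cnt (t, p) j) \<partial>kap) \<partial>\<mu>)"
        by simp
      also have "\<dots> = (\<integral>\<^sup>+p. (\<integral>\<^sup>+t. ennreal (iprod (\<lambda>i. ?\<rho> (t * p i))) \<partial>kap) \<partial>\<mu>)"
        using space_R[OF \<mu>(2)] by (intro nn_integral_cong) (simp add: iprod_power_count_above[OF _ J] cnt_def)
      finally show ?thesis .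
    qed
    have "(\<integral>\<^sup>+p. (\<integral>\<^sup>+t. ennreal (iprod (\<lambda>i. ?\<rho> (t * p i))) \<partial>kap) \<partial>\<mu>1) = (\<integral>\<^sup>+p. (\<integral>\<^sup>+t. ennreal (iprod (\<lambda>i. ?\<rho> (t * p i))) \<partial>kap) \<partial>\<mu>2)"
    proof (rule eq)
      show rng: "?\<rho> x \<in> {0..1}" for x
        using r by (auto intro!: prod_nonneg prod_le_1)
      show "?\<rho> 0 = 1" using pos_rat_pos less_asym by (intro prod.neutral) auto
      \<comment> \<open>Origin of the constant: the test function differs from 1 only when x exceeds
        some level l, and then 1 \<le> x / l.\<close>
      show "0 \<le> (\<Sum>j\<in>J. 1 / pos_rat j)" using pos_rat_pos by (intro sum_nonneg) (simp add: less_imp_le)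
      show "1 - ?\<rho> x \<le> (\<Sum>j\<in>J. 1 / pos_rat j) * x" if "0 \<le> x" for x
      proof (cases "\<exists>j\<in>J. pos_rat j < x")
        case True
        then obtain j where j: "j \<in> J" "pos_rat j < x" by auto
        have "1 \<le> 1 / pos_rat j * x" using j pos_rat_pos[of j] by (simp add: field_simps)
        also have "\<dots> \<le> (\<Sum>j\<in>J. 1 / pos_rat j) * x"
          using that j(1) J pos_rat_pos by (intro mult_right_mono member_le_sum) (auto simp: less_imp_le)
        finally show ?thesis using rng[of x] by simp
      next
        case False
        then have "?\<rho> x = 1" by (auto intro!: prod.neutral)
        then show ?thesis using that pos_rat_pos by (auto intro!: mult_nonneg_nonneg sum_nonneg simp: less_imp_le)
      qed
    qed measurable
    then show ?thesis using int[OF fin(1) sets1] int[OF fin(2) sets2] by simp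
  qed
  \<comment> \<open>Counts in \<open>J\<close> are confined to given sets, counts in
    \<open>K\<close> still carry generating weights. Each induction step trades one weight for an
    indicator, so \<open>K\<close> and \<open>r\<close> have to stay general.\<close>
  have box: "(\<integral>\<^sup>+x. (\<Prod>j\<in>J. indicator (A j) (cnt x j)) * ennreal (\<Prod>j\<in>K. r j ^ cnt x j) \<partial>(kap \<Otimes>\<^sub>M \<mu>1)) =
             (\<integral>\<^sup>+x. (\<Prod>j\<in>J. indicator (A j) (cnt x j)) * ennreal (\<Prod>j\<in>K. r j ^ cnt x j) \<partial>(kap \<Otimes>\<^sub>M \<mu>2))"
    if "finite J" "finite K" "J \<inter> K = {}" "\<And>j. r j \<in> {0..1}" for J K r and A :: "nat \<Rightarrow> nat set"
    using that
  proof (induction J arbitrary: K r rule: finite_induct)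
    case empty
    then show ?case using gf by simp
  next
    case (insert j J)
    let ?Y = "\<lambda>x. (\<Prod>j\<in>J. indicator (A j) (cnt x j)) * ennreal (\<Prod>j\<in>K. r j ^ cnt x j)"
    have "(\<integral>\<^sup>+x. ?Y x * indicator (A j) (cnt x j) \<partial>(kap \<Otimes>\<^sub>M \<mu>1)) = (\<integral>\<^sup>+x. ?Y x * indicator (A j) (cnt x j) \<partial>(kap \<Otimes>\<^sub>M \<mu>2))"
    proof (rule generating_function_unique)
      show "sets (kap \<Otimes>\<^sub>M \<mu>1) = sets (kap \<Otimes>\<^sub>M \<mu>2)" by (simp add: setsS sets1 sets2)
      note [measurable_cong] = setsS[OF sets1]
      show "(\<lambda>x. cnt x j) \<in> measurable (kap \<Otimes>\<^sub>M \<mu>1) (count_space UNIV)" by measurable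
      show "?Y \<in> borel_measurable (kap \<Otimes>\<^sub>M \<mu>1)"
        using borel_measurable_times_ennreal[OF ind[where J = J and A = A] pw[where K = K and r = r]] measurable_cong_sets[OF setsS[OF sets1] refl] by blast
      show "?Y x \<le> 1" for x
      proof -
        have "(\<Prod>j\<in>J. indicator (A j) (cnt x j) :: ennreal) \<le> 1"
          by (intro prod_le_1) (auto simp: indicator_def)
        moreover have "(\<Prod>j\<in>K. r j ^ cnt x j) \<le> 1"
          using insert.prems(3) by (intro prod_le_1) (auto intro!: power_le_one)
        ultimately show ?thesis using mult_mono[of _ "1::ennreal" _ 1] by fastforce
      qed
      fix s :: real assume s: "0 < s" "s < 1"
      have "?Y x * ennreal (s ^ cnt x j) = (\<Prod>j\<in>J. indicator (A j) (cnt x j)) * ennreal (\<Prod>i\<in>insert j K. (r(j := s)) i ^ cnt x i)" for x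
      proof -
        have "j \<notin> K" using insert.prems by auto
        then have "(\<Prod>i\<in>K. (r(j := s)) i ^ cnt x i) = (\<Prod>i\<in>K. r i ^ cnt x i)"
          by (intro prod.cong) auto
        then have "(\<Prod>i\<in>insert j K. (r(j := s)) i ^ cnt x i) = s ^ cnt x j * (\<Prod>i\<in>K. r i ^ cnt x i)"
          using \<open>j \<notin> K\<close> insert.prems by simp
        then show ?thesis using s insert.prems(3)
          by (simp add: ennreal_mult prod_nonneg ac_simps)
      qed
      moreover have "(\<integral>\<^sup>+x. (\<Prod>j\<in>J. indicator (A j) (cnt x j)) * ennreal (\<Prod>i\<in>insert j K. (r(j := s)) i ^ cnt x i) \<partial>(kap \<Otimes>\<^sub>M \<mu>1)) =
         (\<integral>\<^sup>+x. (\<Prod>j\<in>J. indicator (A j) (cnt x j)) * ennreal (\<Prod>i\<in>insert j K. (r(j := s)) i ^ cnt x i) \<partial>(kap \<Otimes>\<^sub>M \<mu>2))"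
        using insert s by (intro insert.IH) auto
      ultimately show "(\<integral>\<^sup>+x. ?Y x * ennreal (s ^ cnt x j) \<partial>(kap \<Otimes>\<^sub>M \<mu>1)) = (\<integral>\<^sup>+x. ?Y x * ennreal (s ^ cnt x j) \<partial>(kap \<Otimes>\<^sub>M \<mu>2))"
        by simp
    qed (use finS fin in auto)
    then show ?case using insert.hyps by (simp add: mult.assoc mult.commute mult.left_commute)
  qed
  have measS: "cnt \<in> measurable (kap \<Otimes>\<^sub>M \<mu>) ?P" if "sets \<mu> = sets ?R" for \<mu>
    using cnt setsS[OF that] measurable_cong_sets by blast
  have law: "distr (kap \<Otimes>\<^sub>M \<mu>1) ?P cnt = distr (kap \<Otimes>\<^sub>M \<mu>2) ?P cnt"
  proof (rule measure_eqI_PiM_infinite)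
    show "finite_measure (distr (kap \<Otimes>\<^sub>M \<mu>1) ?P cnt)"
      using finS[OF fin(1)] measS[OF sets1] by (rule finite_measure.finite_measure_distr)
    fix A :: "nat \<Rightarrow> nat set" and J :: "nat set" assume J: "finite J"
    have "emeasure (distr (kap \<Otimes>\<^sub>M \<mu>) ?P cnt) (prod_emb UNIV (\<lambda>_. count_space UNIV) J (Pi\<^sub>E J A)) =
       (\<integral>\<^sup>+x. (\<Prod>j\<in>J. indicator (A j) (cnt x j)) * ennreal (\<Prod>j\<in>{}. 1 ^ cnt x j) \<partial>(kap \<Otimes>\<^sub>M \<mu>))" if \<mu>: "sets \<mu> = sets ?R" for \<mu>
    proof -
      let ?E = "prod_emb UNIV (\<lambda>_. count_space UNIV :: nat measure) J (Pi\<^sub>E J A)"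
      have "?E \<in> sets ?P" using J by (intro sets_PiM_I) auto
      then have "emeasure (distr (kap \<Otimes>\<^sub>M \<mu>) ?P cnt) ?E = (\<integral>\<^sup>+\<omega>. indicator ?E \<omega> \<partial>distr (kap \<Otimes>\<^sub>M \<mu>) ?P cnt)"
        by simp
      also have "\<dots> = (\<integral>\<^sup>+x. indicator ?E (cnt x) \<partial>(kap \<Otimes>\<^sub>M \<mu>))"
        using measS[OF \<mu>] \<open>?E \<in> sets ?P\<close> by (intro nn_integral_distr) auto
      also have "\<dots> = (\<integral>\<^sup>+x. (\<Prod>j\<in>J. indicator (A j) (cnt x j)) * ennreal (\<Prod>j\<in>{}. 1 ^ cnt x j) \<partial>(kap \<Otimes>\<^sub>M \<mu>))"
      proof (rule nn_integral_cong)
        fix x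
        have "cnt x \<in> ?E \<longleftrightarrow> (\<forall>j\<in>J. cnt x j \<in> A j)" by (auto simp: prod_emb_def PiE_iff)
        moreover have "(\<Prod>j\<in>J. indicator (A j) (cnt x j) :: ennreal) = (if \<forall>j\<in>J. cnt x j \<in> A j then 1 else 0)"
          using J by (auto simp: indicator_def)
        ultimately show "indicator ?E (cnt x) = (\<Prod>j\<in>J. indicator (A j) (cnt x j)) * ennreal (\<Prod>j\<in>{}. 1 ^ cnt x j)"
          by (simp add: indicator_def)
      qed
      finally show ?thesis .
    qed
    note e = this
    show "emeasure (distr (kap \<Otimes>\<^sub>M \<mu>1) ?P cnt) (prod_emb UNIV (\<lambda>_. count_space UNIV) J (Pi\<^sub>E J A)) =
       emeasure (distr (kap \<Otimes>\<^sub>M \<mu>2) ?P cnt) (prod_emb UNIV (\<lambda>_. count_space UNIV) J (Pi\<^sub>E J A))"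
      unfolding e[OF sets1] e[OF sets2] by (rule box) (use J in auto)
  qed auto
  \<comment> \<open>Division by the total removes the scale t.\<close>
  define rec where "rec \<omega> = (\<lambda>i. uncount \<omega> i / (\<Sum>k. uncount \<omega> k))" for \<omega>
  have rec [measurable]: "rec \<in> borel_measurable ?P"
    unfolding rec_def[abs_def] by (rule measurable_coordinatewise_then_product) measurable
  have rec_cnt: "rec (cnt (t, p)) = p" if "0 < t" "p \<in> nabla" for t p
  proof -
    have "(\<Sum>k. t * p k) = t"
      using that(2) by (subst suminf_mult) (auto simp: nabla_def sums_iff)
    then show ?thesis using that by (simp add: rec_def cnt_def uncount_count_above)
  qed
  fix B assume B: "B \<in> sets \<mu>1"
  then obtain B' where B': "B' \<in> sets borel" "B = B' \<inter> nabla"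
    unfolding sets1 by (auto simp: sets_restrict_space)
  have pt: "(indicator (UNIV \<times> B) x :: ennreal) = indicator B' (rec (cnt x))" if "0 < fst x" "snd x \<in> nabla" for x
    using rec_cnt[OF that] that(2) unfolding B'(2) by (cases x) (simp add: indicator_def)
  have "emeasure kap UNIV * emeasure \<mu> B = (\<integral>\<^sup>+\<omega>. indicator B' (rec \<omega>) \<partial>distr (kap \<Otimes>\<^sub>M \<mu>) ?P cnt)"
    if \<mu>: "finite_measure \<mu>" "sets \<mu> = sets ?R" for \<mu>
  proof -
    interpret M: finite_measure \<mu> by fact
    interpret pair_sigma_finite kap \<mu> ..
    have [measurable]: "B \<in> sets \<mu>" using B \<mu>(2) sets1 by simp
    have "emeasure kap UNIV * emeasure \<mu> B = emeasure (kap \<Otimes>\<^sub>M \<mu>) (UNIV \<times> B)"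
      by (rule M.emeasure_pair_measure_Times[symmetric]) auto
    also have "\<dots> = (\<integral>\<^sup>+x. indicator (UNIV \<times> B) x \<partial>(kap \<Otimes>\<^sub>M \<mu>))"
      by (rule nn_integral_indicator[symmetric]) (auto intro: pair_measureI)
    also have "\<dots> = (\<integral>\<^sup>+x. indicator B' (rec (cnt x)) \<partial>(kap \<Otimes>\<^sub>M \<mu>))"
    proof (rule nn_integral_cong_AE)
      have ae: "AE x in kap \<Otimes>\<^sub>M \<mu>. 0 < fst x"
      proof (rule AE_pair_measure)
        show "{x \<in> space (kap \<Otimes>\<^sub>M \<mu>). 0 < fst x} \<in> sets (kap \<Otimes>\<^sub>M \<mu>)" by measurable
        show "AE t in kap. AE p in \<mu>. 0 < fst (t, p)"
          using AE_kap_pos by eventually_elim simp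
      qed
      show "AE x in kap \<Otimes>\<^sub>M \<mu>. (indicator (UNIV \<times> B) x :: ennreal) = (indicator B' (rec (cnt x)) :: ennreal)"
      proof (rule AE_mp[OF ae], rule AE_I2, rule impI, rule pt)
        fix x assume "x \<in> space (kap \<Otimes>\<^sub>M \<mu>)"
        then have "x \<in> UNIV \<times> nabla" by (simp only: space_pair_measure space_kap space_R[OF \<mu>(2)])
        then show "snd x \<in> nabla" by (simp only: mem_Times_iff)
      qed
    qed
    also have "\<dots> = (\<integral>\<^sup>+\<omega>. indicator B' (rec \<omega>) \<partial>distr (kap \<Otimes>\<^sub>M \<mu>) ?P cnt)"
      using measS[OF \<mu>(2)] B' by (intro nn_integral_distr[symmetric]) auto
    finally show ?thesis .
  qed
  from this[OF fin(1) sets1] this[OF fin(2) sets2]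
  have "emeasure kap UNIV * emeasure \<mu>1 B = emeasure kap UNIV * emeasure \<mu>2 B" by (simp add: law)
  then show "emeasure \<mu>1 B = emeasure \<mu>2 B"
    using emeasure_kap by (subst (asm) ennreal_mult_cancel_left) auto
qed

section \<open>Marked sequences\<close>

abbreviation iid :: "'s measure \<Rightarrow> (nat \<Rightarrow> 's) measure" where
  "iid \<nu> \<equiv> \<Pi>\<^sub>M i\<in>(UNIV::nat set). \<nu>"

lemma measurable_coordinate_borel: "(\<lambda>p::nat \<Rightarrow> real. p i) \<in> borel_measurable borel"
  by (rule borel_measurable_continuous_onI) (simp add: continuous_on_product_coordinates)

text \<open>With extended reals the series condition is measurable without a discussion of
  convergence.\<close>

lemma nabla_iff: "p \<in> nabla \<longleftrightarrow> (\<forall>i. p (Suc i) \<le> p i) \<and> (\<forall>i. 0 \<le> p i) \<and> (\<Sum>i. ennreal (p i)) = 1"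
proof -
  have "p sums 1 \<longleftrightarrow> (\<Sum>i. ennreal (p i)) = 1" if nn: "\<forall>i. 0 \<le> p i"
  proof
    assume "p sums 1"
    then show "(\<Sum>i. ennreal (p i)) = 1" using nn by (subst suminf_ennreal2) (auto simp: sums_iff)
  next
    assume 1: "(\<Sum>i. ennreal (p i)) = 1"
    then have s: "summable p" using nn by (intro summable_suminf_not_top) auto
    then have "ennreal (suminf p) = 1" using 1 nn by (subst (asm) suminf_ennreal2) auto
    then show "p sums 1" using s by (simp add: sums_iff)
  qed
  then show ?thesis unfolding nabla_def decseq_Suc_iff by auto
qed

lemma sets_nabla [measurable]: "nabla \<in> sets borel"
proof -
  have "{p \<in> space borel. (\<forall>i. p (Suc i) \<le> p i) \<and> (\<forall>i. 0 \<le> p i) \<and> (\<Sum>i. ennreal (p i)) = 1} \<in> sets (borel :: (nat \<Rightarrow> real) measure)"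
  proof (intro sets.sets_Collect_conj sets.sets_Collect_countable_All)
    show "{p \<in> space borel. p (Suc i) \<le> p i} \<in> sets (borel :: (nat \<Rightarrow> real) measure)" for i
      by (rule borel_measurable_le) (rule measurable_coordinate_borel)+
    show "{p \<in> space borel. 0 \<le> p i} \<in> sets (borel :: (nat \<Rightarrow> real) measure)" for i
      by (intro borel_measurable_le measurable_coordinate_borel borel_measurable_const)
    have "(\<lambda>p. \<Sum>i. ennreal (p i)) \<in> borel_measurable (borel :: (nat \<Rightarrow> real) measure)"
      by (intro borel_measurable_suminf_order measurable_compose[OF measurable_coordinate_borel measurable_ennreal])
    then show "{p \<in> space borel. (\<Sum>i. ennreal (p i)) = 1} \<in> sets (borel :: (nat \<Rightarrow> real) measure)"
      by measurable
  qed
  also have "{p \<in> space borel. (\<forall>i. p (Suc i) \<le> p i) \<and> (\<forall>i. 0 \<le> p i) \<and> (\<Sum>i. ennreal (p i)) = 1} = nabla"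
    by (simp only: nabla_iff[symmetric]) simp
  finally show ?thesis .
qed

section \<open>The Poisson-Dirichlet law as a probability measure on \<open>nabla\<close>\<close>

lemma PD_eq: "PD \<alpha> \<theta> = restrict_space (distr (gem \<alpha> \<theta>) borel (\<lambda>U. desc (stick_breaking U))) nabla"
  by (simp add: PD_def gem_def)

lemma sets_PD [measurable_cong]: "sets (PD \<alpha> \<theta>) = sets (restrict_space borel nabla)"
  unfolding PD_eq by (rule sets_restrict_space_cong) simp

lemma space_PD: "space (PD \<alpha> \<theta>) = nabla"
  using sets_eq_imp_space_eq[OF sets_PD] by (simp add: space_restrict_space)

lemma measurable_coordinate_PD: "(\<lambda>p. p i) \<in> borel_measurable (PD \<alpha> \<theta>)"
  using measurable_restrict_space1[OF measurable_coordinate_borel] measurable_cong_sets[OF sets_PD refl] by blast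

context pd_index
begin

lemma measurable_desc_stick_breaking [measurable]:
  "(\<lambda>U. desc (stick_breaking U)) \<in> borel_measurable (\<Pi>\<^sub>M i\<in>UNIV. borel)"
  by (rule measurable_compose[OF _ measurable_desc]) (rule measurable_coordinatewise_then_product, measurable)

lemma AE_gem_desc:
  assumes "- \<alpha> < \<theta>"
  shows "AE U in gem \<alpha> \<theta>. desc (stick_breaking U) \<in> nabla \<and> (\<exists>\<pi>. bij \<pi> \<and> desc (stick_breaking U) = stick_breaking U \<circ> \<pi>) \<and> (\<forall>i. 0 < stick_breaking U i)"
  using AE_gem_unit[OF assms] AE_gem_sums[OF assms]
proof eventually_elim
  fix U :: "nat \<Rightarrow> real" assume U: "\<forall>i. 0 < U i \<and> U i < 1" and s: "stick_breaking U sums 1"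
  have pos: "0 < stick_breaking U i" for i using U stick_breaking_pos by blast
  obtain \<pi> where "bij \<pi>" "desc (stick_breaking U) = stick_breaking U \<circ> \<pi>"
    using desc_positive_null[OF pos summable_LIMSEQ_zero[OF sums_summable[OF s]]] by blast
  then show "desc (stick_breaking U) \<in> nabla \<and> (\<exists>\<pi>. bij \<pi> \<and> desc (stick_breaking U) = stick_breaking U \<circ> \<pi>) \<and> (\<forall>i. 0 < stick_breaking U i)"
    using desc_in_nabla[OF pos s] pos by blast
qed

text \<open>The restriction to \<open>nabla\<close> costs nothing, because the sorted sticks lie in
  it almost surely.\<close>

lemma nn_integral_PD:
  assumes "- \<alpha> < \<theta>" and [measurable]: "F \<in> borel_measurable borel"
  shows "(\<integral>\<^sup>+p. F p \<partial>PD \<alpha> \<theta>) = (\<integral>\<^sup>+U. F (desc (stick_breaking U)) \<partial>gem \<alpha> \<theta>)"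
proof -
  have "(\<integral>\<^sup>+p. F p \<partial>PD \<alpha> \<theta>) = (\<integral>\<^sup>+p. F p * indicator nabla p \<partial>distr (gem \<alpha> \<theta>) borel (\<lambda>U. desc (stick_breaking U)))"
    unfolding PD_eq by (rule nn_integral_restrict_space) simp
  also have "\<dots> = (\<integral>\<^sup>+U. F (desc (stick_breaking U)) * indicator nabla (desc (stick_breaking U)) \<partial>gem \<alpha> \<theta>)"
    by (rule nn_integral_distr) measurable
  also have "\<dots> = (\<integral>\<^sup>+U. F (desc (stick_breaking U)) \<partial>gem \<alpha> \<theta>)"
    by (rule nn_integral_cong_AE) (use AE_gem_desc[OF assms(1)] in \<open>eventually_elim, auto\<close>)
  finally show ?thesis .
qed

lemma prob_space_PD:
  assumes "- \<alpha> < \<theta>"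
  shows "prob_space (PD \<alpha> \<theta>)"
proof
  interpret prob_space "gem \<alpha> \<theta>" by (rule prob_space_gem[OF assms])
  have "emeasure (PD \<alpha> \<theta>) (space (PD \<alpha> \<theta>)) = (\<integral>\<^sup>+p. 1 \<partial>PD \<alpha> \<theta>)" by simp
  also have "\<dots> = 1" by (subst nn_integral_PD[OF assms]) (auto simp: emeasure_space_1)
  finally show "emeasure (PD \<alpha> \<theta>) (space (PD \<alpha> \<theta>)) = 1" .
qed

lemma AE_PD_pos:
  assumes "- \<alpha> < \<theta>"
  shows "AE p in PD \<alpha> \<theta>. \<forall>i. 0 < p i"
proof -
  have "(\<integral>\<^sup>+p. indicator {p. \<not> (\<forall>i. 0 < p i)} p \<partial>PD \<alpha> \<theta>) = (\<integral>\<^sup>+U. indicator {p. \<not> (\<forall>i. 0 < p i)} (desc (stick_breaking U)) \<partial>gem \<alpha> \<theta>)"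
    by (rule nn_integral_PD[OF assms]) measurable
  also have "\<dots> = (\<integral>\<^sup>+U. 0 \<partial>gem \<alpha> \<theta>)"
    by (rule nn_integral_cong_AE) (use AE_gem_desc[OF assms] in \<open>eventually_elim, auto\<close>)
  finally have 0: "(\<integral>\<^sup>+p. indicator {p. \<not> (\<forall>i. 0 < p i)} p \<partial>PD \<alpha> \<theta>) = 0" by simp
  have "{p \<in> space (PD \<alpha> \<theta>). \<forall>i. 0 < p i} \<in> sets (PD \<alpha> \<theta>)"
    by (intro sets.sets_Collect_countable_All borel_measurable_less measurable_coordinate_PD borel_measurable_const)
  then show ?thesis using 0 by (subst AE_iff_nn_integral) auto
qed

end

text \<open>Products of factors in [0, 1] ignore the order, so the test functionals do not notice
  the sorting of the sticks.\<close>

lemma (in pd_unit) Psi_eq_PD: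
  assumes "- \<alpha> < \<theta>"
  shows "(\<integral>\<^sup>+p. ennreal (iprod (\<lambda>i. \<rho> (u * p i))) \<partial>PD \<alpha> \<theta>) = Psi \<alpha> \<rho> \<theta> u"
proof -
  have "(\<integral>\<^sup>+p. ennreal (iprod (\<lambda>i. \<rho> (u * p i))) \<partial>PD \<alpha> \<theta>) = (\<integral>\<^sup>+U. ennreal (iprod (\<lambda>i. \<rho> (u * desc (stick_breaking U) i))) \<partial>gem \<alpha> \<theta>)"
    by (rule nn_integral_PD[OF assms]) measurable
  also have "\<dots> = Psi \<alpha> \<rho> \<theta> u"
    unfolding Psi_def
  proof (rule nn_integral_cong_AE, use AE_gem_desc[OF assms] in eventually_elim)
    case (elim U)
    then obtain \<pi> where \<pi>: "bij \<pi>" "desc (stick_breaking U) = stick_breaking U \<circ> \<pi>" by blast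
    have "iprod (\<lambda>i. \<rho> (u * desc (stick_breaking U) i)) = iprod ((\<lambda>i. \<rho> (u * stick_breaking U i)) \<circ> \<pi>)"
      by (simp add: \<pi>(2) o_def)
    also have "\<dots> = iprod (\<lambda>i. \<rho> (u * stick_breaking U i))" by (rule iprod_bij[OF \<rho>_range \<pi>(1)])
    finally show ?case by simp
  qed
  finally show ?thesis .
qed

section \<open>Integrating out independent marks\<close>

lemma nn_integral_iid_prod:
  assumes \<nu>: "prob_space \<nu>" and "\<And>i. g i \<in> borel_measurable \<nu>"
  shows "(\<integral>\<^sup>+\<xi>. (\<Prod>i<n. g i (\<xi> i)) \<partial>iid \<nu>) = (\<Prod>i<n. \<integral>\<^sup>+s. g i s \<partial>\<nu>)"
  using assms(2)
proof (induction n arbitrary: g)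
  case 0
  interpret prob_space "iid \<nu>" by (rule prob_space_PiM) (rule \<nu>)
  show ?case by (simp add: emeasure_space_1)
next
  case (Suc n)
  note [measurable] = Suc.prems
  interpret N: prob_space \<nu> by fact
  interpret prob_space "iid \<nu>" by (rule prob_space_PiM) (rule \<nu>)
  have P: "distr (\<nu> \<Otimes>\<^sub>M iid \<nu>) (iid \<nu>) (\<lambda>(x, \<omega>). case_nat x \<omega>) = iid \<nu>"
    and m: "(\<lambda>(x, \<omega>). case_nat x \<omega>) \<in> measurable (\<nu> \<Otimes>\<^sub>M iid \<nu>) (iid \<nu>)"
    using distr_case_nat_PiM(1)[of "\<lambda>_. \<nu>", OF \<nu>] measurable_case_nat_PiM[of "\<lambda>_. \<nu>", OF \<nu>] .
  let ?h = "\<lambda>\<xi>. \<Prod>i<Suc n. g i (\<xi> i)"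
  have h: "?h \<in> borel_measurable (iid \<nu>)" by measurable
  have "(\<integral>\<^sup>+\<xi>. ?h \<xi> \<partial>iid \<nu>) = (\<integral>\<^sup>+p. ?h (case p of (x, \<omega>) \<Rightarrow> case_nat x \<omega>) \<partial>(\<nu> \<Otimes>\<^sub>M iid \<nu>))"
    by (subst P[symmetric], rule nn_integral_distr[OF m]) (use h in simp)
  also have "\<dots> = (\<integral>\<^sup>+x. (\<integral>\<^sup>+\<omega>. ?h (case_nat x \<omega>) \<partial>iid \<nu>) \<partial>\<nu>)"
    using measurable_compose[OF m h] by (subst nn_integral_fst[symmetric]) auto
  also have "\<dots> = (\<integral>\<^sup>+x. (\<integral>\<^sup>+\<omega>. g 0 x * (\<Prod>i<n. g (Suc i) (\<omega> i)) \<partial>iid \<nu>) \<partial>\<nu>)"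
    by (simp add: prod.lessThan_Suc_shift del: prod.lessThan_Suc)
  also have "\<dots> = (\<integral>\<^sup>+x. g 0 x * (\<Prod>i<n. \<integral>\<^sup>+s. g (Suc i) s \<partial>\<nu>) \<partial>\<nu>)"
  proof (rule nn_integral_cong)
    fix x
    have "(\<integral>\<^sup>+\<omega>. (\<Prod>i<n. g (Suc i) (\<omega> i)) \<partial>iid \<nu>) = (\<Prod>i<n. \<integral>\<^sup>+s. g (Suc i) s \<partial>\<nu>)"
      by (rule Suc.IH) (rule Suc.prems)
    then show "(\<integral>\<^sup>+\<omega>. g 0 x * (\<Prod>i<n. g (Suc i) (\<omega> i)) \<partial>iid \<nu>) = g 0 x * (\<Prod>i<n. \<integral>\<^sup>+s. g (Suc i) s \<partial>\<nu>)"
      by (subst nn_integral_cmult) auto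
  qed
  also have "\<dots> = (\<Prod>i<Suc n. \<integral>\<^sup>+s. g i s \<partial>\<nu>)"
    by (subst nn_integral_multc) (auto simp: prod.lessThan_Suc_shift simp del: prod.lessThan_Suc)
  finally show ?case .
qed

lemma prob_space_integral_unit:
  assumes "prob_space \<nu>" and m: "g \<in> borel_measurable \<nu>" and r: "\<And>s. g s \<in> {0..1::real}"
  shows "(\<integral>s. g s \<partial>\<nu>) \<in> {0..1}" "(\<integral>\<^sup>+s. ennreal (g s) \<partial>\<nu>) = ennreal (\<integral>s. g s \<partial>\<nu>)" "integrable \<nu> g"
proof -
  interpret prob_space \<nu> by fact
  show int: "integrable \<nu> g"
    using m r by (intro integrable_const_bound[where B = 1]) auto
  have "(\<integral>s. g s \<partial>\<nu>) \<le> (\<integral>s. 1 \<partial>\<nu>)" using int r by (intro integral_mono) auto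
  then show "(\<integral>s. g s \<partial>\<nu>) \<in> {0..1}" using r by (auto simp: prob_space)
  show "(\<integral>\<^sup>+s. ennreal (g s) \<partial>\<nu>) = ennreal (\<integral>s. g s \<partial>\<nu>)"
    using int r by (intro nn_integral_eq_integral) auto
qed

text \<open>Independence handles the partial products, which 1 dominates. Averaging the marks thus
  replaces each marked factor by its mean, again a factor in [0, 1].\<close>

lemma nn_integral_iid_iprod:
  assumes \<nu>: "prob_space \<nu>" and g [measurable]: "\<And>i. g i \<in> borel_measurable \<nu>" and r: "\<And>i s. g i s \<in> {0..1}"
  shows "(\<integral>\<^sup>+\<xi>. ennreal (iprod (\<lambda>i. g i (\<xi> i))) \<partial>iid \<nu>) = ennreal (iprod (\<lambda>i. \<integral>s. g i s \<partial>\<nu>))"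
proof (rule LIMSEQ_unique)
  interpret prob_space "iid \<nu>" by (rule prob_space_PiM) (rule \<nu>)
  have gi: "(\<lambda>\<xi>. g i (\<xi> i)) \<in> borel_measurable (iid \<nu>)" for i by measurable
  show "(\<lambda>n. \<integral>\<^sup>+\<xi>. ennreal (\<Prod>i<n. g i (\<xi> i)) \<partial>iid \<nu>) \<longlonglongrightarrow> (\<integral>\<^sup>+\<xi>. ennreal (iprod (\<lambda>i. g i (\<xi> i))) \<partial>iid \<nu>)"
  proof (rule nn_integral_dominated_convergence[where w = "\<lambda>_. 1"])
    show "AE \<xi> in iid \<nu>. (\<lambda>n. ennreal (\<Prod>i<n. g i (\<xi> i))) \<longlonglongrightarrow> ennreal (iprod (\<lambda>i. g i (\<xi> i)))"
      by (intro AE_I2 tendsto_ennrealI iprod_LIMSEQ r)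
    show "AE \<xi> in iid \<nu>. ennreal (\<Prod>i<n. g i (\<xi> i)) \<le> 1" for n
      using prod_unit_range[of "\<lambda>i. g i (_ i)", OF r] by (auto simp del: prod.lessThan_Suc)
  qed (auto simp: emeasure_space_1)
  have "(\<integral>\<^sup>+\<xi>. ennreal (\<Prod>i<n. g i (\<xi> i)) \<partial>iid \<nu>) = ennreal (\<Prod>i<n. \<integral>s. g i s \<partial>\<nu>)" for n
  proof -
    have "(\<integral>\<^sup>+\<xi>. ennreal (\<Prod>i<n. g i (\<xi> i)) \<partial>iid \<nu>) = (\<integral>\<^sup>+\<xi>. (\<Prod>i<n. ennreal (g i (\<xi> i))) \<partial>iid \<nu>)"
      using r by (subst prod_ennreal) auto
    also have "\<dots> = (\<Prod>i<n. \<integral>\<^sup>+s. ennreal (g i s) \<partial>\<nu>)"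
      by (rule nn_integral_iid_prod[OF \<nu>]) simp
    also have "\<dots> = ennreal (\<Prod>i<n. \<integral>s. g i s \<partial>\<nu>)"
      using prob_space_integral_unit[OF \<nu> g r] by (subst prod_ennreal[symmetric]) auto
    finally show ?thesis .
  qed
  then show "(\<lambda>n. \<integral>\<^sup>+\<xi>. ennreal (\<Prod>i<n. g i (\<xi> i)) \<partial>iid \<nu>) \<longlonglongrightarrow> ennreal (iprod (\<lambda>i. \<integral>s. g i s \<partial>\<nu>))"
    using prob_space_integral_unit(1)[OF \<nu> g r] by (simp add: tendsto_ennrealI iprod_LIMSEQ)
qed

definition wt :: "real \<Rightarrow> real \<Rightarrow> ennreal" where
  "wt \<theta> u = ennreal (u powr (\<theta> - 1) * (exp (- u) - exp (- 2 * u)))"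

lemma measurable_wt [measurable]: "wt \<theta> \<in> borel_measurable borel"
  unfolding wt_def[abs_def] by measurable

text \<open>For \<open>\<theta> = 0\<close> the function \<open>Dfun\<close> is homogeneous only up to an additive constant, which second
  differences cancel.\<close>

definition Ddiff :: "real \<Rightarrow> real \<Rightarrow> real \<Rightarrow> real \<Rightarrow> real \<Rightarrow> real \<Rightarrow> real" where
  "Ddiff \<alpha> \<theta> a b c d = (Dfun \<alpha> \<theta> a - Dfun \<alpha> \<theta> b) - (Dfun \<alpha> \<theta> c - Dfun \<alpha> \<theta> d)"

lemma Ddiff_scale:
  assumes "0 < k" "0 < a" "0 < b" "0 < c" "0 < d"
  shows "Ddiff \<alpha> \<theta> (k * a) (k * b) (k * c) (k * d) = k powr (- \<theta> / \<alpha>) * Ddiff \<alpha> \<theta> a b c d"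
  using assms by (cases "\<theta> = 0") (auto simp: Ddiff_def Dfun_def ln_mult powr_mult algebra_simps diff_divide_distrib add_divide_distrib)

lemma Ddiff_commute: "Ddiff \<alpha> \<theta> a b c d = Ddiff \<alpha> \<theta> a c b d"
  by (simp add: Ddiff_def)

context pd_index
begin

text \<open>Given p the marks average out, so each of the two products obeys the Mellin identity for
  its mean factor. The difference is kept under one integral because it will produce the difference
  of exponentials in \<open>kap\<close> and in the density.\<close>

lemma marked_mellin_identity:
  fixes G1 G2 :: "real \<Rightarrow> 's \<Rightarrow> real"
  assumes \<theta>: "- \<alpha> < \<theta>" and \<nu>: "prob_space \<nu>"
    and G1 [measurable]: "case_prod G1 \<in> borel_measurable (borel \<Otimes>\<^sub>M \<nu>)" and G2 [measurable]: "case_prod G2 \<in> borel_measurable (borel \<Otimes>\<^sub>M \<nu>)"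
    and r: "\<And>x s. G1 x s \<in> {0..1}" "\<And>x s. G2 x s \<in> {0..1}" and le: "\<And>x s. G2 x s \<le> G1 x s"
    and L1: "pd_full \<alpha> (\<lambda>x. \<integral>s. G1 x s \<partial>\<nu>)" and L2: "pd_full \<alpha> (\<lambda>x. \<integral>s. G2 x s \<partial>\<nu>)"
  shows "(\<integral>\<^sup>+u\<in>{0<..}. wt \<theta> u * (\<integral>\<^sup>+q. ennreal (iprod (\<lambda>i. G1 (u * fst q i) (snd q i)) - iprod (\<lambda>i. G2 (u * fst q i) (snd q i))) \<partial>(PD \<alpha> \<theta> \<Otimes>\<^sub>M iid \<nu>)) \<partial>lborel) =
    ennreal (Ddiff \<alpha> \<theta> (Phi \<alpha> (\<lambda>x. \<integral>s. G1 x s \<partial>\<nu>) 1) (Phi \<alpha> (\<lambda>x. \<integral>s. G1 x s \<partial>\<nu>) 2) (Phi \<alpha> (\<lambda>x. \<integral>s. G2 x s \<partial>\<nu>) 1) (Phi \<alpha> (\<lambda>x. \<integral>s. G2 x s \<partial>\<nu>) 2))"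
proof -
  let ?\<rho>1 = "\<lambda>x. \<integral>s. G1 x s \<partial>\<nu>" and ?\<rho>2 = "\<lambda>x. \<integral>s. G2 x s \<partial>\<nu>"
  interpret L1: pd_full \<alpha> ?\<rho>1 by fact
  interpret L2: pd_full \<alpha> ?\<rho>2 by fact
  interpret I: prob_space "iid \<nu>" by (rule prob_space_PiM) (rule \<nu>)
  interpret Q: prob_space "PD \<alpha> \<theta>" by (rule prob_space_PD[OF \<theta>])
  interpret pair_prob_space "PD \<alpha> \<theta>" "iid \<nu>" ..
  note [measurable] = L1.measurable_Psi[OF \<theta>] L2.measurable_Psi[OF \<theta>]
  have m: "(\<lambda>(u, q). G (u * fst q i) (snd q i)) \<in> borel_measurable (borel \<Otimes>\<^sub>M (PD \<alpha> \<theta> \<Otimes>\<^sub>M iid \<nu>))"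
    if [measurable]: "case_prod G \<in> borel_measurable (borel \<Otimes>\<^sub>M \<nu>)" for G :: "real \<Rightarrow> 's \<Rightarrow> real" and i
  proof -
    have "(\<lambda>x. (fst x * fst (snd x) i, snd (snd x) i)) \<in> measurable (borel \<Otimes>\<^sub>M (PD \<alpha> \<theta> \<Otimes>\<^sub>M iid \<nu>)) (borel \<Otimes>\<^sub>M \<nu>)"
      by (intro measurable_Pair borel_measurable_times measurable_fst
        measurable_compose[OF measurable_snd measurable_compose[OF measurable_fst measurable_coordinate_PD]]
        measurable_compose[OF measurable_snd measurable_compose[OF measurable_snd measurable_component_singleton]]) auto
    from measurable_compose[OF this that] show ?thesis by (simp add: split_beta')
  qed
  have mi [measurable]: "(\<lambda>(u, q). iprod (\<lambda>i. G (u * fst q i) (snd q i))) \<in> borel_measurable (borel \<Otimes>\<^sub>M (PD \<alpha> \<theta> \<Otimes>\<^sub>M iid \<nu>))"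
    if "case_prod G \<in> borel_measurable (borel \<Otimes>\<^sub>M \<nu>)" for G :: "real \<Rightarrow> 's \<Rightarrow> real"
    using borel_measurable_iprod[of "\<lambda>x i. G (fst x * fst (snd x) i) (snd (snd x) i)", OF m[OF that, unfolded split_beta']]
    by (simp add: split_beta')
  have mq: "(\<lambda>q. iprod (\<lambda>i. G (u * fst q i) (snd q i))) \<in> borel_measurable (PD \<alpha> \<theta> \<Otimes>\<^sub>M iid \<nu>)"
    if "case_prod G \<in> borel_measurable (borel \<Otimes>\<^sub>M \<nu>)" for G :: "real \<Rightarrow> 's \<Rightarrow> real" and u
    using measurable_compose[OF measurable_Pair1' mi[OF that], of u] by simp
  have E: "(\<integral>\<^sup>+q. ennreal (iprod (\<lambda>i. G (u * fst q i) (snd q i))) \<partial>(PD \<alpha> \<theta> \<Otimes>\<^sub>M iid \<nu>)) = Psi \<alpha> (\<lambda>x. \<integral>s. G x s \<partial>\<nu>) \<theta> u"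
    if G: "case_prod G \<in> borel_measurable (borel \<Otimes>\<^sub>M \<nu>)" and rG: "\<And>x s. G x s \<in> {0..1}" and L: "pd_unit \<alpha> (\<lambda>x. \<integral>s. G x s \<partial>\<nu>)"
    for G :: "real \<Rightarrow> 's \<Rightarrow> real" and u
  proof -
    have Gx: "G x \<in> borel_measurable \<nu>" for x
      using measurable_compose[OF measurable_Pair1' G, of x] by simp
    have "(\<integral>\<^sup>+q. ennreal (iprod (\<lambda>i. G (u * fst q i) (snd q i))) \<partial>(PD \<alpha> \<theta> \<Otimes>\<^sub>M iid \<nu>)) =
       (\<integral>\<^sup>+p. (\<integral>\<^sup>+\<xi>. ennreal (iprod (\<lambda>i. G (u * p i) (\<xi> i))) \<partial>iid \<nu>) \<partial>PD \<alpha> \<theta>)"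
      using mq[OF G] by (subst I.nn_integral_fst[symmetric]) auto
    also have "\<dots> = (\<integral>\<^sup>+p. ennreal (iprod (\<lambda>i. \<integral>s. G (u * p i) s \<partial>\<nu>)) \<partial>PD \<alpha> \<theta>)"
      by (simp add: nn_integral_iid_iprod[OF \<nu> Gx rG])
    also have "\<dots> = Psi \<alpha> (\<lambda>x. \<integral>s. G x s \<partial>\<nu>) \<theta> u"
      by (rule pd_unit.Psi_eq_PD[OF L \<theta>])
    finally show ?thesis .
  qed
  define X where "X u = (\<integral>\<^sup>+q. ennreal (iprod (\<lambda>i. G1 (u * fst q i) (snd q i)) - iprod (\<lambda>i. G2 (u * fst q i) (snd q i))) \<partial>(PD \<alpha> \<theta> \<Otimes>\<^sub>M iid \<nu>))" for u
  have X [measurable]: "X \<in> borel_measurable borel"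
    unfolding X_def[abs_def] using mi[OF G1] mi[OF G2] by measurable
  \<comment> \<open>Additive form; the subtraction is postponed until after the integration, where
    both terms are finite.\<close>
  have "X u + Psi \<alpha> ?\<rho>2 \<theta> u = Psi \<alpha> ?\<rho>1 \<theta> u" for u
  proof -
    have "X u + Psi \<alpha> ?\<rho>2 \<theta> u = (\<integral>\<^sup>+q. ennreal (iprod (\<lambda>i. G1 (u * fst q i) (snd q i)) - iprod (\<lambda>i. G2 (u * fst q i) (snd q i))) + ennreal (iprod (\<lambda>i. G2 (u * fst q i) (snd q i))) \<partial>(PD \<alpha> \<theta> \<Otimes>\<^sub>M iid \<nu>))"
      unfolding X_def E[OF G2 r(2) L2.pd_unit_axioms, symmetric]
      using mq[OF G1, of u] mq[OF G2, of u] by (subst nn_integral_add) auto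
    also have "\<dots> = (\<integral>\<^sup>+q. ennreal (iprod (\<lambda>i. G1 (u * fst q i) (snd q i))) \<partial>(PD \<alpha> \<theta> \<Otimes>\<^sub>M iid \<nu>))"
    proof (rule nn_integral_cong)
      fix q :: "(nat \<Rightarrow> real) \<times> (nat \<Rightarrow> 's)"
      have "iprod (\<lambda>i. G2 (u * fst q i) (snd q i)) \<le> iprod (\<lambda>i. G1 (u * fst q i) (snd q i))"
        by (rule iprod_mono) (use r le in auto)
      moreover have "0 \<le> iprod (\<lambda>i. G2 (u * fst q i) (snd q i))"
        using iprod_range[of "\<lambda>i. G2 (u * fst q i) (snd q i)", OF r(2)] by simp
      ultimately show "ennreal (iprod (\<lambda>i. G1 (u * fst q i) (snd q i)) - iprod (\<lambda>i. G2 (u * fst q i) (snd q i))) + ennreal (iprod (\<lambda>i. G2 (u * fst q i) (snd q i))) = ennreal (iprod (\<lambda>i. G1 (u * fst q i) (snd q i)))"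
        by (subst ennreal_plus[symmetric]) auto
    qed
    also have "\<dots> = Psi \<alpha> ?\<rho>1 \<theta> u" by (rule E[OF G1 r(1) L1.pd_unit_axioms])
    finally show ?thesis .
  qed
  then have "(\<integral>\<^sup>+u\<in>{0<..}. wt \<theta> u * Psi \<alpha> ?\<rho>1 \<theta> u \<partial>lborel) =
     (\<integral>\<^sup>+u. wt \<theta> u * X u * indicator {0<..} u + wt \<theta> u * Psi \<alpha> ?\<rho>2 \<theta> u * indicator {0<..} u \<partial>lborel)"
    by (intro nn_integral_cong) (metis distrib_left distrib_right)
  also have "\<dots> = (\<integral>\<^sup>+u\<in>{0<..}. wt \<theta> u * X u \<partial>lborel) + (\<integral>\<^sup>+u\<in>{0<..}. wt \<theta> u * Psi \<alpha> ?\<rho>2 \<theta> u \<partial>lborel)"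
    by (rule nn_integral_add) measurable
  finally have sum: "(\<integral>\<^sup>+u\<in>{0<..}. wt \<theta> u * X u \<partial>lborel) + ennreal (Dfun \<alpha> \<theta> (Phi \<alpha> ?\<rho>2 1) - Dfun \<alpha> \<theta> (Phi \<alpha> ?\<rho>2 2)) =
     ennreal (Dfun \<alpha> \<theta> (Phi \<alpha> ?\<rho>1 1) - Dfun \<alpha> \<theta> (Phi \<alpha> ?\<rho>1 2))"
    unfolding wt_def L1.mellin_identity[OF \<theta>] L2.mellin_identity[OF \<theta>] by simp
  have "0 \<le> Dfun \<alpha> \<theta> (Phi \<alpha> ?\<rho>2 1) - Dfun \<alpha> \<theta> (Phi \<alpha> ?\<rho>2 2)"
    using L2.Dfun_antimono[OF \<theta>] .
  then have "(\<integral>\<^sup>+u\<in>{0<..}. wt \<theta> u * X u \<partial>lborel) = ennreal (Dfun \<alpha> \<theta> (Phi \<alpha> ?\<rho>1 1) - Dfun \<alpha> \<theta> (Phi \<alpha> ?\<rho>1 2)) - ennreal (Dfun \<alpha> \<theta> (Phi \<alpha> ?\<rho>2 1) - Dfun \<alpha> \<theta> (Phi \<alpha> ?\<rho>2 2))"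
    unfolding sum[symmetric] by simp
  also have "\<dots> = ennreal (Ddiff \<alpha> \<theta> (Phi \<alpha> ?\<rho>1 1) (Phi \<alpha> ?\<rho>1 2) (Phi \<alpha> ?\<rho>2 1) (Phi \<alpha> ?\<rho>2 2))"
    unfolding Ddiff_def using \<open>0 \<le> _\<close> by (rule ennreal_minus)
  finally show ?thesis unfolding X_def .
qed

end

section \<open>Tilting the marks\<close>

text \<open>The infinite product in the statement does not accept the limit 0 of nonzero factors as
  convergence, whereas \<open>iprod\<close> is the plain limit of partial products. The two notions
  meet where this limit is positive.\<close>

lemma prodinf_eq_iprod:
  assumes "\<And>i. a i \<in> {0..1}" "0 < iprod a"
  shows "prodinf a = iprod a"
proof -
  have "(\<lambda>n. \<Prod>i\<le>n. a i) \<longlonglongrightarrow> iprod a"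
    using LIMSEQ_Suc[OF iprod_LIMSEQ[of a, OF assms(1)]] by (simp only: lessThan_Suc_atMost)
  then have "a has_prod iprod a"
    using assms(2) by (auto simp: has_prod_def raw_has_prod_def)
  then show ?thesis using has_prod_unique by metis
qed

lemma ennreal_expectation_defect:
  assumes \<mu>: "prob_space \<mu>" and g: "g \<in> borel_measurable \<mu>" "\<And>s. g s \<in> {0..1::real}" and a: "a \<in> {0..1}" and b: "0 \<le> b"
  shows "ennreal (b * (1 - a * (\<integral>s. g s \<partial>\<mu>))) = (\<integral>\<^sup>+s. ennreal (b * (1 - a * g s)) \<partial>\<mu>)"
proof -
  interpret prob_space \<mu> by fact
  have i: "integrable \<mu> g" by (rule prob_space_integral_unit(3)[OF \<mu> g])
  have "a * g s \<le> 1 * 1" for s using a g(2)[of s] by (intro mult_mono) auto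
  then have "(\<integral>\<^sup>+s. ennreal (b * (1 - a * g s)) \<partial>\<mu>) = ennreal (\<integral>s. b * (1 - a * g s) \<partial>\<mu>)"
    using i b by (intro nn_integral_eq_integral) (auto intro!: mult_nonneg_nonneg)
  also have "(\<integral>s. b * (1 - a * g s) \<partial>\<mu>) = b * (1 - a * (\<integral>s. g s \<partial>\<mu>))"
    using i by (simp add: prob_space)
  finally show ?thesis by simp
qed

locale pd_tilt = pd_index +
  fixes \<nu> :: "'s measure" and f :: "'s \<Rightarrow> real" and c \<theta> :: real
  assumes \<nu>: "prob_space \<nu>" and f_meas [measurable]: "f \<in> borel_measurable \<nu>"
    and c_pos: "0 < c" and f_ge: "\<And>s. c \<le> f s"
    and f_int: "integrable \<nu> (\<lambda>s. f s powr \<alpha>)" and \<theta>: "- \<alpha> < \<theta>"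
begin

sublocale N: prob_space \<nu> by (rule \<nu>)

definition lam :: real where
  "lam = (\<integral>s. f s powr \<alpha> \<partial>\<nu>)"

abbreviation "\<nu>\<^sub>\<alpha> \<equiv> tilted f \<alpha> \<nu>"

lemma f_pos: "0 < f s"
  using f_ge[of s] c_pos by linarith

lemma lam_pos: "0 < lam"
proof -
  have "(\<integral>s. c powr \<alpha> \<partial>\<nu>) \<le> lam"
    unfolding lam_def using f_ge c_pos \<alpha>_pos by (intro integral_mono f_int powr_mono2) auto
  then have "c powr \<alpha> \<le> lam" by (simp add: N.prob_space)
  moreover have "0 < c powr \<alpha>" using c_pos by simp
  ultimately show ?thesis by linarith
qed

lemma sets_tilted [simp, measurable_cong]: "sets \<nu>\<^sub>\<alpha> = sets \<nu>"
  by (simp add: tilted_def)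

lemma nn_integral_tilted:
  assumes [measurable]: "g \<in> borel_measurable \<nu>"
  shows "(\<integral>\<^sup>+s. g s \<partial>\<nu>\<^sub>\<alpha>) = (\<integral>\<^sup>+s. ennreal (f s powr \<alpha> / lam) * g s \<partial>\<nu>)"
  unfolding tilted_def lam_def by (subst nn_integral_density) auto

lemma prob_space_tilted: "prob_space \<nu>\<^sub>\<alpha>"
proof
  have "emeasure \<nu>\<^sub>\<alpha> (space \<nu>\<^sub>\<alpha>) = (\<integral>\<^sup>+s. 1 \<partial>\<nu>\<^sub>\<alpha>)" by simp
  also have "\<dots> = (\<integral>\<^sup>+s. ennreal (f s powr \<alpha> / lam) \<partial>\<nu>)" by (subst nn_integral_tilted) auto
  also have "\<dots> = ennreal (\<integral>s. f s powr \<alpha> / lam \<partial>\<nu>)"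
    using f_int lam_pos by (intro nn_integral_eq_integral) auto
  also have "(\<integral>s. f s powr \<alpha> / lam \<partial>\<nu>) = 1" using lam_pos by (simp add: lam_def)
  finally show "emeasure \<nu>\<^sub>\<alpha> (space \<nu>\<^sub>\<alpha>) = 1" by simp
qed

sublocale A: prob_space "\<nu>\<^sub>\<alpha>" by (rule prob_space_tilted)

text \<open>Dividing by f undoes the rescaling in \<open>S_map\<close>. The lower bound c on f makes
  the series converge for every p in \<open>nabla\<close>, with T \<le> 1 / c.\<close>

definition T :: "(nat \<Rightarrow> real) \<Rightarrow> (nat \<Rightarrow> 's) \<Rightarrow> real" where
  "T p \<xi> = (\<Sum>i. inverse (f (\<xi> i)) * p i)"

lemma T_summable:
  assumes "p \<in> nabla"
  shows "summable (\<lambda>i. inverse (f (\<xi> i)) * p i)"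
proof (rule summable_comparison_test)
  have "inverse (f s) \<le> inverse c" for s using f_ge[of s] c_pos by (simp add: le_imp_inverse_le)
  then show "\<exists>N. \<forall>n\<ge>N. norm (inverse (f (\<xi> n)) * p n) \<le> inverse c * p n"
    using assms f_pos by (auto simp: nabla_def abs_mult less_imp_le intro!: mult_right_mono)
  show "summable (\<lambda>n. inverse c * p n)"
    using assms by (intro summable_mult) (auto simp: nabla_def sums_iff)
qed

lemma T_pos:
  assumes p: "p \<in> nabla"
  shows "0 < T p \<xi>"
proof -
  obtain i where i: "p i \<noteq> 0"
  proof (rule ccontr)
    assume "\<not> thesis"
    then have "p = (\<lambda>_. 0)" using that by auto
    then show False using p by (simp add: nabla_def sums_iff)
  qed
  then have "0 < p i" using p by (auto simp: nabla_def less_le)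
  then show ?thesis
    unfolding T_def using T_summable[OF p] p f_pos by (intro suminf_pos2[of _ i]) (auto simp: nabla_def less_imp_le)
qed

lemma T_le:
  assumes p: "p \<in> nabla"
  shows "T p \<xi> \<le> 1 / c"
proof -
  have "inverse (f s) \<le> inverse c" for s using f_ge[of s] c_pos by (simp add: le_imp_inverse_le)
  then have "T p \<xi> \<le> (\<Sum>i. inverse c * p i)"
    unfolding T_def using T_summable[OF p] p
    by (intro suminf_le) (auto simp: nabla_def sums_iff intro!: mult_right_mono summable_mult)
  also have "\<dots> = 1 / c" using p by (subst suminf_mult) (auto simp: nabla_def sums_iff inverse_eq_divide)
  finally show ?thesis .
qed

lemma measurable_T [measurable]: "T p \<in> borel_measurable (iid \<nu>\<^sub>\<alpha>)"
  unfolding T_def[abs_def] by measurable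

text \<open>By independence the product of means is the mean of exp(-u T). Since T \<le> 1 / c, it
  is at least exp(-u / c), so the product converges in the strict sense.\<close>

lemma iprod_expectation:
  assumes p: "p \<in> nabla" and u: "0 \<le> u"
  shows "(\<Prod>i. \<integral>s. exp (- u * inverse (f s) * p i) \<partial>\<nu>\<^sub>\<alpha>) = (\<integral>\<xi>. exp (- u * T p \<xi>) \<partial>iid \<nu>\<^sub>\<alpha>)"
proof -
  interpret I: prob_space "iid \<nu>\<^sub>\<alpha>" by (rule prob_space_PiM) (rule prob_space_tilted)
  let ?a = "\<lambda>i. \<integral>s. exp (- u * inverse (f s) * p i) \<partial>\<nu>\<^sub>\<alpha>"
  have r: "exp (- u * inverse (f s) * p i) \<in> {0..1}" for s i
    using p u f_pos[of s] by (auto simp: nabla_def less_imp_le)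
  have m: "(\<lambda>s. exp (- u * inverse (f s) * p i)) \<in> borel_measurable \<nu>\<^sub>\<alpha>" for i by measurable
  have rT: "exp (- u * T p \<xi>) \<in> {0..1}" for \<xi> using u T_pos[OF p, of \<xi>] by auto
  have mT: "(\<lambda>\<xi>. exp (- u * T p \<xi>)) \<in> borel_measurable (iid \<nu>\<^sub>\<alpha>)" by measurable
  note iT = prob_space_integral_unit[OF I.prob_space_axioms mT rT]
  have "iprod (\<lambda>i. exp (- u * inverse (f (\<xi> i)) * p i)) = exp (- u * T p \<xi>)" for \<xi>
    using iprod_exp_summable[OF summable_mult[OF T_summable[OF p, of \<xi>], of u]] T_summable[OF p, of \<xi>]
    by (simp add: T_def suminf_mult mult.assoc)
  then have "ennreal (iprod ?a) = (\<integral>\<^sup>+\<xi>. ennreal (exp (- u * T p \<xi>)) \<partial>iid \<nu>\<^sub>\<alpha>)"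
    using nn_integral_iid_iprod[OF prob_space_tilted, of "\<lambda>i s. exp (- u * inverse (f s) * p i)", OF m r] by simp
  also have "\<dots> = ennreal (\<integral>\<xi>. exp (- u * T p \<xi>) \<partial>iid \<nu>\<^sub>\<alpha>)" by (rule iT(2))
  finally have eq: "iprod ?a = (\<integral>\<xi>. exp (- u * T p \<xi>) \<partial>iid \<nu>\<^sub>\<alpha>)"
    using iT(1) iprod_range[of ?a, OF prob_space_integral_unit(1)[OF prob_space_tilted m r]] by simp
  have "(\<integral>\<xi>. exp (- u * (1 / c)) \<partial>iid \<nu>\<^sub>\<alpha>) \<le> (\<integral>\<xi>. exp (- u * T p \<xi>) \<partial>iid \<nu>\<^sub>\<alpha>)"
  proof (rule integral_mono)
    show "exp (- u * (1 / c)) \<le> exp (- u * T p \<xi>)" for \<xi>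
      using mult_left_mono[OF T_le[OF p, of \<xi>] u] by simp
  qed (use iT(3) in auto)
  then have "exp (- u * (1 / c)) \<le> iprod ?a" unfolding eq by (simp add: I.prob_space)
  then have "0 < iprod ?a" by (rule less_le_trans[rotated]) simp
  then show ?thesis
    using prodinf_eq_iprod[of ?a, OF prob_space_integral_unit(1)[OF prob_space_tilted m r]] eq by simp
qed

text \<open>For fixed marks the expression with exp(-u T) equals T^(-\<theta>) in all three cases:
  by the Gamma integral, trivially, and by its continuation with 1 - exp(-u T). Tonelli moves the
  mean over the marks outside.\<close>

lemma gamma_mellin_expectation:
  assumes p: "p \<in> nabla"
  shows "gamma_mellin \<theta> (\<lambda>u. \<Prod>i. \<integral>s. exp (- u * inverse (f s) * p i) \<partial>\<nu>\<^sub>\<alpha>) = (\<integral>\<^sup>+\<xi>. ennreal (T p \<xi> powr (- \<theta>)) \<partial>iid \<nu>\<^sub>\<alpha>)"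
proof -
  interpret I: prob_space "iid \<nu>\<^sub>\<alpha>" by (rule prob_space_PiM) (rule prob_space_tilted)
  interpret pair_sigma_finite lborel "iid \<nu>\<^sub>\<alpha>" ..
  let ?\<phi> = "\<lambda>u. \<Prod>i. \<integral>s. exp (- u * inverse (f s) * p i) \<partial>\<nu>\<^sub>\<alpha>"
  have rT: "exp (- u * T p \<xi>) \<in> {0..1}" if "0 \<le> u" for u \<xi> using that T_pos[OF p, of \<xi>] by auto
  have mT: "(\<lambda>\<xi>. exp (- u * T p \<xi>)) \<in> borel_measurable (iid \<nu>\<^sub>\<alpha>)" for u by measurable
  have \<phi>0: "?\<phi> 0 = 1" using iprod_expectation[OF p, of 0] by (simp add: I.prob_space)
  consider "0 < \<theta>" | "\<theta> = 0" | "\<theta> < 0" by linarith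
  then show ?thesis
  proof cases
    case 1
    have g: "0 < Gamma \<theta>" using 1 by (rule Gamma_real_pos)
    have "(\<integral>\<^sup>+u\<in>{0<..}. ennreal (u powr (\<theta> - 1) * ?\<phi> u) \<partial>lborel) =
      (\<integral>\<^sup>+u. (\<integral>\<^sup>+\<xi>. ennreal (u powr (\<theta> - 1) * exp (- T p \<xi> * u)) * indicator {0<..} u \<partial>iid \<nu>\<^sub>\<alpha>) \<partial>lborel)"
    proof (rule nn_integral_cong)
      fix u :: real
      show "ennreal (u powr (\<theta> - 1) * ?\<phi> u) * indicator {0<..} u = (\<integral>\<^sup>+\<xi>. ennreal (u powr (\<theta> - 1) * exp (- T p \<xi> * u)) * indicator {0<..} u \<partial>iid \<nu>\<^sub>\<alpha>)"
      proof (cases "0 < u")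
        case True
        then have u: "0 \<le> u" by simp
        have "ennreal (u powr (\<theta> - 1) * ?\<phi> u) = ennreal (u powr (\<theta> - 1)) * (\<integral>\<^sup>+\<xi>. ennreal (exp (- u * T p \<xi>)) \<partial>iid \<nu>\<^sub>\<alpha>)"
          using prob_space_integral_unit[OF I.prob_space_axioms mT rT[OF u]]
          by (simp only: iprod_expectation[OF p u]) (simp add: ennreal_mult)
        also have "\<dots> = (\<integral>\<^sup>+\<xi>. ennreal (u powr (\<theta> - 1)) * ennreal (exp (- u * T p \<xi>)) \<partial>iid \<nu>\<^sub>\<alpha>)"
          by (rule nn_integral_cmult[symmetric]) measurable
        finally show ?thesis using True by (simp add: ennreal_mult mult.commute)
      qed simp
    qed
    also have "\<dots> = (\<integral>\<^sup>+\<xi>. (\<integral>\<^sup>+u. ennreal (u powr (\<theta> - 1) * exp (- T p \<xi> * u)) * indicator {0<..} u \<partial>lborel) \<partial>iid \<nu>\<^sub>\<alpha>)"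
      by (rule Fubini'[symmetric]) measurable
    also have "\<dots> = (\<integral>\<^sup>+\<xi>. ennreal (Gamma \<theta>) * ennreal (T p \<xi> powr (- \<theta>)) \<partial>iid \<nu>\<^sub>\<alpha>)"
      using nn_integral_Gamma[OF 1 T_pos[OF p]] g by (simp add: ennreal_mult)
    also have "\<dots> = ennreal (Gamma \<theta>) * (\<integral>\<^sup>+\<xi>. ennreal (T p \<xi> powr (- \<theta>)) \<partial>iid \<nu>\<^sub>\<alpha>)"
      by (rule nn_integral_cmult) measurable
    finally have "gamma_mellin \<theta> ?\<phi> = ennreal (1 / Gamma \<theta>) * (ennreal (Gamma \<theta>) * (\<integral>\<^sup>+\<xi>. ennreal (T p \<xi> powr (- \<theta>)) \<partial>iid \<nu>\<^sub>\<alpha>))"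
      unfolding gamma_mellin_def using 1 by simp
    also have "ennreal (1 / Gamma \<theta>) * ennreal (Gamma \<theta>) = 1"
      using g by (subst ennreal_mult[symmetric]) auto
    then have "ennreal (1 / Gamma \<theta>) * (ennreal (Gamma \<theta>) * (\<integral>\<^sup>+\<xi>. ennreal (T p \<xi> powr (- \<theta>)) \<partial>iid \<nu>\<^sub>\<alpha>)) = (\<integral>\<^sup>+\<xi>. ennreal (T p \<xi> powr (- \<theta>)) \<partial>iid \<nu>\<^sub>\<alpha>)"
      by (simp only: mult.assoc[symmetric] mult_1_left)
    finally show ?thesis .
  next
    case 2
    have "T p \<xi> powr (- \<theta>) = 1" for \<xi> using T_pos[OF p, of \<xi>] 2 by simp
    then show ?thesis using 2 \<phi>0 by (simp add: gamma_mellin_def I.emeasure_space_1)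
  next
    case 3
    have \<theta>1: "- 1 < \<theta>" using \<theta> \<alpha>_less_1 by linarith
    have "\<theta> \<notin> \<int>\<^sub>\<le>\<^sub>0" using 3 \<theta>1 by (auto elim!: nonpos_Ints_cases)
    then have g: "Gamma (\<theta> + 1) = \<theta> * Gamma \<theta>" by (rule Gamma_plus1)
    have g1: "0 < Gamma (\<theta> + 1)" using \<theta>1 by (intro Gamma_real_pos) auto
    then have g2: "Gamma \<theta> < 0" using g 3 by (simp add: zero_less_mult_iff)
    \<comment> \<open>\<open>Gamma \<theta>\<close> is negative on (-1, 0), so both factors of the
      continued integral appear with reversed sign.\<close>
    have g3: "Gamma (\<theta> + 1) / (- \<theta>) = - Gamma \<theta>" using g 3 by simp
    have "(\<integral>\<^sup>+u\<in>{0<..}. ennreal (u powr (\<theta> - 1) * (?\<phi> 0 - ?\<phi> u)) \<partial>lborel) =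
      (\<integral>\<^sup>+u. (\<integral>\<^sup>+\<xi>. ennreal (u powr (\<theta> - 1) * (1 - exp (- T p \<xi> * u))) * indicator {0<..} u \<partial>iid \<nu>\<^sub>\<alpha>) \<partial>lborel)"
    proof (rule nn_integral_cong)
      fix u :: real
      show "ennreal (u powr (\<theta> - 1) * (?\<phi> 0 - ?\<phi> u)) * indicator {0<..} u = (\<integral>\<^sup>+\<xi>. ennreal (u powr (\<theta> - 1) * (1 - exp (- T p \<xi> * u))) * indicator {0<..} u \<partial>iid \<nu>\<^sub>\<alpha>)"
      proof (cases "0 < u")
        case True
        then have u: "0 \<le> u" by simp
        have "ennreal (u powr (\<theta> - 1) * (1 - 1 * (\<integral>\<xi>. exp (- u * T p \<xi>) \<partial>iid \<nu>\<^sub>\<alpha>))) = (\<integral>\<^sup>+\<xi>. ennreal (u powr (\<theta> - 1) * (1 - 1 * exp (- u * T p \<xi>))) \<partial>iid \<nu>\<^sub>\<alpha>)"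
          by (rule ennreal_expectation_defect[OF I.prob_space_axioms mT rT[OF u]]) auto
        then show ?thesis using True \<phi>0 iprod_expectation[OF p u] by (simp add: mult.commute)
      qed simp
    qed
    also have "\<dots> = (\<integral>\<^sup>+\<xi>. (\<integral>\<^sup>+u. ennreal (u powr (\<theta> - 1) * (1 - exp (- T p \<xi> * u))) * indicator {0<..} u \<partial>lborel) \<partial>iid \<nu>\<^sub>\<alpha>)"
      by (rule Fubini'[symmetric]) measurable
    also have "\<dots> = (\<integral>\<^sup>+\<xi>. ennreal (- Gamma \<theta>) * ennreal (T p \<xi> powr (- \<theta>)) \<partial>iid \<nu>\<^sub>\<alpha>)"
      using nn_integral_one_minus_exp[OF \<theta>1 3 less_imp_le[OF T_pos[OF p]]] g2
      by (simp only: g3) (subst ennreal_mult[symmetric], auto)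
    also have "\<dots> = ennreal (- Gamma \<theta>) * (\<integral>\<^sup>+\<xi>. ennreal (T p \<xi> powr (- \<theta>)) \<partial>iid \<nu>\<^sub>\<alpha>)"
      by (rule nn_integral_cmult) measurable
    finally have "gamma_mellin \<theta> ?\<phi> = ennreal (- 1 / Gamma \<theta>) * (ennreal (- Gamma \<theta>) * (\<integral>\<^sup>+\<xi>. ennreal (T p \<xi> powr (- \<theta>)) \<partial>iid \<nu>\<^sub>\<alpha>))"
      unfolding gamma_mellin_def using 3 by simp
    also have "ennreal (- 1 / Gamma \<theta>) * ennreal (- Gamma \<theta>) = 1"
      using g2 by (subst ennreal_mult[symmetric]) (auto simp: divide_nonpos_neg)
    then have "ennreal (- 1 / Gamma \<theta>) * (ennreal (- Gamma \<theta>) * (\<integral>\<^sup>+\<xi>. ennreal (T p \<xi> powr (- \<theta>)) \<partial>iid \<nu>\<^sub>\<alpha>)) = (\<integral>\<^sup>+\<xi>. ennreal (T p \<xi> powr (- \<theta>)) \<partial>iid \<nu>\<^sub>\<alpha>)"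
      by (simp only: mult.assoc[symmetric] mult_1_left)
    finally show ?thesis .
  qed
qed

end

text \<open>\<open>GL\<close> and \<open>GR\<close> are the factors contributed by a single atom to the test functionals of the
  image law and of the density, respectively. The absolute values only serve to keep them bounded
  on the negative axis.\<close>

locale pd_test = pd_tilt \<alpha> \<nu> f c \<theta> + R: pd_lip \<alpha> \<rho> C
  for \<alpha> and \<nu> :: "'s measure" and f c \<theta> and \<rho> :: "real \<Rightarrow> real" and C +
  assumes \<rho>_0: "\<rho> 0 = 1"
begin

definition GL :: "real \<Rightarrow> real \<Rightarrow> real \<Rightarrow> 's \<Rightarrow> real" where
  "GL k s x \<xi> = exp (- k * \<bar>s * f \<xi> * x\<bar>) * \<rho> (s * f \<xi> * x)"

definition GR :: "real \<Rightarrow> real \<Rightarrow> real \<Rightarrow> 's \<Rightarrow> real" where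
  "GR j r x \<xi> = \<rho> x * exp (- j * \<bar>r * x / f \<xi>\<bar>)"

lemma GL_range: "0 \<le> k \<Longrightarrow> GL k s x \<xi> \<in> {0..1}"
  using R.\<rho>_range[of "s * f \<xi> * x"] by (auto simp: GL_def intro!: mult_le_one)

lemma GR_range: "0 \<le> j \<Longrightarrow> GR j r x \<xi> \<in> {0..1}"
  using R.\<rho>_range[of x] by (auto simp: GR_def intro!: mult_le_one)

lemma measurable_GL [measurable]: "case_prod (GL k s) \<in> borel_measurable (borel \<Otimes>\<^sub>M \<nu>)"
  unfolding GL_def[abs_def] by measurable

lemma measurable_GR [measurable]: "case_prod (GR j r) \<in> borel_measurable (borel \<Otimes>\<^sub>M \<nu>)"
  unfolding GR_def[abs_def] by measurable

lemma measurable_GL1: "GL k s x \<in> borel_measurable \<nu>"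
  unfolding GL_def[abs_def] by measurable

lemma measurable_GR1: "GR j r x \<in> borel_measurable \<nu>\<^sub>\<alpha>"
  unfolding GR_def[abs_def] by measurable

definition rhoL :: "real \<Rightarrow> real \<Rightarrow> real \<Rightarrow> real" where
  "rhoL k s x = (\<integral>\<xi>. GL k s x \<xi> \<partial>\<nu>)"

definition rhoR :: "real \<Rightarrow> real \<Rightarrow> real \<Rightarrow> real" where
  "rhoR j r x = (\<integral>\<xi>. GR j r x \<xi> \<partial>\<nu>\<^sub>\<alpha>)"

text \<open>For a fixed mark, substituting y = s f(\<xi>) x pulls out (s f(\<xi>))^\<alpha>, and the
  weight f^\<alpha> turns \<open>\<nu>\<close> into \<open>lam\<close> times the tilted law. The
  factor exp(-k y) detaches from the mark while exp(-j x) attaches to it, so j and k exchange roles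
  and s becomes 1/s.\<close>

lemma levy_int_scale:
  assumes j: "0 < j" and k: "0 < k" and s: "0 < s"
  shows "levy_int \<alpha> (\<lambda>x. exp (- j * x) * rhoL k s x) = ennreal (lam * s powr \<alpha>) * levy_int \<alpha> (\<lambda>x. exp (- k * x) * rhoR j (1 / s) x)"
proof -
  interpret P: pair_sigma_finite lborel \<nu> ..
  let ?K = "\<lambda>\<xi>. \<integral>\<^sup>+y\<in>{0<..}. ennreal (y powr (- \<alpha> - 1) * (1 - exp (- k * y) * GR j (1 / s) y \<xi>)) \<partial>lborel"
  have mK [measurable]: "?K \<in> borel_measurable \<nu>"
    unfolding GR_def by measurable
  have "levy_int \<alpha> (\<lambda>x. exp (- j * x) * rhoL k s x) =
     (\<integral>\<^sup>+x. (\<integral>\<^sup>+\<xi>. ennreal (x powr (- \<alpha> - 1) * (1 - exp (- j * x) * GL k s x \<xi>)) * indicator {0<..} x \<partial>\<nu>) \<partial>lborel)"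
    unfolding levy_int_def
  proof (rule nn_integral_cong)
    fix x :: real
    show "ennreal (x powr (- \<alpha> - 1) * (1 - exp (- j * x) * rhoL k s x)) * indicator {0<..} x =
       (\<integral>\<^sup>+\<xi>. ennreal (x powr (- \<alpha> - 1) * (1 - exp (- j * x) * GL k s x \<xi>)) * indicator {0<..} x \<partial>\<nu>)"
    proof (cases "0 < x")
      case True
      then show ?thesis unfolding rhoL_def
        using ennreal_expectation_defect[OF \<nu> measurable_GL1 GL_range, of k "exp (- j * x)" "x powr (- \<alpha> - 1)" s x] j k by simp
    qed simp
  qed
  also have "\<dots> = (\<integral>\<^sup>+\<xi>. (\<integral>\<^sup>+x. ennreal (x powr (- \<alpha> - 1) * (1 - exp (- j * x) * GL k s x \<xi>)) * indicator {0<..} x \<partial>lborel) \<partial>\<nu>)"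
    unfolding GL_def by (rule P.Fubini'[symmetric]) measurable
  also have "\<dots> = (\<integral>\<^sup>+\<xi>. ennreal ((s * f \<xi>) powr \<alpha>) * ?K \<xi> \<partial>\<nu>)"
  proof (rule nn_integral_cong)
    fix \<xi>
    have sf: "0 < s * f \<xi>" using s f_pos[of \<xi>] by simp
    have "(\<integral>\<^sup>+x\<in>{0<..}. ennreal (x powr (- \<alpha> - 1) * (1 - exp (- j * x) * GL k s x \<xi>)) \<partial>lborel) =
       ennreal (1 / (s * f \<xi>)) * (\<integral>\<^sup>+y\<in>{0<..}. ennreal ((1 / (s * f \<xi>) * y) powr (- \<alpha> - 1) * (1 - exp (- j * (1 / (s * f \<xi>) * y)) * GL k s (1 / (s * f \<xi>) * y) \<xi>)) \<partial>lborel)"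
      unfolding GL_def by (rule nn_integral_scale_pos) (use sf in auto)
    also have "(\<integral>\<^sup>+y\<in>{0<..}. ennreal ((1 / (s * f \<xi>) * y) powr (- \<alpha> - 1) * (1 - exp (- j * (1 / (s * f \<xi>) * y)) * GL k s (1 / (s * f \<xi>) * y) \<xi>)) \<partial>lborel) =
       (\<integral>\<^sup>+y. ennreal ((1 / (s * f \<xi>)) powr (- \<alpha> - 1)) * (ennreal (y powr (- \<alpha> - 1) * (1 - exp (- k * y) * GR j (1 / s) y \<xi>)) * indicator {0<..} y) \<partial>lborel)"
    proof (rule nn_integral_cong)
      fix y :: real
      show "ennreal ((1 / (s * f \<xi>) * y) powr (- \<alpha> - 1) * (1 - exp (- j * (1 / (s * f \<xi>) * y)) * GL k s (1 / (s * f \<xi>) * y) \<xi>)) * indicator {0<..} y =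
         ennreal ((1 / (s * f \<xi>)) powr (- \<alpha> - 1)) * (ennreal (y powr (- \<alpha> - 1) * (1 - exp (- k * y) * GR j (1 / s) y \<xi>)) * indicator {0<..} y)"
      proof (cases "0 < y")
        case True
        have 1: "s * f \<xi> * (1 / (s * f \<xi>) * y) = y" using s f_pos[of \<xi>] by simp
        have "0 \<le> 1 / s * y / f \<xi>" using True s f_pos[of \<xi>] by simp
        then have "\<bar>1 / s * y / f \<xi>\<bar> = 1 / s * y / f \<xi>" by (rule abs_of_nonneg)
        also have "\<dots> = 1 / (s * f \<xi>) * y" by simp
        finally have 2: "\<bar>1 / s * y / f \<xi>\<bar> = 1 / (s * f \<xi>) * y" .
        have "exp (- j * (1 / (s * f \<xi>) * y)) * GL k s (1 / (s * f \<xi>) * y) \<xi> = exp (- k * y) * GR j (1 / s) y \<xi>"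
          unfolding GL_def GR_def 1 2 using True by simp
        moreover have "(1 / (s * f \<xi>) * y) powr (- \<alpha> - 1) = (1 / (s * f \<xi>)) powr (- \<alpha> - 1) * y powr (- \<alpha> - 1)"
          by (rule powr_mult)
        ultimately show ?thesis using True by (simp add: ennreal_mult'[symmetric] mult.assoc)
      qed simp
    qed
    also have "\<dots> = ennreal ((1 / (s * f \<xi>)) powr (- \<alpha> - 1)) * ?K \<xi>"
      unfolding GR_def by (rule nn_integral_cmult) measurable
    finally have "(\<integral>\<^sup>+x\<in>{0<..}. ennreal (x powr (- \<alpha> - 1) * (1 - exp (- j * x) * GL k s x \<xi>)) \<partial>lborel) =
       ennreal (1 / (s * f \<xi>)) * (ennreal ((1 / (s * f \<xi>)) powr (- \<alpha> - 1)) * ?K \<xi>)" .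
    moreover have "ennreal (1 / (s * f \<xi>)) * ennreal ((1 / (s * f \<xi>)) powr (- \<alpha> - 1)) = ennreal ((s * f \<xi>) powr \<alpha>)"
    proof -
      have "1 / (s * f \<xi>) * (1 / (s * f \<xi>)) powr (- \<alpha> - 1) = (1 / (s * f \<xi>)) powr (1 + (- \<alpha> - 1))"
        using sf by (subst powr_add) simp
      also have "\<dots> = (s * f \<xi>) powr \<alpha>" using sf by (simp add: powr_divide powr_minus_divide)
      finally show ?thesis using sf by (simp add: ennreal_mult'[symmetric])
    qed
    ultimately show "(\<integral>\<^sup>+x\<in>{0<..}. ennreal (x powr (- \<alpha> - 1) * (1 - exp (- j * x) * GL k s x \<xi>)) \<partial>lborel) = ennreal ((s * f \<xi>) powr \<alpha>) * ?K \<xi>"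
      by (simp only: mult.assoc[symmetric])
  qed
  also have "\<dots> = (\<integral>\<^sup>+\<xi>. ennreal (lam * s powr \<alpha>) * (ennreal (f \<xi> powr \<alpha> / lam) * ?K \<xi>) \<partial>\<nu>)"
  proof (rule nn_integral_cong)
    fix \<xi>
    have "(s * f \<xi>) powr \<alpha> = lam * s powr \<alpha> * (f \<xi> powr \<alpha> / lam)"
      using s f_pos[of \<xi>] lam_pos by (simp add: powr_mult)
    then have "ennreal ((s * f \<xi>) powr \<alpha>) = ennreal (lam * s powr \<alpha>) * ennreal (f \<xi> powr \<alpha> / lam)"
      using lam_pos by (simp only: ennreal_mult'[symmetric]) (subst ennreal_mult[symmetric], auto)
    then show "ennreal ((s * f \<xi>) powr \<alpha>) * ?K \<xi> = ennreal (lam * s powr \<alpha>) * (ennreal (f \<xi> powr \<alpha> / lam) * ?K \<xi>)"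
      by (simp only: mult.assoc)
  qed
  also have "\<dots> = ennreal (lam * s powr \<alpha>) * (\<integral>\<^sup>+\<xi>. ?K \<xi> \<partial>\<nu>\<^sub>\<alpha>)"
    by (subst nn_integral_cmult) (auto simp: nn_integral_tilted)
  also have "(\<integral>\<^sup>+\<xi>. ?K \<xi> \<partial>\<nu>\<^sub>\<alpha>) = (\<integral>\<^sup>+y. (\<integral>\<^sup>+\<xi>. ennreal (y powr (- \<alpha> - 1) * (1 - exp (- k * y) * GR j (1 / s) y \<xi>)) * indicator {0<..} y \<partial>\<nu>\<^sub>\<alpha>) \<partial>lborel)"
  proof -
    interpret Q: pair_sigma_finite lborel \<nu>\<^sub>\<alpha> ..
    show ?thesis unfolding GR_def by (rule Q.Fubini') measurable
  qed
  also have "\<dots> = levy_int \<alpha> (\<lambda>x. exp (- k * x) * rhoR j (1 / s) x)"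
    unfolding levy_int_def
  proof (rule nn_integral_cong)
    fix x :: real
    show "(\<integral>\<^sup>+\<xi>. ennreal (x powr (- \<alpha> - 1) * (1 - exp (- k * x) * GR j (1 / s) x \<xi>)) * indicator {0<..} x \<partial>\<nu>\<^sub>\<alpha>) =
       ennreal (x powr (- \<alpha> - 1) * (1 - exp (- k * x) * rhoR j (1 / s) x)) * indicator {0<..} x"
    proof (cases "0 < x")
      case True
      then show ?thesis unfolding rhoR_def
        using ennreal_expectation_defect[OF prob_space_tilted measurable_GR1 GR_range, of j "exp (- k * x)" "x powr (- \<alpha> - 1)" "1 / s" x] j k by simp
    qed simp
  qed
  finally show ?thesis .
qed

text \<open>Since f \<ge> c, the extra exponential is at least exp(-(j r / c) x), which allows a
  comparison with \<rho> at the larger rate \<open>\<kappa>\<close>. On the side of the image law f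
  may be unbounded, and finiteness is transported by \<open>levy_int_scale\<close>.\<close>

lemma levy_int_rhoR_finite:
  assumes j: "0 < j" and k: "0 < k" and r: "0 < r"
  shows "levy_int \<alpha> (\<lambda>x. exp (- k * x) * rhoR j r x) < \<infinity>"
proof -
  define \<kappa> where "\<kappa> = k + j * r / c"
  have \<kappa>: "0 < \<kappa>" using j k r c_pos by (simp add: \<kappa>_def add_pos_pos)
  have "levy_int \<alpha> (\<lambda>x. exp (- k * x) * rhoR j r x) \<le> levy_int \<alpha> (\<lambda>x. exp (- \<kappa> * x) * \<rho> x)"
    unfolding levy_int_def
  proof (rule nn_integral_mono)
    fix x :: real
    show "ennreal (x powr (- \<alpha> - 1) * (1 - exp (- k * x) * rhoR j r x)) * indicator {0<..} x \<le>
      ennreal (x powr (- \<alpha> - 1) * (1 - exp (- \<kappa> * x) * \<rho> x)) * indicator {0<..} x"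
    proof (cases "0 < x")
      case True
      have "\<rho> x * exp (- (j * r / c) * x) \<le> GR j r x \<xi>" for \<xi>
      proof -
        have a: "\<bar>r * x / f \<xi>\<bar> = r * x / f \<xi>" using True r f_pos[of \<xi>] by simp
        have "r * x / f \<xi> \<le> r * x / c" using True r f_ge[of \<xi>] c_pos by (intro divide_left_mono) auto
        then have "j * (r * x / f \<xi>) \<le> j * (r * x / c)" using j by (intro mult_left_mono) auto
        then have "exp (- (j * r / c) * x) \<le> exp (- j * \<bar>r * x / f \<xi>\<bar>)" unfolding a by (simp add: mult.assoc)
        then show ?thesis unfolding GR_def using R.\<rho>_nonneg by (intro mult_left_mono) auto
      qed
      then have "(\<integral>\<xi>. \<rho> x * exp (- (j * r / c) * x) \<partial>\<nu>\<^sub>\<alpha>) \<le> rhoR j r x"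
        unfolding rhoR_def using prob_space_integral_unit(3)[OF prob_space_tilted measurable_GR1 GR_range] j
        by (intro integral_mono) auto
      then have "\<rho> x * exp (- (j * r / c) * x) \<le> rhoR j r x" by (simp add: A.prob_space)
      then have "exp (- k * x) * (\<rho> x * exp (- (j * r / c) * x)) \<le> exp (- k * x) * rhoR j r x"
        by (intro mult_left_mono) auto
      also have "exp (- k * x) * (\<rho> x * exp (- (j * r / c) * x)) = exp (- \<kappa> * x) * \<rho> x"
        unfolding \<kappa>_def by (simp add: exp_add[symmetric] algebra_simps)
      finally have "x powr (- \<alpha> - 1) * (1 - exp (- k * x) * rhoR j r x) \<le> x powr (- \<alpha> - 1) * (1 - exp (- \<kappa> * x) * \<rho> x)"
        by (intro mult_left_mono diff_left_mono) auto
      then show ?thesis using True by (simp add: ennreal_leI)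
    qed simp
  qed
  also have "\<dots> < \<infinity>" by (rule R.levy_finite[OF \<kappa>])
  finally show ?thesis .
qed

lemma pd_full_rhoR:
  assumes j: "0 < j" and r: "0 < r"
  shows "pd_full \<alpha> (rhoR j r)"
proof
  show "rhoR j r \<in> borel_measurable borel"
    unfolding rhoR_def[abs_def] using measurable_GR by (intro A.borel_measurable_lebesgue_integral) simp
  show "rhoR j r x \<in> {0..1}" for x
    unfolding rhoR_def by (rule prob_space_integral_unit(1)[OF prob_space_tilted measurable_GR1 GR_range]) (use j in simp)
  show "rhoR j r 0 = 1" by (simp add: rhoR_def GR_def \<rho>_0 A.prob_space)
  show "levy_int \<alpha> (\<lambda>x. exp (- s * x) * rhoR j r x) < \<infinity>" if "0 < s" for s
    by (rule levy_int_rhoR_finite[OF j that r])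
qed

lemma pd_full_rhoL:
  assumes k: "0 < k" and s: "0 < s"
  shows "pd_full \<alpha> (rhoL k s)"
proof
  show "rhoL k s \<in> borel_measurable borel"
    unfolding rhoL_def[abs_def] using measurable_GL by (intro N.borel_measurable_lebesgue_integral) simp
  show "rhoL k s x \<in> {0..1}" for x
    unfolding rhoL_def by (rule prob_space_integral_unit(1)[OF \<nu> measurable_GL1 GL_range]) (use k in simp)
  show "rhoL k s 0 = 1" by (simp add: rhoL_def GL_def \<rho>_0 N.prob_space)
  show "levy_int \<alpha> (\<lambda>x. exp (- j * x) * rhoL k s x) < \<infinity>" if "0 < j" for j
    unfolding levy_int_scale[OF that k s] using levy_int_rhoR_finite[OF that k, of "1 / s"] s
    by (simp add: ennreal_mult_less_top)
qed

lemma Phi_scale: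
  assumes "0 < j" "0 < k" "0 < s"
  shows "Phi \<alpha> (rhoL k s) j = lam * s powr \<alpha> * Phi \<alpha> (rhoR j (1 / s)) k"
  unfolding Phi_def levy_int_scale[OF assms] using lam_pos by (simp add: enn2real_mult)

text \<open>The test functional of the image law is the integral of \<open>VL s\<close> against
  ds/s, up to \<open>wt_mass\<close>. For the density, \<open>VR r\<close> with weight r^(\<theta> -
  1) plays this part.\<close>

definition VL :: "real \<Rightarrow> ennreal" where
  "VL s = (\<integral>\<^sup>+u\<in>{0<..}. wt \<theta> u * (\<integral>\<^sup>+q. ennreal (iprod (\<lambda>i. GL 1 s (u * fst q i) (snd q i)) - iprod (\<lambda>i. GL 2 s (u * fst q i) (snd q i))) \<partial>(PD \<alpha> \<theta> \<Otimes>\<^sub>M iid \<nu>)) \<partial>lborel)"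

definition VR :: "real \<Rightarrow> ennreal" where
  "VR r = (\<integral>\<^sup>+u\<in>{0<..}. wt \<theta> u * (\<integral>\<^sup>+q. ennreal (iprod (\<lambda>i. GR 1 r (u * fst q i) (snd q i)) - iprod (\<lambda>i. GR 2 r (u * fst q i) (snd q i))) \<partial>(PD \<alpha> \<theta> \<Otimes>\<^sub>M iid \<nu>\<^sub>\<alpha>)) \<partial>lborel)"

lemma GL_antimono: "GL 2 s x \<xi> \<le> GL 1 s x \<xi>"
  unfolding GL_def using R.\<rho>_nonneg by (intro mult_right_mono) auto

lemma GR_antimono: "GR 2 s x \<xi> \<le> GR 1 s x \<xi>"
proof -
  have "exp (- 2 * \<bar>s * x / f \<xi>\<bar>) \<le> exp (- 1 * \<bar>s * x / f \<xi>\<bar>)"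
    unfolding exp_le_cancel_iff by (rule mult_right_mono) auto
  then show ?thesis unfolding GR_def using R.\<rho>_nonneg by (intro mult_left_mono)
qed

text \<open>Each side is a second difference of \<open>Dfun\<close> over a two by two table of
  exponents indexed by k and j. The scaling identity transposes the table, which a second difference
  ignores, and multiplies every entry by \<open>lam * s powr \<alpha>\<close>, which comes out as a
  power.\<close>

lemma VL_eq_VR:
  assumes s: "0 < s"
  shows "VL s = ennreal (lam powr (- \<theta> / \<alpha>) * s powr (- \<theta>)) * VR (1 / s)"
proof -
  have s': "0 < 1 / s" using s by simp
  have VL: "VL s = ennreal (Ddiff \<alpha> \<theta> (Phi \<alpha> (rhoL 1 s) 1) (Phi \<alpha> (rhoL 1 s) 2) (Phi \<alpha> (rhoL 2 s) 1) (Phi \<alpha> (rhoL 2 s) 2))"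
    unfolding VL_def rhoL_def[abs_def]
    by (rule marked_mellin_identity[OF \<theta> \<nu> measurable_GL measurable_GL])
      (use GL_range GL_antimono pd_full_rhoL[of _ s] s in \<open>auto simp: rhoL_def[abs_def]\<close>)
  have mR: "case_prod (GR j r) \<in> borel_measurable (borel \<Otimes>\<^sub>M \<nu>\<^sub>\<alpha>)" for j r
    using measurable_GR by simp
  have VR: "VR (1 / s) = ennreal (Ddiff \<alpha> \<theta> (Phi \<alpha> (rhoR 1 (1 / s)) 1) (Phi \<alpha> (rhoR 1 (1 / s)) 2) (Phi \<alpha> (rhoR 2 (1 / s)) 1) (Phi \<alpha> (rhoR 2 (1 / s)) 2))"
    unfolding VR_def rhoR_def[abs_def]
    by (rule marked_mellin_identity[OF \<theta> prob_space_tilted mR mR])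
      (use GR_range GR_antimono pd_full_rhoR[of _ "1 / s"] s in \<open>auto simp: rhoR_def[abs_def]\<close>)
  have pos: "0 < Phi \<alpha> (rhoR j (1 / s)) k" if "0 < j" "0 < k" for j k
  proof -
    interpret pd_full \<alpha> "rhoR j (1 / s)" by (rule pd_full_rhoR[OF that(1) s'])
    show ?thesis by (rule Phi_pos[OF that(2)])
  qed
  have "VL s = ennreal ((lam * s powr \<alpha>) powr (- \<theta> / \<alpha>) * Ddiff \<alpha> \<theta> (Phi \<alpha> (rhoR 1 (1 / s)) 1) (Phi \<alpha> (rhoR 2 (1 / s)) 1) (Phi \<alpha> (rhoR 1 (1 / s)) 2) (Phi \<alpha> (rhoR 2 (1 / s)) 2))"
    unfolding VL using s lam_pos pos by (simp add: Phi_scale Ddiff_scale)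
  also have "(lam * s powr \<alpha>) powr (- \<theta> / \<alpha>) = lam powr (- \<theta> / \<alpha>) * s powr (- \<theta>)"
    using lam_pos s \<alpha>_pos by (simp add: powr_mult powr_powr)
  also have "ennreal (\<dots> * Ddiff \<alpha> \<theta> (Phi \<alpha> (rhoR 1 (1 / s)) 1) (Phi \<alpha> (rhoR 2 (1 / s)) 1) (Phi \<alpha> (rhoR 1 (1 / s)) 2) (Phi \<alpha> (rhoR 2 (1 / s)) 2)) =
    ennreal (lam powr (- \<theta> / \<alpha>) * s powr (- \<theta>)) * VR (1 / s)"
    unfolding VR by (subst Ddiff_commute) (simp add: ennreal_mult')
  finally show ?thesis .
qed

end

section \<open>The image law and its density\<close>

text \<open>The price of the auxiliary scale u: a constant common to both sides, cancelled at the
  end because it is positive and finite.\<close>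

definition wt_mass :: "real \<Rightarrow> ennreal" where
  "wt_mass \<theta> = (\<integral>\<^sup>+u\<in>{0<..}. wt \<theta> u \<partial>lborel)"

lemma wt_mass:
  assumes "- 1 < \<theta>"
  shows "wt_mass \<theta> \<noteq> 0" "wt_mass \<theta> \<noteq> \<top>"
proof -
  have pos: "0 < u powr (\<theta> - 1) * (exp (- u) - exp (- 2 * u))" if "0 < u" for u :: real using that by simp
  show "wt_mass \<theta> \<noteq> 0"
  proof
    assume "wt_mass \<theta> = 0"
    then have "AE u in lborel. wt \<theta> u * indicator {0<..} u = 0"
      unfolding wt_mass_def by (subst (asm) nn_integral_0_iff_AE) auto
    then have "AE u in lborel. u \<notin> {0<..<1::real}"
    proof eventually_elim
      case (elim u)
      show ?case
      proof
        assume u: "u \<in> {0<..<1}"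
        then have "u powr (\<theta> - 1) * (exp (- u) - exp (- 2 * u)) \<le> 0"
          using elim by (auto simp: ennreal_eq_0_iff wt_def)
        moreover have "0 < u" using u by simp
        ultimately show False using pos[of u] by linarith
      qed
    qed
    then have "emeasure lborel {0<..<1::real} = 0"
      by (subst (asm) AE_iff_measurable[where N = "{0<..<1}"]) auto
    then show False by simp
  qed
  have "wt_mass \<theta> \<le> (\<integral>\<^sup>+u\<in>{0<..}. ennreal (u powr (\<theta> + 1 - 1) * exp (- 1 * u)) \<partial>lborel)"
    unfolding wt_mass_def wt_def
  proof (intro nn_integral_mono)
    fix u :: real
    have "u powr (\<theta> - 1) * (exp (- u) - exp (- 2 * u)) \<le> u powr (\<theta> + 1 - 1) * exp (- 1 * u)" if "0 < u"
    proof -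
      have "exp (- u) - exp (- 2 * u) = exp (- u) * (1 - exp (- u))"
        by (simp add: right_diff_distrib exp_add[symmetric])
      also have "\<dots> \<le> exp (- u) * u"
        using exp_ge_add_one_self[of "- u"] by (intro mult_left_mono) auto
      finally have "u powr (\<theta> - 1) * (exp (- u) - exp (- 2 * u)) \<le> u powr (\<theta> - 1) * (exp (- u) * u)"
        by (rule mult_left_mono) simp
      also have "\<dots> = u powr (\<theta> + 1 - 1) * exp (- 1 * u)" using that by (simp add: powr_diff)
      finally show ?thesis .
    qed
    then show "ennreal (u powr (\<theta> - 1) * (exp (- u) - exp (- 2 * u))) * indicator {0<..} u \<le> ennreal (u powr (\<theta> + 1 - 1) * exp (- 1 * u)) * indicator {0<..} u"
      by (auto simp: indicator_def intro!: ennreal_leI)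
  qed
  also have "\<dots> = ennreal (Gamma (\<theta> + 1))" using nn_integral_Gamma[of "\<theta> + 1" 1] assms by simp
  finally show "wt_mass \<theta> \<noteq> \<top>" by (auto simp: top_unique)
qed

lemma nn_integral_swap_scales:
  fixes B :: "real \<Rightarrow> real \<Rightarrow> 'q \<Rightarrow> ennreal"
  assumes Q: "prob_space Q" and B [measurable]: "(\<lambda>(s, u, q). B s u q) \<in> borel_measurable (borel \<Otimes>\<^sub>M (borel \<Otimes>\<^sub>M Q))"
    and k [measurable]: "k \<in> borel_measurable borel"
  shows "(\<integral>\<^sup>+q. (\<integral>\<^sup>+s\<in>{0<..}. k s * (\<integral>\<^sup>+u\<in>{0<..}. wt \<theta> u * B s u q \<partial>lborel) \<partial>lborel) \<partial>Q) =
    (\<integral>\<^sup>+s\<in>{0<..}. k s * (\<integral>\<^sup>+u\<in>{0<..}. wt \<theta> u * (\<integral>\<^sup>+q. B s u q \<partial>Q) \<partial>lborel) \<partial>lborel)"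
proof -
  interpret Q: prob_space Q by fact
  interpret pair_sigma_finite lborel Q ..
  have Bs: "(\<lambda>(u, q). B s u q) \<in> borel_measurable (borel \<Otimes>\<^sub>M Q)" for s
    using measurable_compose[OF measurable_Pair1' B, of s] by simp
  have Bsu: "B s u \<in> borel_measurable Q" for s u
    using measurable_compose[OF measurable_Pair1' Bs, of u s] by simp
  have Bm: "(\<lambda>((q, s), u). B s u q) \<in> borel_measurable ((Q \<Otimes>\<^sub>M borel) \<Otimes>\<^sub>M borel)"
    "(\<lambda>((s, q), u). B s u q) \<in> borel_measurable ((borel \<Otimes>\<^sub>M Q) \<Otimes>\<^sub>M borel)"
  proof -
    have "(\<lambda>x. (snd (fst x), snd x, fst (fst x))) \<in> measurable ((Q \<Otimes>\<^sub>M borel) \<Otimes>\<^sub>M borel) (borel \<Otimes>\<^sub>M (borel \<Otimes>\<^sub>M Q))" by measurable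
    from measurable_compose[OF this B] show "(\<lambda>((q, s), u). B s u q) \<in> borel_measurable ((Q \<Otimes>\<^sub>M borel) \<Otimes>\<^sub>M borel)"
      by (simp add: split_beta')
    have "(\<lambda>x. (fst (fst x), snd x, snd (fst x))) \<in> measurable ((borel \<Otimes>\<^sub>M Q) \<Otimes>\<^sub>M borel) (borel \<Otimes>\<^sub>M (borel \<Otimes>\<^sub>M Q))" by measurable
    from measurable_compose[OF this B] show "(\<lambda>((s, q), u). B s u q) \<in> borel_measurable ((borel \<Otimes>\<^sub>M Q) \<Otimes>\<^sub>M borel)"
      by (simp add: split_beta')
  qed
  note [measurable] = Bm[unfolded split_beta'] Bs[unfolded split_beta'] Bsu
  have "(\<integral>\<^sup>+q. (\<integral>\<^sup>+s\<in>{0<..}. k s * (\<integral>\<^sup>+u\<in>{0<..}. wt \<theta> u * B s u q \<partial>lborel) \<partial>lborel) \<partial>Q) =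
     (\<integral>\<^sup>+s. (\<integral>\<^sup>+q. k s * (\<integral>\<^sup>+u\<in>{0<..}. wt \<theta> u * B s u q \<partial>lborel) * indicator {0<..} s \<partial>Q) \<partial>lborel)"
    by (rule Fubini') measurable
  also have "\<dots> = (\<integral>\<^sup>+s\<in>{0<..}. k s * (\<integral>\<^sup>+u\<in>{0<..}. wt \<theta> u * (\<integral>\<^sup>+q. B s u q \<partial>Q) \<partial>lborel) \<partial>lborel)"
  proof (rule nn_integral_cong)
    fix s
    have m: "(\<lambda>q. \<integral>\<^sup>+u\<in>{0<..}. wt \<theta> u * B s u q \<partial>lborel) \<in> borel_measurable Q"
      using Bs[of s] by measurable
    have "(\<integral>\<^sup>+q. (\<integral>\<^sup>+u. wt \<theta> u * B s u q * indicator {0<..} u \<partial>lborel) \<partial>Q) = (\<integral>\<^sup>+u. (\<integral>\<^sup>+q. wt \<theta> u * B s u q * indicator {0<..} u \<partial>Q) \<partial>lborel)"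
      using Bs[of s] by (intro Fubini') measurable
    also have "\<dots> = (\<integral>\<^sup>+u\<in>{0<..}. wt \<theta> u * (\<integral>\<^sup>+q. B s u q \<partial>Q) \<partial>lborel)"
      by (intro nn_integral_cong) (simp add: nn_integral_multc nn_integral_cmult Bsu)
    finally show "(\<integral>\<^sup>+q. k s * (\<integral>\<^sup>+u\<in>{0<..}. wt \<theta> u * B s u q \<partial>lborel) * indicator {0<..} s \<partial>Q) =
       k s * (\<integral>\<^sup>+u\<in>{0<..}. wt \<theta> u * (\<integral>\<^sup>+q. B s u q \<partial>Q) \<partial>lborel) * indicator {0<..} s"
      using m by (simp add: nn_integral_multc nn_integral_cmult)
  qed
  finally show ?thesis .
qed

section \<open>Change of variables for a fixed sequence and fixed marks\<close>

definition test_integral :: "(real \<Rightarrow> real) \<Rightarrow> (nat \<Rightarrow> real) \<Rightarrow> ennreal" where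
  "test_integral \<rho> p = (\<integral>\<^sup>+t. ennreal (iprod (\<lambda>i. \<rho> (t * p i))) \<partial>kap)"

context pd_test
begin

lemma test_integral_eq:
  "test_integral \<rho> p = (\<integral>\<^sup>+t\<in>{0<..}. ennreal ((exp (- t) - exp (- 2 * t)) / t) * ennreal (iprod (\<lambda>i. \<rho> (t * p i))) \<partial>lborel)"
  unfolding test_integral_def by (rule nn_integral_kap) measurable

text \<open>With a_i = f(\<xi>_i) p_i, total S0 and v = a / S0, the products are exp(-k u S0 s)
  times the product of \<rho>(u S0 s v_i). Substituting t = u S0 s and using the invariance of ds/s
  removes u and S0, so the u-integral contributes only \<open>wt_mass\<close>.\<close>

lemma S_map_identity:
  assumes p: "p \<in> nabla" "\<And>i. 0 < p i"
  shows "wt_mass \<theta> * (test_integral \<rho> (S_map f \<xi> p) * indicator nabla (S_map f \<xi> p)) =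
    (\<integral>\<^sup>+s\<in>{0<..}. ennreal (1 / s) * (\<integral>\<^sup>+u\<in>{0<..}. wt \<theta> u * ennreal (iprod (\<lambda>i. GL 1 s (u * p i) (\<xi> i)) - iprod (\<lambda>i. GL 2 s (u * p i) (\<xi> i))) \<partial>lborel) \<partial>lborel)"
    (is "?L = ?R")
proof -
  define a where "a i = f (\<xi> i) * p i" for i
  have a: "0 < a i" for i using p(2)[of i] f_pos[of "\<xi> i"] by (simp add: a_def)
  have S: "S_map f \<xi> p = desc (\<lambda>i. a i / (\<Sum>j. a j))" by (simp add: S_map_def a_def)
  have GL: "iprod (\<lambda>i. GL k s (u * p i) (\<xi> i)) = iprod (\<lambda>i. exp (- (k * s * u * a i))) * iprod (\<lambda>i. \<rho> (s * u * a i))"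
    if "0 < k" "0 < s" "0 < u" for k s u
  proof -
    have "GL k s (u * p i) (\<xi> i) = exp (- (k * s * u * a i)) * \<rho> (s * u * a i)" for i
    proof -
      have 1: "s * f (\<xi> i) * (u * p i) = s * u * a i" by (simp add: a_def)
      have "0 \<le> s * u * a i" using that a[of i] by (simp add: less_imp_le)
      then show ?thesis unfolding GL_def 1 by (simp add: mult.assoc)
    qed
    then show ?thesis
      using that a by (simp only:) (intro iprod_mult R.\<rho>_range, auto simp: less_imp_le)
  qed
  show ?thesis
  proof (cases "summable a")
    \<comment> \<open>Divergent normaliser: the exponential products vanish on the right, and the
      normalised sequence leaves \<open>nabla\<close> on the left.\<close>
    case False
    have "iprod (\<lambda>i. exp (- (k * s * u * a i))) = 0" if "0 < k" "0 < s" "0 < u" for k s u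
    proof (rule iprod_exp_not_summable)
      show "\<not> summable (\<lambda>i. k * s * u * a i)" using False that by (subst summable_cmult_iff) auto
    qed (use that a in \<open>simp add: less_imp_le\<close>)
    then have "iprod (\<lambda>i. GL k s (u * p i) (\<xi> i)) = 0" if "0 < k" "0 < s" "0 < u" for k s u
      unfolding GL[OF that] using that by simp
    then have z: "wt \<theta> u * ennreal (iprod (\<lambda>i. GL 1 s (u * p i) (\<xi> i)) - iprod (\<lambda>i. GL 2 s (u * p i) (\<xi> i))) * indicator {0<..} u = 0" if "0 < s" for s u
      using that by (cases "0 < u") auto
    have "(\<integral>\<^sup>+u\<in>{0<..}. wt \<theta> u * ennreal (iprod (\<lambda>i. GL 1 s (u * p i) (\<xi> i)) - iprod (\<lambda>i. GL 2 s (u * p i) (\<xi> i))) \<partial>lborel) = 0" if "0 < s" for s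
      by (simp only: z[OF that] nn_integral_const mult_zero_left)
    then have z': "ennreal (1 / s) * (\<integral>\<^sup>+u\<in>{0<..}. wt \<theta> u * ennreal (iprod (\<lambda>i. GL 1 s (u * p i) (\<xi> i)) - iprod (\<lambda>i. GL 2 s (u * p i) (\<xi> i))) \<partial>lborel) * indicator {0<..} s = 0" for s
      by (cases "0 < s") auto
    have "?R = 0" by (simp only: z' nn_integral_const mult_zero_left)
    moreover have "S_map f \<xi> p \<notin> nabla"
      unfolding S by (rule desc_not_in_nabla) (use a False in auto)
    ultimately show ?thesis by simp
  next
    case True
    define S0 where "S0 = suminf a"
    have S0: "0 < S0" unfolding S0_def using True a by (intro suminf_pos) auto
    define v where "v i = a i / S0" for i
    have v: "0 < v i" for i using a[of i] S0 by (simp add: v_def)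
    have "v sums (S0 / S0)" unfolding v_def using True by (intro sums_divide) (simp add: S0_def summable_sums)
    then have v1: "v sums 1" using S0 by simp
    have Sv: "S_map f \<xi> p = desc v" unfolding S v_def S0_def ..
    obtain \<pi> where \<pi>: "bij \<pi>" "desc v = v \<circ> \<pi>"
      using desc_positive_null[OF v summable_LIMSEQ_zero[OF sums_summable[OF v1]]] by blast
    have "iprod (\<lambda>i. \<rho> (t * desc v i)) = iprod (\<lambda>i. \<rho> (t * v i))" for t
      using iprod_bij[of "\<lambda>i. \<rho> (t * v i)" \<pi>, OF R.\<rho>_range \<pi>(1)] by (simp add: \<pi>(2) o_def)
    then have L: "?L = wt_mass \<theta> * test_integral \<rho> v"
      unfolding Sv test_integral_def using desc_in_nabla[OF v v1] by simp
    have diff: "iprod (\<lambda>i. GL 1 s (u * p i) (\<xi> i)) - iprod (\<lambda>i. GL 2 s (u * p i) (\<xi> i)) =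
       (exp (- (u * S0 * s)) - exp (- 2 * (u * S0 * s))) * iprod (\<lambda>i. \<rho> (u * S0 * s * v i))" if "0 < s" "0 < u" for s u
    proof -
      have e: "iprod (\<lambda>i. exp (- (k * s * u * a i))) = exp (- (k * (u * S0 * s)))" for k
        using iprod_exp_summable[OF summable_mult[OF True, of "k * s * u"]] suminf_mult[OF True, of "k * s * u"]
        by (simp add: S0_def ac_simps)
      have v': "s * u * a i = u * S0 * s * v i" for i using S0 by (simp add: v_def)
      have "iprod (\<lambda>i. GL k s (u * p i) (\<xi> i)) = exp (- (k * (u * S0 * s))) * iprod (\<lambda>i. \<rho> (u * S0 * s * v i))" if "0 < k" for k
        unfolding GL[OF that \<open>0 < s\<close> \<open>0 < u\<close>] e by (simp only: v')
      from this[of 1] this[of 2] show ?thesis by (simp add: left_diff_distrib)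
    qed
    let ?h = "\<lambda>s u. ennreal (1 / s) * (ennreal ((exp (- (u * S0 * s)) - exp (- 2 * (u * S0 * s))) * iprod (\<lambda>i. \<rho> (u * S0 * s * v i))))"
    have inner: "(\<integral>\<^sup>+s\<in>{0<..}. ?h s u \<partial>lborel) = test_integral \<rho> v" if u: "0 < u" for u
    proof -
      have uS: "0 < u * S0" using u S0 by simp
      have "test_integral \<rho> v = ennreal (u * S0) * (\<integral>\<^sup>+s\<in>{0<..}. ennreal ((exp (- (u * S0 * s)) - exp (- 2 * (u * S0 * s))) / (u * S0 * s)) * ennreal (iprod (\<lambda>i. \<rho> (u * S0 * s * v i))) \<partial>lborel)"
        unfolding test_integral_eq by (rule nn_integral_scale_pos[OF _ uS]) measurable
      also have "\<dots> = (\<integral>\<^sup>+s. ennreal (u * S0) * (ennreal ((exp (- (u * S0 * s)) - exp (- 2 * (u * S0 * s))) / (u * S0 * s)) * ennreal (iprod (\<lambda>i. \<rho> (u * S0 * s * v i))) * indicator {0<..} s) \<partial>lborel)"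
        by (rule nn_integral_cmult[symmetric]) measurable
      also have "\<dots> = (\<integral>\<^sup>+s\<in>{0<..}. ?h s u \<partial>lborel)"
      proof (rule nn_integral_cong)
        fix s :: real
        show "ennreal (u * S0) * (ennreal ((exp (- (u * S0 * s)) - exp (- 2 * (u * S0 * s))) / (u * S0 * s)) * ennreal (iprod (\<lambda>i. \<rho> (u * S0 * s * v i))) * indicator {0<..} s) = ?h s u * indicator {0<..} s"
        proof (cases "0 < s")
          case True
          let ?e = "exp (- (u * S0 * s)) - exp (- 2 * (u * S0 * s))" and ?i = "iprod (\<lambda>i. \<rho> (u * S0 * s * v i))"
          have i: "0 \<le> ?i" using iprod_range[of "\<lambda>i. \<rho> (u * S0 * s * v i)", OF R.\<rho>_range] by simp
          have e: "0 \<le> ?e" using True u S0 by simp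
          have d: "0 \<le> ?e / (u * S0 * s)" using e u S0 True by (intro divide_nonneg_pos) auto
          have "ennreal (u * S0) * (ennreal (?e / (u * S0 * s)) * ennreal ?i) = ennreal (u * S0 * (?e / (u * S0 * s) * ?i))"
            unfolding ennreal_mult[OF less_imp_le[OF uS] mult_nonneg_nonneg[OF d i]] ennreal_mult[OF d i] ..
          also have "u * S0 * (?e / (u * S0 * s) * ?i) = 1 / s * (?e * ?i)"
            using u S0 by simp
          also have "ennreal \<dots> = ennreal (1 / s) * ennreal (?e * ?i)"
            using e i True by (intro ennreal_mult) auto
          finally show ?thesis using True by simp
        qed simp
      qed
      finally show ?thesis ..
    qed
    have "?R = (\<integral>\<^sup>+s. (\<integral>\<^sup>+u. wt \<theta> u * ?h s u * indicator {0<..} s * indicator {0<..} u \<partial>lborel) \<partial>lborel)"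
    proof (rule nn_integral_cong)
      fix s :: real
      show "ennreal (1 / s) * (\<integral>\<^sup>+u\<in>{0<..}. wt \<theta> u * ennreal (iprod (\<lambda>i. GL 1 s (u * p i) (\<xi> i)) - iprod (\<lambda>i. GL 2 s (u * p i) (\<xi> i))) \<partial>lborel) * indicator {0<..} s =
         (\<integral>\<^sup>+u. wt \<theta> u * ?h s u * indicator {0<..} s * indicator {0<..} u \<partial>lborel)"
      proof (cases "0 < s")
        case True
        have "(\<integral>\<^sup>+u\<in>{0<..}. wt \<theta> u * ennreal (iprod (\<lambda>i. GL 1 s (u * p i) (\<xi> i)) - iprod (\<lambda>i. GL 2 s (u * p i) (\<xi> i))) \<partial>lborel) =
           (\<integral>\<^sup>+u\<in>{0<..}. wt \<theta> u * ennreal ((exp (- (u * S0 * s)) - exp (- 2 * (u * S0 * s))) * iprod (\<lambda>i. \<rho> (u * S0 * s * v i))) \<partial>lborel)"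
          using diff[OF True] by (intro nn_integral_cong) (simp add: indicator_def)
        then show ?thesis using True
          by (simp add: nn_integral_cmult[symmetric] mult.assoc mult.left_commute)
      qed simp
    qed
    also have "\<dots> = (\<integral>\<^sup>+u. (\<integral>\<^sup>+s. wt \<theta> u * ?h s u * indicator {0<..} s * indicator {0<..} u \<partial>lborel) \<partial>lborel)"
      by (rule lborel_pair.Fubini') measurable
    also have "\<dots> = (\<integral>\<^sup>+u. wt \<theta> u * indicator {0<..} u * test_integral \<rho> v \<partial>lborel)"
    proof (rule nn_integral_cong)
      fix u :: real
      show "(\<integral>\<^sup>+s. wt \<theta> u * ?h s u * indicator {0<..} s * indicator {0<..} u \<partial>lborel) = wt \<theta> u * indicator {0<..} u * test_integral \<rho> v"
      proof (cases "0 < u")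
        case True
        have "(\<integral>\<^sup>+s. wt \<theta> u * ?h s u * indicator {0<..} s * indicator {0<..} u \<partial>lborel) = (\<integral>\<^sup>+s. wt \<theta> u * (?h s u * indicator {0<..} s) \<partial>lborel)"
          using True by (simp add: mult.assoc)
        also have "\<dots> = wt \<theta> u * (\<integral>\<^sup>+s\<in>{0<..}. ?h s u \<partial>lborel)"
          by (rule nn_integral_cmult) measurable
        finally show ?thesis using True inner[OF True] by simp
      qed simp
    qed
    also have "\<dots> = wt_mass \<theta> * test_integral \<rho> v"
      unfolding wt_mass_def by (rule nn_integral_multc) measurable
    finally show ?thesis using L by simp
  qed
qed

text \<open>Here u plays the part of t. The r-integral at scale u T equals (u T)^(-\<theta>) times
  \<open>wt_mass\<close>; its power of u combines with u^(\<theta> - 1) to du/u, which yields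
  \<open>kap\<close>, and T^(-\<theta>) remains.\<close>

lemma density_identity:
  assumes p: "p \<in> nabla"
  shows "wt_mass \<theta> * (ennreal (T p \<xi> powr (- \<theta>)) * test_integral \<rho> p) =
    (\<integral>\<^sup>+r\<in>{0<..}. ennreal (r powr (\<theta> - 1)) * (\<integral>\<^sup>+u\<in>{0<..}. wt \<theta> u * ennreal (iprod (\<lambda>i. GR 1 r (u * p i) (\<xi> i)) - iprod (\<lambda>i. GR 2 r (u * p i) (\<xi> i))) \<partial>lborel) \<partial>lborel)"
    (is "_ = ?R")
proof -
  have T: "0 < T p \<xi>" by (rule T_pos[OF p])
  have diff: "iprod (\<lambda>i. GR 1 r (u * p i) (\<xi> i)) - iprod (\<lambda>i. GR 2 r (u * p i) (\<xi> i)) =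
       iprod (\<lambda>i. \<rho> (u * p i)) * (exp (- (u * T p \<xi> * r)) - exp (- 2 * (u * T p \<xi> * r)))" if "0 < r" "0 < u" for r u
  proof -
    have "iprod (\<lambda>i. GR j r (u * p i) (\<xi> i)) = iprod (\<lambda>i. \<rho> (u * p i)) * exp (- (j * (u * T p \<xi> * r)))" if j: "0 < j" for j
    proof -
      let ?b = "\<lambda>i. inverse (f (\<xi> i)) * p i"
      have b: "0 \<le> ?b i" for i using p f_pos[of "\<xi> i"] by (simp add: nabla_def less_imp_le)
      have "GR j r (u * p i) (\<xi> i) = \<rho> (u * p i) * exp (- (j * r * u * ?b i))" for i
      proof -
        have 1: "r * (u * p i) / f (\<xi> i) = r * u * ?b i" by (simp add: field_simps)
        have "0 \<le> r * u * ?b i" using \<open>0 < r\<close> \<open>0 < u\<close> b[of i] by simp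
        then show ?thesis unfolding GR_def 1 by (simp add: mult.assoc)
      qed
      then have "iprod (\<lambda>i. GR j r (u * p i) (\<xi> i)) = iprod (\<lambda>i. \<rho> (u * p i)) * iprod (\<lambda>i. exp (- (j * r * u * ?b i)))"
        using j \<open>0 < r\<close> \<open>0 < u\<close> b by (simp only:) (intro iprod_mult R.\<rho>_range, auto)
      also have "iprod (\<lambda>i. exp (- (j * r * u * ?b i))) = exp (- (j * (u * T p \<xi> * r)))"
        using iprod_exp_summable[OF summable_mult[OF T_summable[OF p, of \<xi>], of "j * r * u"]]
          suminf_mult[OF T_summable[OF p, of \<xi>], of "j * r * u"]
        by (simp add: T_def ac_simps)
      finally show ?thesis .
    qed
    from this[of 1] this[of 2] show ?thesis by (simp add: right_diff_distrib)
  qed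
  let ?e = "\<lambda>r u. ennreal (r powr (\<theta> - 1) * (exp (- (u * T p \<xi> * r)) - exp (- 2 * (u * T p \<xi> * r))))"
  let ?i = "\<lambda>u. ennreal (iprod (\<lambda>i. \<rho> (u * p i)))"
  have inner: "(\<integral>\<^sup>+r\<in>{0<..}. ?e r u \<partial>lborel) = ennreal ((u * T p \<xi>) powr (- \<theta>)) * wt_mass \<theta>" if u: "0 < u" for u
  proof -
    let ?c = "u * T p \<xi>"
    have c: "0 < ?c" using u T by simp
    have "wt_mass \<theta> = ennreal ?c * (\<integral>\<^sup>+r\<in>{0<..}. wt \<theta> (?c * r) \<partial>lborel)"
      unfolding wt_mass_def by (rule nn_integral_scale_pos[OF _ c]) measurable
    also have "(\<integral>\<^sup>+r\<in>{0<..}. wt \<theta> (?c * r) \<partial>lborel) = (\<integral>\<^sup>+r. ennreal (?c powr (\<theta> - 1)) * (?e r u * indicator {0<..} r) \<partial>lborel)"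
      using c by (intro nn_integral_cong) (auto simp: wt_def indicator_def powr_mult ennreal_mult'[symmetric] mult.assoc)
    also have "\<dots> = ennreal (?c powr (\<theta> - 1)) * (\<integral>\<^sup>+r\<in>{0<..}. ?e r u \<partial>lborel)"
      by (rule nn_integral_cmult) measurable
    finally have "ennreal (?c powr (- \<theta>)) * wt_mass \<theta> = (ennreal (?c powr (- \<theta>)) * (ennreal ?c * ennreal (?c powr (\<theta> - 1)))) * (\<integral>\<^sup>+r\<in>{0<..}. ?e r u \<partial>lborel)"
      by (simp only: mult.assoc)
    also have "ennreal (?c powr (- \<theta>)) * (ennreal ?c * ennreal (?c powr (\<theta> - 1))) = 1"
    proof -
      have "?c powr (- \<theta>) * (?c * ?c powr (\<theta> - 1)) = 1"
        using c u T by (simp add: powr_diff powr_minus field_simps)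
      then show ?thesis using c by (simp only: ennreal_mult[symmetric] powr_ge_zero less_imp_le mult_nonneg_nonneg) simp
    qed
    finally show ?thesis by simp
  qed
  have "?R = (\<integral>\<^sup>+r. (\<integral>\<^sup>+u. wt \<theta> u * ?i u * indicator {0<..} u * (?e r u * indicator {0<..} r) \<partial>lborel) \<partial>lborel)"
  proof (rule nn_integral_cong)
    fix r :: real
    show "ennreal (r powr (\<theta> - 1)) * (\<integral>\<^sup>+u\<in>{0<..}. wt \<theta> u * ennreal (iprod (\<lambda>i. GR 1 r (u * p i) (\<xi> i)) - iprod (\<lambda>i. GR 2 r (u * p i) (\<xi> i))) \<partial>lborel) * indicator {0<..} r =
      (\<integral>\<^sup>+u. wt \<theta> u * ?i u * indicator {0<..} u * (?e r u * indicator {0<..} r) \<partial>lborel)"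
    proof (cases "0 < r")
      case True
      have "ennreal (r powr (\<theta> - 1)) * (\<integral>\<^sup>+u\<in>{0<..}. wt \<theta> u * ennreal (iprod (\<lambda>i. GR 1 r (u * p i) (\<xi> i)) - iprod (\<lambda>i. GR 2 r (u * p i) (\<xi> i))) \<partial>lborel) =
        ennreal (r powr (\<theta> - 1)) * (\<integral>\<^sup>+u. wt \<theta> u * (?i u * ennreal (exp (- (u * T p \<xi> * r)) - exp (- 2 * (u * T p \<xi> * r)))) * indicator {0<..} u \<partial>lborel)"
        using diff[OF True] True T
        by (intro arg_cong[where f = "(*) _"] nn_integral_cong) (auto simp: indicator_def ennreal_mult'')
      also have "\<dots> = (\<integral>\<^sup>+u. ennreal (r powr (\<theta> - 1)) * (wt \<theta> u * (?i u * ennreal (exp (- (u * T p \<xi> * r)) - exp (- 2 * (u * T p \<xi> * r)))) * indicator {0<..} u) \<partial>lborel)"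
        by (rule nn_integral_cmult[symmetric]) measurable
      also have "\<dots> = (\<integral>\<^sup>+u. wt \<theta> u * ?i u * indicator {0<..} u * (?e r u * indicator {0<..} r) \<partial>lborel)"
        using True by (intro nn_integral_cong) (simp add: ennreal_mult' ac_simps)
      finally show ?thesis using True by simp
    qed simp
  qed
  also have "\<dots> = (\<integral>\<^sup>+u. (\<integral>\<^sup>+r. wt \<theta> u * ?i u * indicator {0<..} u * (?e r u * indicator {0<..} r) \<partial>lborel) \<partial>lborel)"
    by (rule lborel_pair.Fubini') measurable
  also have "\<dots> = (\<integral>\<^sup>+u. (wt_mass \<theta> * ennreal (T p \<xi> powr (- \<theta>))) * (ennreal ((exp (- u) - exp (- 2 * u)) / u) * ?i u * indicator {0<..} u) \<partial>lborel)"
  proof (rule nn_integral_cong)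
    fix u :: real
    have "(\<integral>\<^sup>+r. wt \<theta> u * ?i u * indicator {0<..} u * (?e r u * indicator {0<..} r) \<partial>lborel) = wt \<theta> u * ?i u * indicator {0<..} u * (\<integral>\<^sup>+r\<in>{0<..}. ?e r u \<partial>lborel)"
      by (rule nn_integral_cmult) measurable
    also have "\<dots> = (wt_mass \<theta> * ennreal (T p \<xi> powr (- \<theta>))) * (ennreal ((exp (- u) - exp (- 2 * u)) / u) * ?i u * indicator {0<..} u)"
    proof (cases "0 < u")
      case True
      have "wt \<theta> u * ennreal ((u * T p \<xi>) powr (- \<theta>)) = ennreal (T p \<xi> powr (- \<theta>)) * ennreal ((exp (- u) - exp (- 2 * u)) / u)"
      proof -
        have "u powr (\<theta> - 1) * (exp (- u) - exp (- 2 * u)) * (u * T p \<xi>) powr (- \<theta>) = T p \<xi> powr (- \<theta>) * ((exp (- u) - exp (- 2 * u)) / u)"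
          using True T by (simp add: powr_mult powr_diff powr_minus field_simps)
        then show ?thesis unfolding wt_def by (simp only: ennreal_mult''[symmetric] powr_ge_zero) (subst ennreal_mult', auto)
      qed
      note w = this
      have "wt \<theta> u * ?i u * (ennreal ((u * T p \<xi>) powr (- \<theta>)) * wt_mass \<theta>) =
          (wt \<theta> u * ennreal ((u * T p \<xi>) powr (- \<theta>))) * ?i u * wt_mass \<theta>"
        by (simp only: ac_simps)
      also have "\<dots> = (wt_mass \<theta> * ennreal (T p \<xi> powr (- \<theta>))) * (ennreal ((exp (- u) - exp (- 2 * u)) / u) * ?i u)"
        unfolding w by (simp only: ac_simps)
      finally show ?thesis using True inner[OF True] by simp
    qed simp
    finally show "(\<integral>\<^sup>+r. wt \<theta> u * ?i u * indicator {0<..} u * (?e r u * indicator {0<..} r) \<partial>lborel) =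
      (wt_mass \<theta> * ennreal (T p \<xi> powr (- \<theta>))) * (ennreal ((exp (- u) - exp (- 2 * u)) / u) * ?i u * indicator {0<..} u)" .
  qed
  also have "\<dots> = (wt_mass \<theta> * ennreal (T p \<xi> powr (- \<theta>))) * test_integral \<rho> p"
    unfolding test_integral_eq by (rule nn_integral_cmult) measurable
  finally show ?thesis by (simp add: mult.assoc)
qed

end

section \<open>Integrating over sequences and marks; equality of the two measures\<close>

context pd_tilt
begin

sublocale PD: prob_space "PD \<alpha> \<theta>" by (rule prob_space_PD[OF \<theta>])

sublocale I: prob_space "iid \<nu>" by (rule prob_space_PiM) (rule \<nu>)

sublocale IA: prob_space "iid \<nu>\<^sub>\<alpha>" by (rule prob_space_PiM) (rule prob_space_tilted)

lemma measurable_PD_fst [measurable]: "(\<lambda>q. fst q i) \<in> borel_measurable (PD \<alpha> \<theta> \<Otimes>\<^sub>M M)"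
  by (rule measurable_compose[OF measurable_fst measurable_coordinate_PD])

lemma measurable_mark [measurable]:
  "(\<lambda>q. f (snd q i)) \<in> borel_measurable (PD \<alpha> \<theta> \<Otimes>\<^sub>M iid \<nu>)"
  "(\<lambda>q. f (snd q i)) \<in> borel_measurable (PD \<alpha> \<theta> \<Otimes>\<^sub>M iid \<nu>\<^sub>\<alpha>)"
  by measurable

lemma measurable_S_map:
  "(\<lambda>q. S_map f (snd q) (fst q)) \<in> measurable (PD \<alpha> \<theta> \<Otimes>\<^sub>M iid \<nu>) borel"
  unfolding S_map_def
proof (rule measurable_compose[OF _ measurable_desc], rule measurable_coordinatewise_then_product)
  fix i
  show "(\<lambda>q. f (snd q i) * fst q i / (\<Sum>j. f (snd q j) * fst q j)) \<in> borel_measurable (PD \<alpha> \<theta> \<Otimes>\<^sub>M iid \<nu>)"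
    by measurable
qed

lemma measurable_T_pair:
  "(\<lambda>q. T (fst q) (snd q)) \<in> borel_measurable (PD \<alpha> \<theta> \<Otimes>\<^sub>M iid \<nu>\<^sub>\<alpha>)"
  unfolding T_def by measurable

text \<open>Working form of the density; \<open>gamma_mellin_expectation\<close> turns the mean into
  the expression of the statement. It is extended real because the mean could be infinite for some
  p.\<close>

definition dens :: "(nat \<Rightarrow> real) \<Rightarrow> ennreal" where
  "dens p = ennreal (lam powr (- \<theta> / \<alpha>)) * (\<integral>\<^sup>+\<xi>. ennreal (T p \<xi> powr (- \<theta>)) \<partial>iid \<nu>\<^sub>\<alpha>)"

lemma measurable_inner_dens:
  "(\<lambda>p. \<integral>\<^sup>+\<xi>. ennreal (T p \<xi> powr (- \<theta>)) \<partial>iid \<nu>\<^sub>\<alpha>) \<in> borel_measurable (PD \<alpha> \<theta>)"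
proof -
  have "(\<lambda>q. ennreal (T (fst q) (snd q) powr (- \<theta>))) \<in> borel_measurable (PD \<alpha> \<theta> \<Otimes>\<^sub>M iid \<nu>\<^sub>\<alpha>)"
    using measurable_T_pair by measurable
  from IA.borel_measurable_nn_integral_fst[OF this] show ?thesis by simp
qed

lemma measurable_dens [measurable]: "dens \<in> borel_measurable (PD \<alpha> \<theta>)"
  unfolding dens_def[abs_def] using measurable_inner_dens by measurable

text \<open>T is positive on \<open>nabla\<close>, so a strictly positive function is averaged.
  Hence the Poisson-Dirichlet law is absolutely continuous with respect to the image law.\<close>

lemma dens_pos:
  assumes p: "p \<in> nabla"
  shows "dens p \<noteq> 0"
proof
  assume "dens p = 0"
  then have "(\<integral>\<^sup>+\<xi>. ennreal (T p \<xi> powr (- \<theta>)) \<partial>iid \<nu>\<^sub>\<alpha>) = 0"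
    using lam_pos by (simp add: dens_def ennreal_eq_0_iff)
  then have "AE \<xi> in iid \<nu>\<^sub>\<alpha>. ennreal (T p \<xi> powr (- \<theta>)) = 0"
    by (subst (asm) nn_integral_0_iff_AE) auto
  then have "AE \<xi> in iid \<nu>\<^sub>\<alpha>. False"
    by eventually_elim (use T_pos[OF p] in \<open>simp add: ennreal_eq_0_iff less_imp_neq[symmetric]\<close>)
  then show False using IA.AE_False by simp
qed

lemma sets_S_image: "sets (S_image f \<nu> (PD \<alpha> \<theta>)) = sets (restrict_space borel nabla)"
  unfolding S_image_def by (rule sets_restrict_space_cong) simp

lemma nn_integral_S_image:
  assumes F: "F \<in> borel_measurable borel"
  shows "(\<integral>\<^sup>+p. F p \<partial>S_image f \<nu> (PD \<alpha> \<theta>)) =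
    (\<integral>\<^sup>+q. F (S_map f (snd q) (fst q)) * indicator nabla (S_map f (snd q) (fst q)) \<partial>(PD \<alpha> \<theta> \<Otimes>\<^sub>M iid \<nu>))"
proof -
  have [measurable]: "(\<lambda>p. F p * indicator nabla p) \<in> borel_measurable borel"
    using F by measurable
  have "(\<integral>\<^sup>+p. F p \<partial>S_image f \<nu> (PD \<alpha> \<theta>)) =
     (\<integral>\<^sup>+p. F p * indicator nabla p \<partial>distr (PD \<alpha> \<theta> \<Otimes>\<^sub>M iid \<nu>) borel (\<lambda>q. S_map f (snd q) (fst q)))"
    unfolding S_image_def split_beta' by (rule nn_integral_restrict_space) simp
  also have "\<dots> = (\<integral>\<^sup>+q. F (S_map f (snd q) (fst q)) * indicator nabla (S_map f (snd q) (fst q)) \<partial>(PD \<alpha> \<theta> \<Otimes>\<^sub>M iid \<nu>))"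
    by (rule nn_integral_distr[OF measurable_S_map]) measurable
  finally show ?thesis .
qed

text \<open>The bound 1 comes from dropping the indicator of \<open>nabla\<close>; finiteness is
  what \<open>nabla_measure_eqI\<close> asks for.\<close>

lemma finite_measure_S_image: "finite_measure (S_image f \<nu> (PD \<alpha> \<theta>))"
proof
  interpret pair_prob_space "PD \<alpha> \<theta>" "iid \<nu>" ..
  have "emeasure (S_image f \<nu> (PD \<alpha> \<theta>)) (space (S_image f \<nu> (PD \<alpha> \<theta>))) = (\<integral>\<^sup>+p. 1 \<partial>S_image f \<nu> (PD \<alpha> \<theta>))" by simp
  also have "\<dots> = (\<integral>\<^sup>+q. 1 * indicator nabla (S_map f (snd q) (fst q)) \<partial>(PD \<alpha> \<theta> \<Otimes>\<^sub>M iid \<nu>))"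
    by (rule nn_integral_S_image) simp
  also have "\<dots> \<le> (\<integral>\<^sup>+q. 1 \<partial>(PD \<alpha> \<theta> \<Otimes>\<^sub>M iid \<nu>))"
    by (intro nn_integral_mono) (simp add: indicator_def)
  also have "\<dots> = 1" using P.emeasure_space_1 by simp
  finally show "emeasure (S_image f \<nu> (PD \<alpha> \<theta>)) (space (S_image f \<nu> (PD \<alpha> \<theta>))) \<noteq> \<infinity>"
    by (auto simp: top_unique)
qed

end

context pd_test
begin

lemma measurable_test_integral: "test_integral \<rho> \<in> borel_measurable borel"
proof -
  interpret K: finite_measure kap by (rule finite_measure_kap)
  have "(\<lambda>x :: (nat \<Rightarrow> real) \<times> real. fst x i) \<in> borel_measurable (borel \<Otimes>\<^sub>M kap)" for i
    by (rule measurable_compose[OF measurable_fst measurable_coordinate_borel])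
  note [measurable] = this
  have "(\<lambda>x. ennreal (iprod (\<lambda>i. \<rho> (snd x * fst x i)))) \<in> borel_measurable (borel \<Otimes>\<^sub>M kap)"
    by measurable
  from K.borel_measurable_nn_integral_fst[OF this] show ?thesis
    unfolding test_integral_def[abs_def] by simp
qed

lemma test_integral_S_image:
  "wt_mass \<theta> * (\<integral>\<^sup>+p. test_integral \<rho> p \<partial>S_image f \<nu> (PD \<alpha> \<theta>)) = (\<integral>\<^sup>+s\<in>{0<..}. ennreal (1 / s) * VL s \<partial>lborel)"
proof -
  let ?Q = "PD \<alpha> \<theta> \<Otimes>\<^sub>M iid \<nu>"
  interpret pair_prob_space "PD \<alpha> \<theta>" "iid \<nu>" ..
  let ?B = "\<lambda>s u q. ennreal (iprod (\<lambda>i. GL 1 s (u * fst q i) (snd q i)) - iprod (\<lambda>i. GL 2 s (u * fst q i) (snd q i)))"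
  let ?F = "\<lambda>q. test_integral \<rho> (S_map f (snd q) (fst q)) * indicator nabla (S_map f (snd q) (fst q))"
  have "(\<lambda>p. test_integral \<rho> p * indicator nabla p) \<in> borel_measurable borel"
    using measurable_test_integral by measurable
  from measurable_compose[OF measurable_S_map this] have "?F \<in> borel_measurable ?Q" .
  then have "wt_mass \<theta> * (\<integral>\<^sup>+p. test_integral \<rho> p \<partial>S_image f \<nu> (PD \<alpha> \<theta>)) = (\<integral>\<^sup>+q. wt_mass \<theta> * ?F q \<partial>?Q)"
    unfolding nn_integral_S_image[OF measurable_test_integral] by (rule nn_integral_cmult[symmetric])
  also have "\<dots> = (\<integral>\<^sup>+q. (\<integral>\<^sup>+s\<in>{0<..}. ennreal (1 / s) * (\<integral>\<^sup>+u\<in>{0<..}. wt \<theta> u * ?B s u q \<partial>lborel) \<partial>lborel) \<partial>?Q)"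
  proof (rule nn_integral_cong_AE)
    \<comment> \<open>The sorting lemmas want strictly positive entries, which \<open>nabla\<close>
      grants only almost surely.\<close>
    have ae: "AE q in ?Q. \<forall>i. 0 < fst q i"
    proof (rule AE_pair_measure)
      show "{q \<in> space ?Q. \<forall>i. 0 < fst q i} \<in> sets ?Q" by measurable
      show "AE p in PD \<alpha> \<theta>. AE \<xi> in iid \<nu>. \<forall>i. 0 < fst (p, \<xi>) i"
        using AE_PD_pos[OF \<theta>] by eventually_elim simp
    qed
    have pt: "wt_mass \<theta> * ?F q = (\<integral>\<^sup>+s\<in>{0<..}. ennreal (1 / s) * (\<integral>\<^sup>+u\<in>{0<..}. wt \<theta> u * ?B s u q \<partial>lborel) \<partial>lborel)"
      if q: "q \<in> space ?Q" "\<forall>i. 0 < fst q i" for q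
    proof (rule S_map_identity)
      show "fst q \<in> nabla" using q(1) by (simp add: space_pair_measure space_PD mem_Times_iff)
    qed (use q(2) in blast)
    show "AE q in ?Q. wt_mass \<theta> * ?F q = (\<integral>\<^sup>+s\<in>{0<..}. ennreal (1 / s) * (\<integral>\<^sup>+u\<in>{0<..}. wt \<theta> u * ?B s u q \<partial>lborel) \<partial>lborel)"
      by (rule AE_mp[OF ae], rule AE_I2, rule impI, rule pt)
  qed
  also have "\<dots> = (\<integral>\<^sup>+s\<in>{0<..}. ennreal (1 / s) * VL s \<partial>lborel)"
    unfolding VL_def
  proof (rule nn_integral_swap_scales)
    show "(\<lambda>(s, u, q). ?B s u q) \<in> borel_measurable (borel \<Otimes>\<^sub>M (borel \<Otimes>\<^sub>M ?Q))"
      unfolding GL_def split_beta' by measurable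
    show "prob_space ?Q" by (rule P.prob_space_axioms)
  qed measurable
  finally show ?thesis .
qed

lemma test_integral_density:
  "wt_mass \<theta> * (\<integral>\<^sup>+p. test_integral \<rho> p \<partial>density (PD \<alpha> \<theta>) dens) =
    ennreal (lam powr (- \<theta> / \<alpha>)) * (\<integral>\<^sup>+r\<in>{0<..}. ennreal (r powr (\<theta> - 1)) * VR r \<partial>lborel)"
proof -
  let ?Q = "PD \<alpha> \<theta> \<Otimes>\<^sub>M iid \<nu>\<^sub>\<alpha>"
  interpret pair_prob_space "PD \<alpha> \<theta>" "iid \<nu>\<^sub>\<alpha>" ..
  let ?B = "\<lambda>r u q. ennreal (iprod (\<lambda>i. GR 1 r (u * fst q i) (snd q i)) - iprod (\<lambda>i. GR 2 r (u * fst q i) (snd q i)))"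
  let ?G = "\<lambda>q. ennreal (T (fst q) (snd q) powr (- \<theta>)) * test_integral \<rho> (fst q)"
  have tm [measurable]: "test_integral \<rho> \<in> borel_measurable (PD \<alpha> \<theta>)"
    using measurable_restrict_space1[OF measurable_test_integral] measurable_cong_sets[OF sets_PD refl] by blast
  have Gm: "?G \<in> borel_measurable ?Q"
    using measurable_T_pair measurable_compose[OF measurable_fst tm, of "iid \<nu>\<^sub>\<alpha>"] by measurable
  have "(\<integral>\<^sup>+p. test_integral \<rho> p \<partial>density (PD \<alpha> \<theta>) dens) = (\<integral>\<^sup>+p. dens p * test_integral \<rho> p \<partial>PD \<alpha> \<theta>)"
    by (rule nn_integral_density) measurable
  also have "\<dots> = (\<integral>\<^sup>+p. ennreal (lam powr (- \<theta> / \<alpha>)) * (\<integral>\<^sup>+\<xi>. ennreal (T p \<xi> powr (- \<theta>)) * test_integral \<rho> p \<partial>iid \<nu>\<^sub>\<alpha>) \<partial>PD \<alpha> \<theta>)"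
    unfolding dens_def by (intro nn_integral_cong) (simp add: nn_integral_multc mult.assoc)
  also have "\<dots> = ennreal (lam powr (- \<theta> / \<alpha>)) * (\<integral>\<^sup>+p. (\<integral>\<^sup>+\<xi>. ennreal (T p \<xi> powr (- \<theta>)) * test_integral \<rho> p \<partial>iid \<nu>\<^sub>\<alpha>) \<partial>PD \<alpha> \<theta>)"
    using IA.borel_measurable_nn_integral_fst[OF Gm] by (intro nn_integral_cmult) simp
  also have "(\<integral>\<^sup>+p. (\<integral>\<^sup>+\<xi>. ennreal (T p \<xi> powr (- \<theta>)) * test_integral \<rho> p \<partial>iid \<nu>\<^sub>\<alpha>) \<partial>PD \<alpha> \<theta>) = (\<integral>\<^sup>+q. ?G q \<partial>?Q)"
    using IA.nn_integral_fst[OF Gm] by simp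
  finally have "wt_mass \<theta> * (\<integral>\<^sup>+p. test_integral \<rho> p \<partial>density (PD \<alpha> \<theta>) dens) =
     ennreal (lam powr (- \<theta> / \<alpha>)) * (\<integral>\<^sup>+q. wt_mass \<theta> * ?G q \<partial>?Q)"
    using Gm by (simp add: nn_integral_cmult mult.left_commute)
  also have "(\<integral>\<^sup>+q. wt_mass \<theta> * ?G q \<partial>?Q) = (\<integral>\<^sup>+q. (\<integral>\<^sup>+r\<in>{0<..}. ennreal (r powr (\<theta> - 1)) * (\<integral>\<^sup>+u\<in>{0<..}. wt \<theta> u * ?B r u q \<partial>lborel) \<partial>lborel) \<partial>?Q)"
  proof (rule nn_integral_cong)
    fix q assume "q \<in> space ?Q"
    then have "fst q \<in> nabla" by (simp add: space_pair_measure space_PD mem_Times_iff)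
    then show "wt_mass \<theta> * ?G q = (\<integral>\<^sup>+r\<in>{0<..}. ennreal (r powr (\<theta> - 1)) * (\<integral>\<^sup>+u\<in>{0<..}. wt \<theta> u * ?B r u q \<partial>lborel) \<partial>lborel)"
      by (rule density_identity)
  qed
  also have "\<dots> = (\<integral>\<^sup>+r\<in>{0<..}. ennreal (r powr (\<theta> - 1)) * VR r \<partial>lborel)"
    unfolding VR_def
  proof (rule nn_integral_swap_scales)
    show "(\<lambda>(r, u, q). ?B r u q) \<in> borel_measurable (borel \<Otimes>\<^sub>M (borel \<Otimes>\<^sub>M ?Q))"
      unfolding GR_def split_beta' by measurable
    show "prob_space ?Q" by (rule P.prob_space_axioms)
  qed measurable
  finally show ?thesis .
qed

lemma measurable_VR [measurable]: "VR \<in> borel_measurable borel"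
proof -
  interpret pair_prob_space "PD \<alpha> \<theta>" "iid \<nu>\<^sub>\<alpha>" ..
  show ?thesis unfolding VR_def[abs_def] GR_def by measurable
qed

text \<open>With s = 1/r, the weight ds/s times the factor s^(-\<theta>) from
  \<open>VL_eq_VR\<close> becomes r^(\<theta> - 1) dr, the weight on the side of the
  density.\<close>

lemma test_integral_agree:
  "(\<integral>\<^sup>+p. test_integral \<rho> p \<partial>S_image f \<nu> (PD \<alpha> \<theta>)) = (\<integral>\<^sup>+p. test_integral \<rho> p \<partial>density (PD \<alpha> \<theta>) dens)"
proof -
  let ?g = "\<lambda>r. ennreal (r powr (\<theta> - 1)) * VR r"
  let ?l = "ennreal (lam powr (- \<theta> / \<alpha>))"
  have "(\<integral>\<^sup>+s\<in>{0<..}. ennreal (1 / s) * VL s \<partial>lborel) = (\<integral>\<^sup>+s. ?l * (?g (1 / s) * ennreal (1 / s\<^sup>2) * indicator {0<..} s) \<partial>lborel)"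
  proof (rule nn_integral_cong)
    fix s :: real
    show "ennreal (1 / s) * VL s * indicator {0<..} s = ?l * (?g (1 / s) * ennreal (1 / s\<^sup>2) * indicator {0<..} s)"
    proof (cases "0 < s")
      case True
      have "1 / s * (lam powr (- \<theta> / \<alpha>) * s powr (- \<theta>)) = lam powr (- \<theta> / \<alpha>) * ((1 / s) powr (\<theta> - 1) * (1 / s\<^sup>2))"
      proof -
        have "(1 / s) powr (\<theta> - 1) = s powr (1 - \<theta>)"
          using True by (simp add: powr_divide powr_minus_divide[symmetric])
        also have "\<dots> = s * s powr (- \<theta>)" using True powr_add[of s 1 "- \<theta>"] by simp
        finally show ?thesis using True by (simp add: power2_eq_square)
      qed
      then have "ennreal (1 / s) * ennreal (lam powr (- \<theta> / \<alpha>) * s powr (- \<theta>)) = ?l * (ennreal ((1 / s) powr (\<theta> - 1)) * ennreal (1 / s\<^sup>2))"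
        using True by (simp add: ennreal_mult[symmetric])
      then show ?thesis using True unfolding VL_eq_VR[OF True] by (simp add: mult.assoc[symmetric]) (simp add: ac_simps)
    qed simp
  qed
  also have "\<dots> = ?l * (\<integral>\<^sup>+s\<in>{0<..}. ?g (1 / s) * ennreal (1 / s\<^sup>2) \<partial>lborel)"
    by (rule nn_integral_cmult) measurable
  also have "(\<integral>\<^sup>+s\<in>{0<..}. ?g (1 / s) * ennreal (1 / s\<^sup>2) \<partial>lborel) = (\<integral>\<^sup>+r\<in>{0<..}. ?g r \<partial>lborel)"
    by (rule nn_integral_inverse_pos[symmetric]) measurable
  finally have "wt_mass \<theta> * (\<integral>\<^sup>+p. test_integral \<rho> p \<partial>S_image f \<nu> (PD \<alpha> \<theta>)) = wt_mass \<theta> * (\<integral>\<^sup>+p. test_integral \<rho> p \<partial>density (PD \<alpha> \<theta>) dens)"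
    unfolding test_integral_S_image test_integral_density .
  then show ?thesis
    using wt_mass[of \<theta>] \<theta> \<alpha>_less_1 by (subst (asm) ennreal_mult_cancel_left) auto
qed

end

context pd_tilt
begin

theorem S_image_eq_density: "S_image f \<nu> (PD \<alpha> \<theta>) = density (PD \<alpha> \<theta>) dens"
proof (rule nabla_measure_eqI)
  have agree: "(\<integral>\<^sup>+p. test_integral \<rho> p \<partial>S_image f \<nu> (PD \<alpha> \<theta>)) = (\<integral>\<^sup>+p. test_integral \<rho> p \<partial>density (PD \<alpha> \<theta>) dens)"
    if "\<rho> \<in> borel_measurable borel" "\<And>x. \<rho> x \<in> {0..1}" "\<rho> 0 = 1" "0 \<le> C" "\<And>x. 0 \<le> x \<Longrightarrow> 1 - \<rho> x \<le> C * x" for \<rho> C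
  proof -
    interpret pd_test \<alpha> \<nu> f c \<theta> \<rho> C by unfold_locales (use that in auto)
    show ?thesis by (rule test_integral_agree)
  qed
  then show "(\<integral>\<^sup>+p. (\<integral>\<^sup>+t. ennreal (iprod (\<lambda>i. \<rho> (t * p i))) \<partial>kap) \<partial>S_image f \<nu> (PD \<alpha> \<theta>)) = (\<integral>\<^sup>+p. (\<integral>\<^sup>+t. ennreal (iprod (\<lambda>i. \<rho> (t * p i))) \<partial>kap) \<partial>density (PD \<alpha> \<theta>) dens)"
    if "\<rho> \<in> borel_measurable borel" "\<And>x. \<rho> x \<in> {0..1}" "\<rho> 0 = 1" "0 \<le> C" "\<And>x. 0 \<le> x \<Longrightarrow> 1 - \<rho> x \<le> C * x" for \<rho> C
    using that unfolding test_integral_def by blast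
  show fin: "finite_measure (S_image f \<nu> (PD \<alpha> \<theta>))" by (rule finite_measure_S_image)
  show "finite_measure (density (PD \<alpha> \<theta>) dens)"
  proof
    let ?M = "density (PD \<alpha> \<theta>) dens"
    \<comment> \<open>For \<theta> > 0 integrability of the density is not evident, since T has no
      positive lower bound when f is unbounded. The constant test function 1 reads off total masses,
      and that of the image law is finite.\<close>
    have one: "test_integral (\<lambda>_. 1) p = emeasure kap UNIV" for p
      using iprod_eq_prod[of 0 "\<lambda>_. 1"] by (simp add: test_integral_def)
    have "emeasure kap UNIV * emeasure (S_image f \<nu> (PD \<alpha> \<theta>)) (space (S_image f \<nu> (PD \<alpha> \<theta>))) = emeasure kap UNIV * emeasure ?M (space ?M)"
      using agree[of "\<lambda>_. 1" 0] by (simp add: one)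
    then have "emeasure (S_image f \<nu> (PD \<alpha> \<theta>)) (space (S_image f \<nu> (PD \<alpha> \<theta>))) = emeasure ?M (space ?M)"
      using emeasure_kap by (subst (asm) ennreal_mult_cancel_left) auto
    then show "emeasure ?M (space ?M) \<noteq> \<infinity>"
      using finite_measure.emeasure_finite[OF fin, of "space (S_image f \<nu> (PD \<alpha> \<theta>))"] by simp
  qed
  show "sets (S_image f \<nu> (PD \<alpha> \<theta>)) = sets (restrict_space borel nabla)" by (rule sets_S_image)
  show "sets (density (PD \<alpha> \<theta>) dens) = sets (restrict_space borel nabla)" by (simp add: sets_PD)
qed

end

theorem theorem4p3:
  fixes \<nu>\<^sub>0 :: "'s::metric_space measure" and f :: "'s \<Rightarrow> real" and \<alpha> \<theta> :: real
  assumes "compact (UNIV :: 's set)"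
    and "prob_space \<nu>\<^sub>0" and "sets \<nu>\<^sub>0 = sets borel"
    and "0 < \<alpha>" and "\<alpha> < 1" and "- \<alpha> < \<theta>"
    and "f \<in> B_plus"
    and "integrable \<nu>\<^sub>0 (\<lambda>s. f s powr \<alpha>)"
  shows "absolutely_continuous (PD \<alpha> \<theta>) (S_image f \<nu>\<^sub>0 (PD \<alpha> \<theta>))
    \<and> absolutely_continuous (S_image f \<nu>\<^sub>0 (PD \<alpha> \<theta>)) (PD \<alpha> \<theta>)
    \<and> (AE p in PD \<alpha> \<theta>. RN_deriv (PD \<alpha> \<theta>) (S_image f \<nu>\<^sub>0 (PD \<alpha> \<theta>)) p =
         ennreal ((\<integral>s. f s powr \<alpha> \<partial>\<nu>\<^sub>0) powr (- \<theta> / \<alpha>)) *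
         gamma_mellin \<theta> (\<lambda>u. \<Prod>i. \<integral>s. exp (- u * inverse (f s) * p i) \<partial>(tilted f \<alpha> \<nu>\<^sub>0)))"
proof -
  obtain c where c: "0 < c" "\<And>s. c \<le> f s" and "f \<in> borel_measurable borel"
    using assms(7) by (auto simp: B_plus_def)
  then have f: "f \<in> borel_measurable \<nu>\<^sub>0"
    using measurable_cong_sets[OF assms(3) refl] by blast
  interpret pd_tilt \<alpha> \<nu>\<^sub>0 f c \<theta>
    by (intro pd_tilt.intro pd_index.intro pd_tilt_axioms.intro) (use assms c f in auto)
  have dens: "dens p = ennreal ((\<integral>s. f s powr \<alpha> \<partial>\<nu>\<^sub>0) powr (- \<theta> / \<alpha>)) *
      gamma_mellin \<theta> (\<lambda>u. \<Prod>i. \<integral>s. exp (- u * inverse (f s) * p i) \<partial>(tilted f \<alpha> \<nu>\<^sub>0))" if "p \<in> nabla" for p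
    unfolding dens_def gamma_mellin_expectation[OF that] lam_def ..
  have "AE p in PD \<alpha> \<theta>. dens p = RN_deriv (PD \<alpha> \<theta>) (S_image f \<nu>\<^sub>0 (PD \<alpha> \<theta>)) p"
    by (rule PD.RN_deriv_unique) (simp_all add: S_image_eq_density)
  then have "AE p in PD \<alpha> \<theta>. RN_deriv (PD \<alpha> \<theta>) (S_image f \<nu>\<^sub>0 (PD \<alpha> \<theta>)) p =
         ennreal ((\<integral>s. f s powr \<alpha> \<partial>\<nu>\<^sub>0) powr (- \<theta> / \<alpha>)) *
         gamma_mellin \<theta> (\<lambda>u. \<Prod>i. \<integral>s. exp (- u * inverse (f s) * p i) \<partial>(tilted f \<alpha> \<nu>\<^sub>0))"
    by (rule AE_mp) (rule AE_I2, use dens space_PD in auto)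
  moreover have "absolutely_continuous (PD \<alpha> \<theta>) (S_image f \<nu>\<^sub>0 (PD \<alpha> \<theta>))"
    unfolding S_image_eq_density by (rule absolutely_continuousI_density) simp
  moreover have "absolutely_continuous (S_image f \<nu>\<^sub>0 (PD \<alpha> \<theta>)) (PD \<alpha> \<theta>)"
    unfolding absolutely_continuous_def S_image_eq_density
  proof
    fix N assume N: "N \<in> null_sets (density (PD \<alpha> \<theta>) dens)"
    then have "AE p in PD \<alpha> \<theta>. p \<in> N \<longrightarrow> dens p = 0" and NS: "N \<in> sets (PD \<alpha> \<theta>)"
      by (auto simp: null_sets_density_iff)
    then have "AE p in PD \<alpha> \<theta>. p \<notin> N"
      by (auto intro: AE_mp AE_I2 simp: space_PD dens_pos)
    then show "N \<in> null_sets (PD \<alpha> \<theta>)" using NS by (simp add: AE_iff_null_sets)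
  qed
  ultimately show ?thesis by blast
qed

end
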